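(* Let $x \in \{0,1\}^n$ and $y \in \{0,1\}^m$ be binary strings. Then $\operatorname{DTW}(x,y)$ can be computed in time $O(n+m)$.
   Context: Strings are treated as time series over the alphabet $\{0,1\}$ with metric $d(a,b)=|a-b|$ (so $d(0,1)=1$, $d(a,a)=0$). The runs of a string are its maximal substrings consisting of a single repeated letter. A run is extended by further duplicating its letter; any string obtained from $x$ by extending runs of $x$ (each run may be extended by any nonnegative number of extra copies) is an expansion of $x$. A correspondence between $x$ and $y$ is a pair $(\overline{x},\overline{y})$ of equal-length expansions of $x$ and $y$; its value is $\sum_i d(\overline{x}_i,\overline{y}_i)$. The dynamic time warping distance $\operatorname{DTW}(x,y)$ is the minimum value over all correspondences between $x$ and $y$. Running time is measured in the standard RAM model. *)

theory Defs
  imports Complex_Main "HOL-Library.Landau_Symbols"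
begin

definition binary_strings :: "nat \<Rightarrow> nat list set" where
  "binary_strings n = {x. set x \<subseteq> {0, 1} \<and> length x = n}"

definition letter_dist :: "nat \<Rightarrow> nat \<Rightarrow> nat" where
  "letter_dist a b = nat \<bar>int a - int b\<bar>"

function runs :: "'a list \<Rightarrow> 'a list list" where
  "runs [] = []"
| "runs (a # x) = (a # takeWhile (\<lambda>b. b = a) x) # runs (dropWhile (\<lambda>b. b = a) x)"
  by pat_completeness auto
termination
  by (relation "measure length") (auto simp: less_Suc_eq_le length_dropWhile_le)

lemma concat_runs: "concat (runs x) = x"
  by (induction x rule: runs.induct) auto

lemma run_constant:
  assumes "r \<in> set (runs x)"
  shows "r \<noteq> [] \<and> set r = {hd r}"
  using assms
  by (induction x rule: runs.induct) (auto dest: set_takeWhileD)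

lemma hd_first_run: "x \<noteq> [] \<Longrightarrow> hd (runs x ! 0) = hd x"
  by (cases x) auto

lemma runs_maximal:
  assumes "Suc i < length (runs x)"
  shows "hd (runs x ! i) \<noteq> hd (runs x ! Suc i)"
  using assms
proof (induction x arbitrary: i rule: runs.induct)
  case 1
  then show ?case by simp
next
  case (2 a x)
  let ?d = "dropWhile (\<lambda>b. b = a) x"
  show ?case
  proof (cases i)
    case 0
    with 2 have "runs ?d \<noteq> []" by auto
    hence ne: "?d \<noteq> []" by (cases "?d") simp_all
    hence "hd ?d \<noteq> a" by (rule hd_dropWhile)
    moreover have "hd (runs ?d ! 0) = hd ?d"
      by (rule hd_first_run[OF ne])
    ultimately show ?thesis using 0 by simp
  next
    case (Suc j)
    with 2 show ?thesis by simp
  qed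
qed

definition expansions :: "'a list \<Rightarrow> 'a list set" where
  "expansions x =
     {concat (map2 (\<lambda>r k. r @ replicate k (hd r)) (runs x) ks) | ks.
        length ks = length (runs x)}"

definition correspondences :: "'a list \<Rightarrow> 'a list \<Rightarrow> ('a list \<times> 'a list) set" where
  "correspondences x y =
     {(x', y'). x' \<in> expansions x \<and> y' \<in> expansions y \<and> length x' = length y'}"

definition correspondence_value :: "nat list \<times> nat list \<Rightarrow> nat" where
  "correspondence_value = (\<lambda>(x', y'). \<Sum>i<length x'. letter_dist (x' ! i) (y' ! i))"

text \<open>
  The minimum exists iff there is a correspondence at all; this fails exactly when one of the two
  strings is empty and the other is not (lemma \<open>correspondences_nonempty_iff\<close>).
\<close>
definition dtw :: "nat list \<Rightarrow> nat list \<Rightarrow> nat" where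
  "dtw x y = (LEAST v. v \<in> correspondence_value ` correspondences x y)"

lemma expansions_Nil: "expansions [] = {[]}"
  by (auto simp: expansions_def)

lemma map2_extend_zero:
  "concat (map2 (\<lambda>r k. r @ replicate k (hd r)) rs (replicate (length rs) 0)) = concat rs"
  by (induction rs) auto

lemma expansion_of_length:
  assumes "x \<noteq> []"
  shows "\<exists>x' \<in> expansions x. length x' = length x + k"
proof -
  obtain r rs where r: "runs x = r # rs"
    using assms by (cases x) auto
  define ks where "ks = k # replicate (length rs) 0"
  have "concat (map2 (\<lambda>r k. r @ replicate k (hd r)) (runs x) ks) \<in> expansions x"
    unfolding expansions_def by (auto simp: ks_def r intro!: exI[of _ ks])
  moreover have "length x = length r + length (concat rs)"
    using concat_runs[of x] r by (metis concat.simps(2) length_append)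
  hence "length (concat (map2 (\<lambda>r k. r @ replicate k (hd r)) (runs x) ks)) = length x + k"
    by (simp add: ks_def r map2_extend_zero del: length_concat)
  ultimately show ?thesis by blast
qed

lemma Nil_in_expansions_iff: "[] \<in> expansions x \<longleftrightarrow> x = []"
proof
  assume "[] \<in> expansions x"
  thus "x = []"
    by (cases x) (auto simp: expansions_def length_Suc_conv)
qed (simp add: expansions_Nil)

lemma correspondences_nonempty_iff:
  "correspondences x y \<noteq> {} \<longleftrightarrow> (x = [] \<longleftrightarrow> y = [])"
proof
  assume "correspondences x y \<noteq> {}"
  thus "x = [] \<longleftrightarrow> y = []"
    by (auto simp: correspondences_def expansions_Nil Nil_in_expansions_iff)
next
  assume *: "x = [] \<longleftrightarrow> y = []"
  show "correspondences x y \<noteq> {}"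
  proof (cases "x = []")
    case True
    with * show ?thesis by (auto simp: correspondences_def expansions_Nil)
  next
    case False
    with * obtain x' y' where "x' \<in> expansions x" "length x' = length x + length y"
      "y' \<in> expansions y" "length y' = length y + length x"
      using expansion_of_length by meson
    hence "(x', y') \<in> correspondences x y" by (simp add: correspondences_def)
    thus ?thesis by blast
  qed
qed

text \<open>
  A unit-cost RAM with finitely many directly addressed registers (those named in the program)
  and a word-addressed memory. Words hold natural numbers, subtraction is truncated at \<open>0\<close>.
  There is no multiplication, division or bit operation, so that unit cost is
  uncontroversial.
\<close>
datatype ram_instr =
    Const nat nat
  | Move nat nat
  | Add nat nat nat
  | Sub nat nat nat
  | Load nat nat
  | Store nat nat
  | Jump nat
  | JumpLess nat nat nat

type_synonym ram_program = "ram_instr list"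

datatype ram_config = Config (pc: nat) (reg: "nat \<Rightarrow> nat") (mem: "nat \<Rightarrow> nat")

fun ram_exec :: "ram_instr \<Rightarrow> ram_config \<Rightarrow> ram_config" where
  "ram_exec (Const i k) (Config p R M) = Config (Suc p) (R(i := k)) M"
| "ram_exec (Move i j) (Config p R M) = Config (Suc p) (R(i := R j)) M"
| "ram_exec (Add i j k) (Config p R M) = Config (Suc p) (R(i := R j + R k)) M"
| "ram_exec (Sub i j k) (Config p R M) = Config (Suc p) (R(i := R j - R k)) M"
| "ram_exec (Load i j) (Config p R M) = Config (Suc p) (R(i := M (R j))) M"
| "ram_exec (Store i j) (Config p R M) = Config (Suc p) R (M(R i := R j))"
| "ram_exec (Jump l) (Config p R M) = Config l R M"
| "ram_exec (JumpLess i j l) (Config p R M) = Config (if R i < R j then l else Suc p) R M"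

definition ram_halted :: "ram_program \<Rightarrow> ram_config \<Rightarrow> bool" where
  "ram_halted P c \<longleftrightarrow> length P \<le> pc c"

definition ram_step :: "ram_program \<Rightarrow> ram_config \<Rightarrow> ram_config" where
  "ram_step P c = (if ram_halted P c then c else ram_exec (P ! pc c) c)"

definition fits_words :: "nat \<Rightarrow> ram_config \<Rightarrow> bool" where
  "fits_words w c \<longleftrightarrow> (\<forall>i. reg c i < 2 ^ w) \<and> (\<forall>a. mem c a < 2 ^ w)"

text \<open>A run in which some word exceeds \<open>w\<close> bits does not count; the result is left in register \<open>0\<close>.\<close>
definition ram_computes :: "nat \<Rightarrow> ram_program \<Rightarrow> ram_config \<Rightarrow> nat \<Rightarrow> nat \<Rightarrow> bool" where
  "ram_computes w P c v t \<longleftrightarrow>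
     (\<exists>s\<le>t. ram_halted P ((ram_step P ^^ s) c) \<and>
            reg ((ram_step P ^^ s) c) 0 = v \<and>
            (\<forall>i\<le>s. fits_words w ((ram_step P ^^ i) c)))"

text \<open>
  Input convention for a pair of strings: the lengths are in registers \<open>0\<close> and \<open>1\<close>, the letters
  of \<open>x\<close> followed by those of \<open>y\<close> occupy memory from address \<open>0\<close> on, one letter per word;
  everything else is \<open>0\<close>.
\<close>
definition ram_input :: "nat list \<Rightarrow> nat list \<Rightarrow> ram_config" where
  "ram_input x y =
     Config 0 ((\<lambda>_. 0)(0 := length x, 1 := length y))
       (\<lambda>a. if a < length x + length y then (x @ y) ! a else 0)"

end

theory Submission
  imports Defs "HOL-Real_Asymp.Real_Asymp"
begin

text \<open>
  Let \<open>x\<close> have at least as many runs as \<open>y\<close>. In an optimal correspondence every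
  maximal stretch of mismatches is a single run of one string swallowed by a run of the other, and
  swallowing one run of \<open>x\<close> together with one run of \<open>y\<close> can be undone for free. So, up to
  corrections at the two ends where the letters may differ, the optimum is the least total length
  of \<open>q\<close> pairwise non-adjacent runs of \<open>x\<close>, with \<open>q\<close> determined by the numbers of runs.

  This minimum is computed by contraction: if \<open>b \<le> a, c\<close> in a list \<open>\<dots>, a, b, c, \<dots>\<close>, then choosing
  \<open>r\<close> non-adjacent entries amounts to choosing \<open>r\<close> such entries of \<open>\<dots>, a + c - b, \<dots>\<close>, or
  \<open>r - 1\<close> of them and paying \<open>b\<close>. Contracting with a stack, in place, until nothing is left yields
  a multiset of payments, and the optimum is the sum of its \<open>q\<close> smallest elements. The
  payments are at most the length of the input, so counting them by value takes linear time.
\<close>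

section \<open>Cheapest non-adjacent entries of a list\<close>

text \<open>The neighbours of a swallowed run carry the same letter and then act as one run, so
  every swallow uses up two runs of its string. This makes \<open>q\<close> about half the surplus
  of runs, and it forbids adjacent choices. At an end where the letters differ, one of two runs
  \<open>\<alpha>\<close>, \<open>\<beta>\<close> from different strings has to be swallowed.
  Charging the minimum and adding a truncated difference to the list turns this into one more
  optional entry, so that a single list suffices. Contraction rests on an exchange: if
  \<open>b\<close> is at most both neighbours, some cheapest choice takes none of \<open>a\<close>,
  \<open>b\<close>, \<open>c\<close>, or \<open>b\<close> alone, or both \<open>a\<close> and
  \<open>c\<close>; the entry \<open>a + c - b\<close> is the price of passing from the second to
  the third. Payments thus become independent of each other, which makes the greedy sum of the
  smallest ones correct. The price \<open>V\<close> stands in for infinity. It only has to reach the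
  cost of any alignment, hence the total length, so all numbers stay polynomial and fit logarithmic
  words.\<close>

text \<open>
  \<open>sepmin V L r\<close> is the least sum of \<open>r\<close> pairwise non-adjacent entries of \<open>L\<close>, where any of the
  \<open>r\<close> may be left out at the price \<open>V\<close>; this avoids infinite values when \<open>L\<close> is too short.
\<close>

function sepmin :: "nat \<Rightarrow> nat list \<Rightarrow> nat \<Rightarrow> nat" where
  "sepmin V [] r = r * V"
| "sepmin V (a # L) 0 = 0"
| "sepmin V (a # L) (Suc r) = min (sepmin V L (Suc r)) (a + sepmin V (tl L) r)"
  by pat_completeness auto
termination by (relation "measure (\<lambda>(V, L, r). length L)") auto

section \<open>Monotonicity and feasibility of the recursion\<close>

lemma sepmin_0 [simp]: "sepmin V L 0 = 0"
  by (cases L) auto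

lemma sepmin_Cons_le: "sepmin V (a # L) r \<le> sepmin V L r"
  by (cases r) auto

lemma sepmin_le_tl: "sepmin V L r \<le> sepmin V (tl L) r"
  by (cases L) (auto simp: sepmin_Cons_le)

lemma sepmin_mono_Suc: "sepmin V L r \<le> sepmin V L (Suc r)"
proof (induction "length L" arbitrary: L r rule: less_induct)
  case less
  show ?case
  proof (cases L)
    case (Cons a L')
    show ?thesis
    proof (cases r)
      case (Suc r')
      have "sepmin V L' (Suc r') \<le> sepmin V L' (Suc (Suc r'))" 
        and "sepmin V (tl L') r' \<le> sepmin V (tl L') (Suc r')"
        using less Cons by auto
      then show ?thesis unfolding Cons Suc by auto
    qed simp
  qed simp
qed

lemma sepmin_tl_le_Suc: "sepmin V (tl L) r \<le> sepmin V L (Suc r)"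
proof (cases L)
  case (Cons a L')
  show ?thesis
    using sepmin_mono_Suc[of V L' r] sepmin_le_tl[of V L' r] Cons by auto
qed simp

text \<open>At most half of the positions, rounded up, are pairwise non-adjacent, so at least one of
  the \<open>r\<close> choices is left out at price \<open>V\<close>. When \<open>V\<close> is at
  least the total run length, an impossible choice cannot undercut a real alignment.\<close>

lemma sepmin_infeasible: "length L + 1 < 2 * r \<Longrightarrow> V \<le> sepmin V L r"
proof (induction V L r rule: sepmin.induct)
  case (1 V r)
  then show ?case by (cases r) auto
next
  case (3 V a L r)
  then show ?case by (cases L) (auto intro: trans_le_add2)
qed auto

lemma sepmin_butlast_le_Suc: "sepmin V (butlast L) r \<le> sepmin V L (Suc r)"
proof (induction "length L" arbitrary: L r rule: less_induct)
  case less
  show ?case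
  proof (cases L)
    case (Cons a L')
    show ?thesis
    proof (cases "L' = [] \<or> r = 0")
      case True
      then show ?thesis using Cons by auto
    next
      case False
      then obtain r' where r: "r = Suc r'" and ne: "L' \<noteq> []" by (cases r) auto
      have "sepmin V (butlast L') r \<le> sepmin V L' (Suc r)"
        "sepmin V (butlast (tl L')) r' \<le> sepmin V (tl L') (Suc r')"
        using less Cons by auto
      then show ?thesis using Cons ne r by (auto simp: butlast_tl)
    qed
  qed simp
qed

text \<open>The recursion peels entries off the front, but the correction for the last runs is an
  entry at the back. This is the mirrored recursion, as an inequality.\<close>

lemma sepmin_snoc_ge:
  "min (sepmin V L (Suc r)) (c + sepmin V (butlast L) r) \<le> sepmin V (L @ [c]) (Suc r)"
proof (induction "length L" arbitrary: L r rule: less_induct)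
  case less
  show ?case
  proof (cases L)
    case (Cons a L')
    show ?thesis
    proof (cases "L' = []")
      case True
      then show ?thesis using Cons by auto
    next
      case ne: False
      have 1: "min (sepmin V L' (Suc r)) (c + sepmin V (butlast L') r) \<le> sepmin V (L' @ [c]) (Suc r)"
        using less Cons by auto
      show ?thesis
      proof (cases r)
        case 0
        then show ?thesis using 1 Cons ne by auto
      next
        case (Suc r')
        have "min (sepmin V (tl L') (Suc r')) (c + sepmin V (butlast (tl L')) r')
            \<le> sepmin V (tl L' @ [c]) (Suc r')"
          using less Cons by auto
        with 1 show ?thesis using Cons ne Suc by (auto simp: butlast_tl min_def split: if_splits)
      qed
    qed
  qed simp
qed

text \<open>The min-plus convolution of \<open>f\<close> with a single optional item of price \<open>b\<close>.\<close>

definition offer :: "nat \<Rightarrow> (nat \<Rightarrow> nat) \<Rightarrow> nat \<Rightarrow> nat" where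
  "offer b f r = (case r of 0 \<Rightarrow> f 0 | Suc r' \<Rightarrow> min (f r) (b + f r'))"

lemma offer_simps [simp]:
  "offer b f 0 = f 0" "offer b f (Suc r) = min (f (Suc r)) (b + f r)"
  by (auto simp: offer_def)

section \<open>Contraction of local minima\<close>

lemma sepmin_contract_left:
  assumes "b \<le> c"
  shows "sepmin V (b # c # Q) r = offer b (sepmin V Q) r"
proof (cases r)
  case (Suc r')
  \<comment> \<open>Taking \<open>b\<close> in place of \<open>c\<close> is no dearer and leaves all
    of \<open>Q\<close> available, so \<open>c\<close> never has to be taken.\<close>
  have "sepmin V Q r' \<le> sepmin V (tl Q) r'" by (rule sepmin_le_tl)
  then show ?thesis using Suc assms by auto
qed simp

text \<open>If exactly one of \<open>a\<close>, \<open>b\<close>, \<open>c\<close> is chosen, it may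
  be \<open>b\<close>, which is cheapest and blocks nothing in \<open>P\<close> or \<open>Q\<close>.
  Choosing both \<open>a\<close> and \<open>c\<close> blocks the same entries of \<open>P\<close>
  and \<open>Q\<close> as the merged entry and costs \<open>b + (a + c - b)\<close>. Taking the
  merged entry without paying \<open>b\<close> is dominated by taking \<open>b\<close>, since
  \<open>b \<le> a + c - b\<close>.\<close>

lemma sepmin_contract:
  assumes "b \<le> a" "b \<le> c"
  shows "sepmin V (P @ a # b # c # Q) r = offer b (sepmin V (P @ (a + c - b) # Q)) r"
proof (induction "length P" arbitrary: P r rule: less_induct)
  case less
  have le: "sepmin V Q i \<le> sepmin V (tl Q) i" for i by (rule sepmin_le_tl)
  consider "r = 0" | r' where "r = Suc r'" by (cases r) auto
  then show ?case
  proof cases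
    case (2 r')
    note r = this
    consider "P = []" | p where "P = [p]" | p p' P' where "P = p # p' # P'"
      by (cases P; cases "tl P") auto
    then show ?thesis
    proof cases
      case 1
      have e: "sepmin V (b # c # Q) (Suc r') = min (sepmin V Q (Suc r')) (b + sepmin V Q r')"
        using sepmin_contract_left[OF assms(2), of V Q "Suc r'"] by simp
      show ?thesis
      proof (cases r')
        case 0
        then show ?thesis using 1 r e assms by auto
      next
        case (Suc r'')
        then show ?thesis using 1 r e assms le[of r'] le[of r''] 
          by (auto simp: min_def)
      qed
    next
      case (2 p)
      have IH: "sepmin V ([] @ a # b # c # Q) r = offer b (sepmin V ([] @ (a + c - b) # Q)) r" for r
        using less[of "[]"] 2 by auto
      \<comment> \<open>Choosing \<open>p\<close> forbids \<open>a\<close>, and what is left begins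
        with \<open>b\<close>: the contraction at the left end applies.\<close>
      have e: "sepmin V (b # c # Q) i = offer b (sepmin V Q) i" for i
        using sepmin_contract_left[OF assms(2), of V Q i] by simp
      show ?thesis
        using 2 r IH[of r] e[of r'] by (cases r') (auto simp: min_def simp del: sepmin.simps(3) simp add: sepmin.simps(3)[of V p])
    next
      case (3 p p' P')
      have IH: "sepmin V (P' @ a # b # c # Q) i = offer b (sepmin V (P' @ (a + c - b) # Q)) i" 
        "sepmin V ((p' # P') @ a # b # c # Q) i = offer b (sepmin V ((p' # P') @ (a + c - b) # Q)) i" for i
        using less[of P'] less[of "p' # P'"] 3 by auto
      show ?thesis
        using 3 r IH(2)[of r] IH(1)[of r'] by (cases r') (auto simp: min_def simp del: sepmin.simps(3) simp add: sepmin.simps(3)[of V p])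
    qed
  qed simp
qed

lemma sepmin_contract_right:
  assumes "b \<le> a"
  shows "sepmin V (P @ [a, b]) r = offer b (sepmin V P) r"
proof (induction "length P" arbitrary: P r rule: less_induct)
  case less
  consider "r = 0" | r' where "r = Suc r'" by (cases r) auto
  then show ?case
  proof cases
    case (2 r')
    note r = this
    consider "P = []" | p where "P = [p]" | p p' P' where "P = p # p' # P'"
      by (cases P; cases "tl P") auto
    then show ?thesis
    proof cases
      case 1
      then show ?thesis using r assms by auto
    next
      case (2 p)
      then show ?thesis using r assms by (cases r') auto
    next
      case (3 p p' P')
      have IH: "sepmin V (P' @ [a, b]) i = offer b (sepmin V P') i" 
        "sepmin V ((p' # P') @ [a, b]) i = offer b (sepmin V (p' # P')) i" for i
        using less[of P'] less[of "p' # P'"] 3 by auto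
      show ?thesis
        using 3 r IH(2)[of r] IH(1)[of r'] by (cases r') (auto simp: min_def simp del: sepmin.simps(3) simp add: sepmin.simps(3)[of V p])
    qed
  qed simp
qed

text \<open>
  The left-hand side is the sum of the \<open>r\<close> smallest prices; on the right, the term for \<open>v\<close> counts
  how many of these exceed \<open>v\<close>.
\<close>

lemma foldr_offer_eq_sum:
  assumes "\<forall>b \<in> set bs. b \<le> V"
  shows "foldr offer bs (\<lambda>r. r * V) r = (\<Sum>v<V. r - length (filter (\<lambda>b. b \<le> v) bs))"
  using assms
proof (induction bs arbitrary: r)
  case (Cons b bs)
  let ?n = "\<lambda>v. length (filter (\<lambda>b. b \<le> v) bs)"
  let ?f = "\<lambda>r. \<Sum>v<V. r - ?n v"
  have IH: "foldr offer bs (\<lambda>r. r * V) = ?f" using Cons by auto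
  show ?case
  proof (cases r)
    case 0
    then show ?thesis using IH by simp
  next
    case (Suc r')
    have mono: "?n v \<le> ?n v'" if "v \<le> v'" for v v'
      using that by (induction bs) auto
    have split: "(\<Sum>v<V. g v) = (\<Sum>v<b. g v) + (\<Sum>v=b..<V. g v)" for g :: "nat \<Rightarrow> nat"
      using Cons.prems sum.atLeastLessThan_concat[of 0 b V g] by (simp add: atLeast0LessThan)
    let ?L = "(\<Sum>v<b. r - ?n v) + (\<Sum>v=b..<V. r' - ?n v)"
    have L: "(\<Sum>v<V. r - length (filter (\<lambda>b. b \<le> v) (b # bs))) = ?L"
      unfolding split using Suc by (intro arg_cong2[of _ _ _ _ "(+)"] sum.cong) auto
    have 1: "?L \<le> ?f r" unfolding split using Suc by (intro add_mono sum_mono) auto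
    have "(\<Sum>v<b. r - ?n v) \<le> (\<Sum>v<b. 1 + (r' - ?n v))" using Suc by (intro sum_mono) auto
    then have 2: "?L \<le> b + ?f r'" unfolding split by (simp only: sum.distrib) simp
    have 3: "?L = ?f r \<or> ?L = b + ?f r'"
    \<comment> \<open>If \<open>r\<close> of the other prices already lie below \<open>b\<close>,
      then \<open>b\<close> is not among the \<open>r\<close> smallest. Otherwise it is, and it adds
      one to each of the \<open>b\<close> terms with \<open>v < b\<close>.\<close>
    proof (cases "\<exists>v<b. ?n v \<ge> r")
      case True
      then obtain v where v: "v < b" "?n v \<ge> r" by auto
      have "r' - ?n v' = r - ?n v'" if "v' \<ge> b" for v'
        using mono[of v v'] v that Suc by auto
      then have "?L = ?f r" unfolding split by simp
      then show ?thesis ..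
    next
      case False
      then have "(\<Sum>v<b. r - ?n v) = (\<Sum>v<b. 1 + (r' - ?n v))" 
        using Suc by (intro sum.cong) (auto simp: not_le less_Suc_eq_le Suc_diff_le)
      then show ?thesis unfolding split by (simp only: sum.distrib) simp
    qed
    show ?thesis using 1 2 3 unfolding L using IH Suc by (auto simp: min_def)
  qed
qed simp

section \<open>Correspondences in terms of run lengths\<close>

fun alternate :: "nat \<Rightarrow> nat list \<Rightarrow> nat list" where
  "alternate c [] = []"
| "alternate c (k # ks) = replicate k c @ alternate (1 - c) ks"

abbreviation run_lengths :: "'a list \<Rightarrow> nat list" where
  "run_lengths x \<equiv> map length (runs x)"

lemma extend_runs_eq_alternate:
  assumes "set x \<subseteq> {0, 1}" "length js = length (runs x)"
  shows "concat (map2 (\<lambda>r k. r @ replicate k (hd r)) (runs x) js)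
    = alternate (hd x) (map2 (+) (run_lengths x) js)"
  using assms
proof (induction x arbitrary: js rule: runs.induct)
  case (2 a x)
  let ?d = "dropWhile (\<lambda>b. b = a) x"
  obtain j js' where js: "js = j # js'" "length js' = length (runs ?d)"
    using 2(3) by (cases js) auto
  have t: "takeWhile (\<lambda>b. b = a) x = replicate (length (takeWhile (\<lambda>b. b = a) x)) a"
    by (metis (mono_tags, lifting) replicate_length_same set_takeWhileD)
  have "set ?d \<subseteq> {0, 1}" using 2(2) by (auto dest: set_dropWhileD)
  note IH = 2(1)[OF this js(2)]
  have "alternate (hd ?d) zs = alternate (1 - a) zs" if "length zs = length (runs ?d)" for zs
  proof (cases "?d = []")
    case True
    show ?thesis using that unfolding True by simp
  next
    case False
    then have "hd ?d \<noteq> a" by (rule hd_dropWhile)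
    moreover have "hd ?d \<in> {0, 1}" using False \<open>set ?d \<subseteq> {0, 1}\<close> hd_in_set by blast
    moreover have "a \<in> {0, 1}" using 2(2) by auto
    ultimately have "hd ?d = 1 - a" by auto
    then show ?thesis by simp
  qed
  then have "concat (map2 (\<lambda>r k. r @ replicate k (hd r)) (runs ?d) js')
    = alternate (1 - a) (map2 (+) (run_lengths ?d) js')" using IH js(2) by simp
  then show ?case using js t
    by (simp add: replicate_add)
qed simp

text \<open>With two letters, each run determines the letter of the next. An expansion therefore
  amounts to the first letter and a list of run lengths that is pointwise at least the original
  one.\<close>

lemma expansions_eq_alternate:
  assumes "set x \<subseteq> {0, 1}"
  shows "expansions x = {alternate (hd x) ks | ks. list_all2 (\<le>) (run_lengths x) ks}"
proof -
  have 1: "list_all2 (\<le>) as (map2 (+) as js)" if "length js = length as" for as js :: "nat list"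
    using that by (auto simp: list_all2_conv_all_nth)
  have 2: "ks = map2 (+) as (map2 (-) ks as)" if "list_all2 (\<le>) as ks" for as ks :: "nat list"
    using that by (auto simp: list_all2_conv_all_nth intro!: nth_equalityI)
  show ?thesis
  proof (intro set_eqI iffI)
    fix z assume "z \<in> expansions x"
    then obtain js where "length js = length (runs x)"
      "z = concat (map2 (\<lambda>r k. r @ replicate k (hd r)) (runs x) js)"
      by (auto simp: expansions_def)
    then show "z \<in> {alternate (hd x) ks | ks. list_all2 (\<le>) (run_lengths x) ks}"
      using extend_runs_eq_alternate[OF assms] 1[of js "run_lengths x"] by auto
  next
    fix z assume "z \<in> {alternate (hd x) ks | ks. list_all2 (\<le>) (run_lengths x) ks}"
    then obtain ks where ks: "z = alternate (hd x) ks" "list_all2 (\<le>) (run_lengths x) ks" by auto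
    define js where "js = map2 (-) ks (run_lengths x)"
    have l: "length js = length (runs x)" using ks by (auto simp: js_def dest: list_all2_lengthD)
    have "z = concat (map2 (\<lambda>r k. r @ replicate k (hd r)) (runs x) js)"
      using extend_runs_eq_alternate[OF assms l] 2[OF ks(2)] ks(1) by (simp add: js_def)
    then show "z \<in> expansions x" using l by (auto simp: expansions_def)
  qed
qed

lemma run_lengths_pos: "k \<in> set (run_lengths x) \<Longrightarrow> 0 < k"
  using run_constant by fastforce

lemma length_alternate [simp]: "length (alternate c ks) = sum_list ks"
  by (induction ks arbitrary: c) auto

text \<open>The flag of \<open>overlay\<close> says whether the two current letters agree.\<close>

function overlay :: "nat list \<Rightarrow> nat list \<Rightarrow> bool \<Rightarrow> nat" where
  "overlay (k # ks) (l # ls) s =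
     (if s then 0 else min k l) +
     (if k = l then overlay ks ls s
      else if k < l then overlay ks ((l - k) # ls) (\<not> s)
      else overlay ((k - l) # ks) ls (\<not> s))"
| "overlay [] ls s = 0"
| "overlay (k # ks) [] s = 0"
  by pat_completeness auto
termination by (relation "measure (\<lambda>(ks, ls, s). length ks + length ls)") auto

lemma overlay_commute: "overlay ks ls s = overlay ls ks s"
proof (induction ks ls s rule: overlay.induct)
  case (2 ls s)
  then show ?case by (cases ls) auto
qed (auto simp: min.commute)

section \<open>Values of correspondences as overlays of run lengths\<close>

lemma correspondence_value_append:
  assumes "length x = length y" "length x' = length y'"
  shows "correspondence_value (x @ x', y @ y') =
    correspondence_value (x, y) + correspondence_value (x', y')"
proof -
  have "correspondence_value (u, v) = sum_list (map2 letter_dist u v)" if "length u = length v" for u v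
    using that by (simp add: correspondence_value_def sum_list_sum_nth atLeast0LessThan)
  then show ?thesis using assms by simp
qed

lemma correspondence_value_replicate:
  "correspondence_value (replicate k a, replicate k b) = k * letter_dist a b"
  by (simp add: correspondence_value_def)

lemma correspondence_value_alternate:
  assumes "c \<le> 1" "c' \<le> 1" "sum_list ks = sum_list ls"
  shows "correspondence_value (alternate c ks, alternate c' ls) = overlay ks ls (c = c')"
  using assms
proof (induction ks ls "c = c'" arbitrary: c c' rule: overlay.induct)
  case (1 k ks l ls)
  have d: "letter_dist c c' = (if c = c' then 0 else 1)"
    using 1(4,5) by (auto simp: letter_dist_def)
  have flip: "(1 - c = c') = (c \<noteq> c')" "(c = 1 - c') = (c \<noteq> c')"  "(1 - c = 1 - c') = (c = c')"
    using 1(4,5) by (auto simp: le_Suc_eq)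
  consider "k = l" | "k < l" | "k > l" by linarith
  then show ?case
  proof cases
    case 1
    then show ?thesis using "1.hyps"(1)[of "1 - c" "1 - c'"] "1.prems" flip d
      by (simp add: correspondence_value_append correspondence_value_replicate)
  next
    case 2
    then have "replicate l c' = replicate k c' @ replicate (l - k) c'"
      by (simp flip: replicate_add)
    then show ?thesis using 2 "1.hyps"(2)[of "1 - c" "c'"] "1.prems" flip d
      by (simp add: correspondence_value_append correspondence_value_replicate)
  next
    case 3
    then have "replicate k c = replicate l c @ replicate (k - l) c"
      by (simp flip: replicate_add)
    then show ?thesis using 3 "1.hyps"(3)[of "c" "1 - c'"] "1.prems" flip d
      by (simp add: correspondence_value_append correspondence_value_replicate)
  qed
next
  \<comment> \<open>Blocks of length zero are allowed here, so equal sums only show that the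
    remaining strings are empty.\<close>
  case (3 k ks)
  then have "length (alternate c (k # ks)) = 0" unfolding length_alternate by simp
  then show ?case unfolding correspondence_value_def case_prod_conv by (simp only: lessThan_0 sum.empty overlay.simps)
qed (auto simp: correspondence_value_def)

lemma correspondence_values_eq:
  assumes "set x \<subseteq> {0, 1}" "set y \<subseteq> {0, 1}" "x \<noteq> []" "y \<noteq> []"
  shows "correspondence_value ` correspondences x y =
    {overlay ks ls (hd x = hd y) | ks ls. list_all2 (\<le>) (run_lengths x) ks \<and>
       list_all2 (\<le>) (run_lengths y) ls \<and> sum_list ks = sum_list ls}"
proof -
  have "hd x \<in> {0, 1}" "hd y \<in> {0, 1}" using assms hd_in_set by blast+
  then have "hd x \<le> 1" "hd y \<le> 1" by auto
  note v = correspondence_value_alternate[OF this]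
  have "v \<in> correspondence_value ` correspondences x y" if "v = overlay ks ls (hd x = hd y)"
    "list_all2 (\<le>) (run_lengths x) ks" "list_all2 (\<le>) (run_lengths y) ls"
    "sum_list ks = sum_list ls" for v ks ls
    unfolding correspondences_def expansions_eq_alternate[OF assms(1)] expansions_eq_alternate[OF assms(2)]
    by (rule image_eqI[of _ _ "(alternate (hd x) ks, alternate (hd y) ls)"]) (use that v in auto)
  moreover have "\<exists>ks ls. v = overlay ks ls (hd x = hd y) \<and> list_all2 (\<le>) (run_lengths x) ks \<and>
       list_all2 (\<le>) (run_lengths y) ls \<and> sum_list ks = sum_list ls"
    if "v \<in> correspondence_value ` correspondences x y" for v
    using that v
    unfolding correspondences_def expansions_eq_alternate[OF assms(1)] expansions_eq_alternate[OF assms(2)]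
    by auto metis
  ultimately show ?thesis by blast
qed

text \<open>
  \<open>agree_cost as bs v\<close>: starting inside two runs of the same letter, with the runs \<open>as\<close> and
  \<open>bs\<close> still to come, an alignment in which every maximal stretch of mismatches is a single
  swallowed run costs \<open>v\<close>. In \<open>differ_cost\<close> the two current runs, of different
  letters, are the heads of the lists.
\<close>

inductive agree_cost :: "nat list \<Rightarrow> nat list \<Rightarrow> nat \<Rightarrow> bool" where
  "agree_cost [] [] 0"
| "agree_cost as bs v \<Longrightarrow> agree_cost (a # as) (b # bs) v"
| "agree_cost as bs v \<Longrightarrow> agree_cost (a # a' # as) bs (a + v)"
| "agree_cost as bs v \<Longrightarrow> agree_cost as (b # b' # bs) (b + v)"
| "agree_cost [a] [] a"
| "agree_cost [] [b] b"

inductive differ_cost :: "nat list \<Rightarrow> nat list \<Rightarrow> nat \<Rightarrow> bool" where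
  "agree_cost as bs v \<Longrightarrow> differ_cost (a # a' # as) (b # bs) (a + v)"
| "agree_cost as bs v \<Longrightarrow> differ_cost (a # as) (b # b' # bs) (b + v)"
| "differ_cost [a] [b] (max a b)"

section \<open>Normalised alignments as lower bounds for overlays\<close>

lemma agree_cost_sym: "agree_cost as bs v \<Longrightarrow> agree_cost bs as v"
  by (induction rule: agree_cost.induct) (auto intro: agree_cost.intros)

lemma differ_cost_sym: "differ_cost as bs v \<Longrightarrow> differ_cost bs as v"
proof (induction rule: differ_cost.induct)
  case (3 a b)
  then show ?case using differ_cost.intros(3)[of b a] by (simp add: max.commute)
qed (auto intro: differ_cost.intros agree_cost_sym)

text \<open>If the first letters agree, the two first runs are stretched to a common length for
  free. Their lengths do not enter the cost, hence \<open>tl\<close>.\<close>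

definition align_cost :: "nat list \<Rightarrow> nat list \<Rightarrow> bool \<Rightarrow> nat \<Rightarrow> bool" where
  "align_cost A B s v \<longleftrightarrow> (if s then agree_cost (tl A) (tl B) v else differ_cost A B v)"

lemma align_cost_sym: "align_cost A B s v \<Longrightarrow> align_cost B A s v"
  by (auto simp: align_cost_def agree_cost_sym differ_cost_sym split: if_splits)

text \<open>The block of the first list ends after \<open>k\<close> positions, inside the run
  \<open>b\<close>, of which \<open>b - k\<close> is still to be covered; truncation is right, as a
  run already stretched beyond its length demands nothing more. If the letters differ, the block
  that ends counts as a swallowed run, of length \<open>a \<le> k\<close>.\<close>

lemma overlay_lower_bound_less:
  assumes "align_cost as ((b - k) # bs) (\<not> s) v" "a \<le> k" "as \<noteq> []"
  shows "\<exists>u \<le> (if s then 0 else k) + v. align_cost (a # as) (b # bs) s u"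
proof (cases s)
  case False
  obtain a1 as1 where as: "as = a1 # as1" using assms(3) by (cases as) auto
  then have "agree_cost as1 bs v" using assms(1) False by (auto simp: align_cost_def)
  then have "differ_cost (a # as) (b # bs) (a + v)" using as by (auto intro: differ_cost.intros)
  then show ?thesis using False assms(2) by (auto simp: align_cost_def intro!: exI[of _ "a + v"])
next
  case True
  then have "differ_cost as ((b - k) # bs) v" using assms by (auto simp: align_cost_def)
  then have "\<exists>u\<le>v. agree_cost as bs u"
  proof (cases rule: differ_cost.cases)
    case (1 as v a a')
    then show ?thesis by (auto intro: agree_cost.intros)
  next
    \<comment> \<open>Swallowing the rest of \<open>b\<close> is wasteful: if \<open>b\<close> ends
      together with the block opposite it, then \<open>a\<close> and \<open>b'\<close> pair up for
      free.\<close>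
    case (2 as bs' v a b')
    then show ?thesis by (intro exI[of _ v]) (auto intro: agree_cost.intros)
  next
    case (3 a)
    then show ?thesis by (auto intro!: exI[of _ a] agree_cost.intros)
  qed
  then show ?thesis using True by (auto simp: align_cost_def)
qed

text \<open>Mismatched blocks that end together are followed by another mismatch. Swallowing just
  one of the two current runs lets later runs pair up and saves the next swallow. If each string has
  only one more run, the cost \<open>a + b1\<close> is covered by
  \<open>k + max a1 b1\<close>.\<close>

lemma overlay_lower_bound_eq:
  assumes "align_cost as bs s v" "a \<le> k" "b \<le> k" "as \<noteq> []" "bs \<noteq> []"
  shows "\<exists>u \<le> (if s then 0 else k) + v. align_cost (a # as) (b # bs) s u"
proof (cases s)
  case True
  then show ?thesis using assms 
    by (intro exI[of _ v]) (auto simp: align_cost_def neq_Nil_conv intro: agree_cost.intros)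
next
  case False
  then have "differ_cost as bs v" using assms by (auto simp: align_cost_def)
  then have "\<exists>u\<le>k + v. differ_cost (a # as) (b # bs) u"
  proof (cases rule: differ_cost.cases)
    case (1 as bs v a1 a2 b1)
    then show ?thesis using assms
      by (intro exI[of _ "a + v"]) (auto intro!: differ_cost.intros agree_cost.intros(2))
  next
    case (2 as bs v a1 b1 b2)
    then show ?thesis using assms
      by (intro exI[of _ "b + v"]) (auto intro!: differ_cost.intros(2) agree_cost.intros(2))
  next
    case (3 a1 b1)
    then show ?thesis using assms
      by (intro exI[of _ "a + b1"]) (auto intro!: differ_cost.intros(1) agree_cost.intros)
  qed
  then show ?thesis using False by (auto simp: align_cost_def)
qed

text \<open>Induction along the overlay. Comparing the runs with the blocks only pointwise is what
  survives when a block is partly consumed, since the run and the block shrink by the same truncated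
  amount.\<close>

lemma overlay_lower_bound:
  assumes "list_all2 (\<le>) A ks" "list_all2 (\<le>) B ls" "sum_list ks = sum_list ls"
    "\<forall>k\<in>set ks. 0 < k" "\<forall>l\<in>set ls. 0 < l" "A \<noteq> []" "B \<noteq> []"
  shows "\<exists>v \<le> overlay ks ls s. align_cost A B s v"
  using assms
proof (induction ks ls s arbitrary: A B rule: overlay.induct)
  case (1 k ks l ls s)
  obtain a as b bs where A: "A = a # as" "B = b # bs" "a \<le> k" "b \<le> l"
    "list_all2 (\<le>) as ks" "list_all2 (\<le>) bs ls"
    using "1.prems" by (auto simp: list_all2_Cons2)
  consider "k = l" | "k < l" | "k > l" by linarith
  then show ?case
  proof cases
    case k: 1
    show ?thesis
    proof (cases "as = [] \<or> bs = []")
      case True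
      have "sum_list ks = sum_list ls" using "1.prems"(3) k by simp
      \<comment> \<open>Since blocks are positive and the sums agree, the two strings end
        together.\<close>
      moreover have "sum_list ks = 0 \<longleftrightarrow> ks = []" "sum_list ls = 0 \<longleftrightarrow> ls = []"
        using "1.prems"(4,5) by (cases ks, auto, cases ls, auto)
      ultimately have z: "ks = [] \<longleftrightarrow> ls = []" by metis
      then have "as = [] \<and> bs = []" using True A by auto
      moreover from this z have "ks = []" "ls = []" using A by auto
      moreover have "align_cost [a] [b] True 0" "align_cost [a] [b] False (max a b)"
        by (auto simp: align_cost_def intro: agree_cost.intros differ_cost.intros)
      ultimately show ?thesis using A k
        by (intro exI[of _ "if s then 0 else max a b"]) (cases s; simp)
    next
      case False
      then obtain v where "v \<le> overlay ks ls s" "align_cost as bs s v"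
        using 1(1)[of as bs] k A "1.prems" by auto
      moreover from this obtain u where "u \<le> (if s then 0 else k) + v" "align_cost (a # as) (b # bs) s u"
        using overlay_lower_bound_eq[of as bs s v a k b] A k False by blast
      ultimately show ?thesis using A k by (intro exI[of _ u]) auto
    qed
  next
    case k: 2
    have "ks \<noteq> []" using k "1.prems"(3) by auto
    then have ne: "as \<noteq> []" using A by auto
    moreover have "list_all2 (\<le>) ((b - k) # bs) ((l - k) # ls)" using A by auto
    moreover have "sum_list ks = sum_list ((l - k) # ls)" using "1.prems"(3) k by simp
    ultimately obtain v where "v \<le> overlay ks ((l - k) # ls) (\<not> s)" 
      "align_cost as ((b - k) # bs) (\<not> s) v"
      using 1(2)[of as "(b - k) # bs"] k A "1.prems" by auto
    moreover from this obtain u where "u \<le> (if s then 0 else k) + v" "align_cost (a # as) (b # bs) s u"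
      using overlay_lower_bound_less[of as b k bs s v a] A k ne by blast
    ultimately show ?thesis using A k by (intro exI[of _ u]) auto
  next
    case k: 3
    have "ls \<noteq> []" using k "1.prems"(3) by auto
    then have ne: "bs \<noteq> []" using A by auto
    moreover have "list_all2 (\<le>) ((a - l) # as) ((k - l) # ks)" using A by auto
    moreover have "sum_list ((k - l) # ks) = sum_list ls" using "1.prems"(3) k by simp
    ultimately obtain v where "v \<le> overlay ((k - l) # ks) ls (\<not> s)" 
      "align_cost ((a - l) # as) bs (\<not> s) v"
      using 1(3)[of "(a - l) # as" bs] k A "1.prems" by auto
    moreover from this obtain u where "u \<le> (if s then 0 else l) + v" "align_cost (b # bs) (a # as) s u"
      using overlay_lower_bound_less[of bs a l as s v b, OF align_cost_sym] A k ne by blast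
    ultimately show ?thesis using A k by (intro exI[of _ u]) (auto intro: align_cost_sym)
  qed
qed auto

section \<open>Realising normalised alignments by overlays\<close>

lemma overlay_swallow:
  assumes "0 < l"
  shows "overlay (Suc a # a' # k # ks) ((Suc a + a' + l) # ls) True = a' + overlay (k # ks) (l # ls) True"
proof -
  have "overlay (Suc a # a' # k # ks) ((Suc a + a' + l) # ls) True
      = overlay (a' # k # ks) ((a' + l) # ls) False"
    using assms by (subst overlay.simps(1)) (auto simp del: overlay.simps)
  also have "\<dots> = a' + overlay (k # ks) (l # ls) True"
    using assms by (subst overlay.simps(1)) (auto simp del: overlay.simps)
  finally show ?thesis .
qed

text \<open>The bounds \<open>a\<close> and \<open>b\<close> on the current runs are arbitrary: the
  induction must be able to demand that an absorbing run reaches past the run it swallows.\<close>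

lemma agree_cost_overlay:
  assumes "agree_cost as bs v"
  shows "\<exists>k ks l ls. a \<le> k \<and> b \<le> l \<and> list_all2 (\<le>) as ks \<and> list_all2 (\<le>) bs ls \<and>
    k + sum_list ks = l + sum_list ls \<and> overlay (k # ks) (l # ls) True = v"
  using assms
proof (induction arbitrary: a b rule: agree_cost.induct)
  case 1
  have "overlay [max a b] [max a b] True = 0" by simp
  then show ?case by (metis list_all2_Nil max.cobounded1 max.cobounded2)
next
  case (2 as bs v a' b')
  obtain k ks l ls where *: "a' \<le> k" "b' \<le> l" "list_all2 (\<le>) as ks" "list_all2 (\<le>) bs ls"
    "k + sum_list ks = l + sum_list ls" "overlay (k # ks) (l # ls) True = v"
    using "2.IH"[of a' b'] by blast
  have "overlay (max a b # k # ks) (max a b # l # ls) True = overlay (k # ks) (l # ls) True"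
    by (subst overlay.simps(1)) (simp del: overlay.simps)
  then show ?case using * by (intro exI[of _ "max a b"] exI[of _ "k # ks"] exI[of _ "l # ls"]) simp
next
  case (3 as bs v a1 a2)
  \<comment> \<open>The bound \<open>Suc b\<close> forces \<open>0 < l\<close>, so that the
    absorbing run extends strictly beyond the swallowed one.\<close>
  obtain k ks l ls where *: "a2 \<le> k" "Suc b \<le> l" "list_all2 (\<le>) as ks" "list_all2 (\<le>) bs ls"
    "k + sum_list ks = l + sum_list ls" "overlay (k # ks) (l # ls) True = v"
    using "3.IH"[of a2 "Suc b"] by blast
  then show ?case using overlay_swallow[of l a a1 k ks ls]
    by (intro exI[of _ "Suc a"] exI[of _ "a1 # k # ks"] exI[of _ "Suc a + a1 + l"] exI[of _ ls])
      (auto simp del: overlay.simps)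
next
  case (4 as bs v b1 b2)
  obtain k ks l ls where *: "Suc a \<le> k" "b2 \<le> l" "list_all2 (\<le>) as ks" "list_all2 (\<le>) bs ls"
    "k + sum_list ks = l + sum_list ls" "overlay (k # ks) (l # ls) True = v"
    using "4.IH"[of "Suc a" b2] by blast
  then show ?case using overlay_swallow[of k b b1 l ls ks]
    by (intro exI[of _ "Suc b + b1 + k"] exI[of _ ks] exI[of _ "Suc b"] exI[of _ "b1 # l # ls"])
      (auto simp: overlay_commute simp del: overlay.simps)
next
  case (5 a1)
  then show ?case
    by (intro exI[of _ "max a b"] exI[of _ "[a1]"] exI[of _ "max a b + a1"] exI[of _ "[]"]) auto
next
  case (6 b1)
  then show ?case
    by (intro exI[of _ "max a b + b1"] exI[of _ "[]"] exI[of _ "max a b"] exI[of _ "[b1]"]) auto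
qed

lemma differ_cost_overlay:
  assumes "differ_cost A B v"
  shows "\<exists>ks ls. list_all2 (\<le>) A ks \<and> list_all2 (\<le>) B ls \<and>
    sum_list ks = sum_list ls \<and> overlay ks ls False = v"
  using assms
proof cases
  case (1 as bs v' a a' b)
  obtain k ks l ls where *: "a' \<le> k" "Suc b \<le> l" "list_all2 (\<le>) as ks" "list_all2 (\<le>) bs ls"
    "k + sum_list ks = l + sum_list ls" "overlay (k # ks) (l # ls) True = v'"
    using agree_cost_overlay[OF 1(4), of a' "Suc b"] by blast
  moreover have "overlay (a # k # ks) ((a + l) # ls) False = a + overlay (k # ks) (l # ls) True"
    using * by (subst overlay.simps(1)) (simp del: overlay.simps)
  ultimately show ?thesis using 1
    by (intro exI[of _ "a # k # ks"] exI[of _ "(a + l) # ls"]) (simp del: overlay.simps)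
next
  case (2 as bs v' a b b')
  obtain k ks l ls where *: "Suc a \<le> k" "b' \<le> l" "list_all2 (\<le>) as ks" "list_all2 (\<le>) bs ls"
    "k + sum_list ks = l + sum_list ls" "overlay (k # ks) (l # ls) True = v'"
    using agree_cost_overlay[OF 2(4), of "Suc a" b'] by blast
  moreover have "overlay ((b + k) # ks) (b # l # ls) False = b + overlay (k # ks) (l # ls) True"
    using * by (subst overlay.simps(1)) (simp del: overlay.simps)
  ultimately show ?thesis using 2
    by (intro exI[of _ "(b + k) # ks"] exI[of _ "b # l # ls"]) (simp del: overlay.simps)
next
  case (3 a b)
  then show ?thesis by (intro exI[of _ "[max a b]"]) auto
qed

lemma align_cost_overlay:
  assumes "align_cost A B s v" "A \<noteq> []" "B \<noteq> []"
  shows "\<exists>ks ls. list_all2 (\<le>) A ks \<and> list_all2 (\<le>) B ls \<and>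
    sum_list ks = sum_list ls \<and> overlay ks ls s = v"
proof (cases s)
  case True
  obtain a as b bs where A: "A = a # as" "B = b # bs" using assms by (auto simp: neq_Nil_conv)
  then obtain k ks l ls where "a \<le> k" "b \<le> l" "list_all2 (\<le>) as ks" "list_all2 (\<le>) bs ls"
    "k + sum_list ks = l + sum_list ls" "overlay (k # ks) (l # ls) True = v"
    using agree_cost_overlay[of as bs v a b] assms True by (auto simp: align_cost_def)
  then show ?thesis using A True
    by (intro exI[of _ "k # ks"] exI[of _ "l # ls"]) (simp del: overlay.simps)
next
  case False
  then show ?thesis using differ_cost_overlay[of A B v] assms by (auto simp: align_cost_def)
qed

text \<open>Overlay values and normalised costs form different sets, but every value dominates a
  cost and every cost is a value, so the minima coincide.\<close>

lemma dtw_eqI: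
  assumes "set x \<subseteq> {0, 1}" "set y \<subseteq> {0, 1}" "x \<noteq> []" "y \<noteq> []"
  assumes ex: "\<exists>u\<le>v. align_cost (run_lengths x) (run_lengths y) (hd x = hd y) u"
  assumes min: "\<And>u. align_cost (run_lengths x) (run_lengths y) (hd x = hd y) u \<Longrightarrow> v \<le> u"
  shows "dtw x y = v"
proof -
  have ne: "run_lengths x \<noteq> []" "run_lengths y \<noteq> []"
    using assms by (auto simp: neq_Nil_conv)
  have "align_cost (run_lengths x) (run_lengths y) (hd x = hd y) v"
    using ex min by (metis le_antisym)
  then have mem: "v \<in> correspondence_value ` correspondences x y"
    unfolding correspondence_values_eq[OF assms(1-4)] using align_cost_overlay[OF _ ne] by blast
  have "v \<le> u" if "u \<in> correspondence_value ` correspondences x y" for u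
  proof -
    obtain ks ls where *: "u = overlay ks ls (hd x = hd y)" "list_all2 (\<le>) (run_lengths x) ks"
       "list_all2 (\<le>) (run_lengths y) ls" "sum_list ks = sum_list ls"
      using \<open>u \<in> _\<close> unfolding correspondence_values_eq[OF assms(1-4)] by blast
    have pos: "\<forall>k\<in>set ks. 0 < k" if "list_all2 (\<le>) (run_lengths z) ks" for ks and z :: "nat list"
      using that run_lengths_pos[of _ z]
      by (metis in_set_conv_nth list_all2_conv_all_nth order_less_le_trans)
    show ?thesis
      using overlay_lower_bound[OF *(2-4) pos[OF *(2)] pos[OF *(3)] ne] min *(1) by (meson order_trans)
  qed
  with mem show ?thesis unfolding dtw_def by (intro Least_equality) auto
qed

section \<open>A closed form for the optimal cost\<close>

text \<open>
  Here \<open>d\<close> is the number of runs by which \<open>as\<close> exceeds \<open>bs\<close>, and \<open>\<alpha>\<close>, \<open>\<beta>\<close> are the last runs. For odd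
  \<open>d\<close> the last letters differ, and one of the last runs is swallowed: paying \<open>min \<alpha> \<beta>\<close> in
  advance, the choice of \<open>\<alpha>\<close> costs another \<open>\<alpha> - \<beta>\<close>. If \<open>\<alpha> < \<beta>\<close>, truncation makes this entry free,
  so that it can be assumed to be chosen.
\<close>

definition agree_opt :: "nat \<Rightarrow> nat list \<Rightarrow> nat \<Rightarrow> nat \<Rightarrow> nat \<Rightarrow> nat" where
  "agree_opt V as \<alpha> \<beta> d = (if odd d then min \<alpha> \<beta> else 0) +
     sepmin V (butlast as @ (if odd d then [\<alpha> - \<beta>] else [])) ((d + 1) div 2)"

section \<open>Equal first letters: the lower bound\<close>

lemma agree_opt_0 [simp]: "agree_opt V as \<alpha> \<beta> 0 = 0"
  by (simp add: agree_opt_def)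

lemma agree_opt_Cons:
  "as \<noteq> [] \<or> d = 0 \<Longrightarrow> agree_opt V (a # as) \<alpha> \<beta> d \<le> agree_opt V as \<alpha> \<beta> d"
  by (auto simp: agree_opt_def intro: sepmin_Cons_le)

text \<open>A swallow consumes two runs, so the surplus changes by two and the number of choices by
  one. The run \<open>a'\<close> merges with the one before \<open>a\<close>, which matches the
  \<open>tl\<close> in the recursion of \<open>sepmin\<close>.\<close>

lemma agree_opt_swallow:
  assumes "as \<noteq> [] \<or> d = 0"
  shows "agree_opt V (a # a' # as) \<alpha> \<beta> (Suc (Suc d)) \<le> a + agree_opt V as \<alpha> \<beta> d"
  using assms by (cases "as = []") (auto simp: agree_opt_def)

lemma agree_opt_add2: "agree_opt V as \<alpha> \<beta> d \<le> agree_opt V as \<alpha> \<beta> (Suc (Suc d))"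
  using sepmin_mono_Suc by (auto simp: agree_opt_def)

lemma agree_opt_1_Cons: "agree_opt V (a # a' # as) \<alpha> \<beta> 1 \<le> a + min \<alpha> \<beta>"
  by (auto simp: agree_opt_def)

lemma agree_opt_1_ge: "min \<alpha> \<beta> \<le> agree_opt V as \<alpha> \<beta> 1"
  by (auto simp: agree_opt_def)

text \<open>Putting two runs in front of one list can change which list is longer. This happens in
  the middle of the comparison, at a surplus of one, where the symmetric payment
  \<open>min \<alpha> \<beta>\<close> links the two formulas.\<close>

lemma agree_opt_swallow_le:
  assumes 1: "length bs \<le> length as \<longrightarrow> agree_opt V as \<alpha> \<beta> (length as - length bs) \<le> v"
    and 2: "length as \<le> length bs \<longrightarrow> agree_opt V bs \<beta> \<alpha> (length bs - length as) \<le> v"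
  shows "(length bs \<le> length (a # a' # as) \<longrightarrow>
       agree_opt V (a # a' # as) \<alpha> \<beta> (length (a # a' # as) - length bs) \<le> a + v) \<and>
     (length (a # a' # as) \<le> length bs \<longrightarrow>
       agree_opt V bs \<beta> \<alpha> (length bs - length (a # a' # as)) \<le> a + v)"
proof -
  consider "length bs \<le> length as" | "length bs = Suc (length as)"
    | "length bs = Suc (Suc (length as))" | "Suc (Suc (length as)) < length bs" by linarith
  then show ?thesis
  proof cases
    case 1
    then have "length (a # a' # as) - length bs = Suc (Suc (length as - length bs))" by auto
    moreover have "as \<noteq> [] \<or> length as - length bs = 0" by auto
    ultimately show ?thesis using agree_opt_swallow[of as "length as - length bs" V a a' \<alpha> \<beta>] assms 1
      by fastforce
  next
    case 2
    have "min \<alpha> \<beta> \<le> v" using agree_opt_1_ge[of \<beta> \<alpha> V bs] assms(2) 2 by (auto simp: min.commute)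
    then show ?thesis using agree_opt_1_Cons[of V a a' as \<alpha> \<beta>] 2 by auto
  next
    case 3
    then show ?thesis by auto
  next
    case 4
    then have "length bs - length as = Suc (Suc (length bs - length (a # a' # as)))" by auto
    then show ?thesis using agree_opt_add2[of V bs \<beta> \<alpha> "length bs - length (a # a' # as)"] assms 4
      by auto
  qed
qed

text \<open>Both orders of the lengths are treated together because swallows in the shorter list
  exchange the roles. The current runs \<open>a0\<close>, \<open>b0\<close> serve as last runs once
  a list is empty.\<close>

lemma agree_opt_lower:
  assumes "agree_cost as bs v"
  shows "(length bs \<le> length as \<longrightarrow>
       agree_opt V as (last (a0 # as)) (last (b0 # bs)) (length as - length bs) \<le> v) \<and>
     (length as \<le> length bs \<longrightarrow>
       agree_opt V bs (last (b0 # bs)) (last (a0 # as)) (length bs - length as) \<le> v)"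
  using assms
proof (induction arbitrary: a0 b0 rule: agree_cost.induct)
  case (2 as bs v a b)
  have "as \<noteq> [] \<or> length as - length bs = 0" "bs \<noteq> [] \<or> length bs - length as = 0" by auto
  then show ?case using "2.IH"[of a b]
    using agree_opt_Cons[of as "length as - length bs" V a "last (a # as)" "last (b # bs)"]
      agree_opt_Cons[of bs "length bs - length as" V b "last (b # bs)" "last (a # as)"]
    by (auto split: if_splits)
next
  case (3 as bs v a a')
  show ?case
    using agree_opt_swallow_le[OF "3.IH"[of a' b0, THEN conjunct1] "3.IH"[of a' b0, THEN conjunct2], of a a']
    by (simp del: last.simps add: last_ConsR)
next
  case (4 as bs v b b')
  show ?case
    using agree_opt_swallow_le[OF "4.IH"[of a0 b', THEN conjunct2] "4.IH"[of a0 b', THEN conjunct1], of b b']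
    by (simp del: last.simps add: last_ConsR)
qed (auto simp: agree_opt_def)

section \<open>Equal first letters: attaining the bound\<close>

lemma agree_cost_Nil_bound: "\<exists>v \<le> sum_list as. agree_cost as [] v"
proof (induction as rule: induct_list012)
  case (3 a a' as)
  then obtain v where "v \<le> sum_list as" "agree_cost as [] v" by auto
  then show ?case by (intro exI[of _ "a + v"]) (auto intro: agree_cost.intros)
qed (auto intro: agree_cost.intros)

lemma agree_cost_same_length: "length as = length bs \<Longrightarrow> agree_cost as bs 0"
  by (induction as bs rule: list_induct2) (auto intro: agree_cost.intros)

text \<open>With an even surplus the last letters agree and the last run of \<open>as\<close> need
  not be swallowed, hence \<open>butlast\<close>. Each of the \<open>r\<close> swallows removes two
  surplus runs; every other run is paired for free.\<close>

lemma agree_cost_even_upper: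
  assumes "length as = length bs + 2 * r" "sum_list as \<le> V"
  shows "\<exists>v \<le> sepmin V (butlast as) r. agree_cost as bs v"
  using assms
proof (induction "length as" arbitrary: as bs r rule: less_induct)
  case less
  show ?case
  proof (cases r)
    case 0
    then show ?thesis using agree_cost_same_length less by auto
  next
    case (Suc r')
    then obtain a a' as' where as: "as = a # a' # as'"
      using less(2) by (cases as; cases "tl as") auto
    obtain v1 where v1: "v1 \<le> sepmin V (butlast as') r'" "agree_cost as' bs v1"
      using less(1)[of as' bs r'] less(2,3) Suc as by auto
    have 1: "\<exists>v \<le> a + sepmin V (butlast as') r'. agree_cost as bs v"
      using v1 as by (intro exI[of _ "a + v1"]) (auto intro: agree_cost.intros)
    have 2: "\<exists>v \<le> sepmin V (butlast (a' # as')) r. agree_cost as bs v"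
    proof (cases bs)
      case Nil
      \<comment> \<open>Now \<open>as\<close> has \<open>2 * r\<close> runs, and skipping
        \<open>a\<close> leaves \<open>2 * r - 2\<close> candidates, too few for \<open>r\<close>
        non-adjacent choices. Any alignment at all is then cheap enough.\<close>
      then have "V \<le> sepmin V (butlast (a' # as')) r"
        using less(2) as Suc by (intro sepmin_infeasible) (simp del: butlast.simps)
      then show ?thesis using agree_cost_Nil_bound[of as] less(3) Nil by (meson order_trans)
    next
      case (Cons b bs')
      then obtain v where "v \<le> sepmin V (butlast (a' # as')) r" "agree_cost (a' # as') bs' v"
        using less(1)[of "a' # as'" bs' r] less(2,3) as by auto
      then show ?thesis using as Cons by (auto intro: agree_cost.intros)
    qed
    have "sepmin V (butlast as) r = min (sepmin V (butlast (a' # as')) r) (a + sepmin V (butlast as') r')"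
      using as Suc by (cases "as' = []") auto
    then show ?thesis using 1 2 by (auto simp: min_def)
  qed
qed

text \<open>All recursive rules preserve parity, so with an even total the derivation cannot end in
  a swallowed last run; a further last run can then be swallowed there.\<close>

lemma agree_cost_snoc:
  assumes "agree_cost as bs v" "even (length as + length bs)"
  shows "agree_cost (as @ [a]) bs (v + a)"
  using assms
proof (induction rule: agree_cost.induct)
  case 1
  then show ?case using agree_cost.intros(5)[of a] by simp
qed (auto intro: agree_cost.intros simp: add.assoc)

lemma agree_cost_odd_upper:
  assumes "length as = length bs + 2 * r + 1" "sum_list as \<le> V"
  shows "\<exists>v \<le> min (last as) (last (b0 # bs)) +
    sepmin V (butlast as @ [last as - last (b0 # bs)]) (Suc r). agree_cost as bs v"
proof -
  define \<alpha> where "\<alpha> = last as"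
  define \<beta> where "\<beta> = last (b0 # bs)"
  define L where "L = butlast as"
  have "as \<noteq> []" using assms(1) by auto
  then have as: "as = L @ [\<alpha>]" by (simp add: L_def \<alpha>_def)
  have V: "sum_list L + \<alpha> \<le> V" using assms(2) as by simp
  obtain v where "v \<le> sepmin V (butlast L) r" "agree_cost L bs v"
    using agree_cost_even_upper[of L bs r V] assms(1) V as by auto
  then have 1: "\<exists>v \<le> \<alpha> + sepmin V (butlast L) r. agree_cost as bs v"
    using agree_cost_snoc[of L bs v \<alpha>] assms(1) as by (intro exI[of _ "v + \<alpha>"]) auto
  have 2: "\<exists>v \<le> \<beta> + sepmin V L (Suc r). agree_cost as bs v"
  proof (cases "bs = []")
    case True
    \<comment> \<open>Here \<open>\<beta>\<close> is the length of the current run, which cannot be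
      swallowed. The formula agrees: \<open>L\<close> has length \<open>2 * r\<close>, too short for
      \<open>r + 1\<close> non-adjacent entries.\<close>
    then have "V \<le> sepmin V L (Suc r)"
      using assms(1) as by (intro sepmin_infeasible) auto
    then show ?thesis using agree_cost_Nil_bound[of as] assms(2) True by (meson order_trans trans_le_add2)
  next
    case False
    then have bs: "bs = butlast bs @ [\<beta>]" by (auto simp: \<beta>_def)
    have len: "length as = length (butlast bs) + 2 * Suc r" using assms(1) False
      by (cases bs) auto
    then obtain v where v: "v \<le> sepmin V L (Suc r)" "agree_cost as (butlast bs) v"
      using agree_cost_even_upper[of as "butlast bs" "Suc r" V] assms(2) L_def by auto
    moreover have "even (length (butlast bs) + length as)" using len by simp
    ultimately have "agree_cost as (butlast bs @ [\<beta>]) (v + \<beta>)"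
      using agree_cost_snoc[OF agree_cost_sym[OF v(2)], of \<beta>] by (intro agree_cost_sym[of _ as]) auto
    then show ?thesis using v bs by (intro exI[of _ "v + \<beta>"]) auto
  qed
  have 3: "min (sepmin V L (Suc r)) (\<alpha> - \<beta> + sepmin V (butlast L) r)
    \<le> sepmin V (L @ [\<alpha> - \<beta>]) (Suc r)" by (rule sepmin_snoc_ge)
  have 4: "sepmin V (butlast L) r \<le> sepmin V L (Suc r)" by (rule sepmin_butlast_le_Suc)
  have "\<exists>v \<le> min \<alpha> \<beta> + sepmin V (L @ [\<alpha> - \<beta>]) (Suc r). agree_cost as bs v"
  proof (cases "\<alpha> \<le> \<beta>")
    case True
    then have "\<alpha> + sepmin V (butlast L) r \<le> min \<alpha> \<beta> + sepmin V (L @ [\<alpha> - \<beta>]) (Suc r)"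
      using 3 4 by auto
    then show ?thesis using 1 by (meson order_trans)
  next
    case False
    then have "\<alpha> + sepmin V (butlast L) r \<le> min \<alpha> \<beta> + sepmin V (L @ [\<alpha> - \<beta>]) (Suc r)
      \<or> \<beta> + sepmin V L (Suc r) \<le> min \<alpha> \<beta> + sepmin V (L @ [\<alpha> - \<beta>]) (Suc r)"
      using 3 by (auto simp: min_def split: if_splits)
    then show ?thesis using 1 2 by (meson order_trans)
  qed
  then show ?thesis by (simp add: \<alpha>_def \<beta>_def L_def)
qed

lemma agree_opt_upper:
  assumes "length bs \<le> length as" "sum_list as \<le> V"
  shows "\<exists>v \<le> agree_opt V as (last (a0 # as)) (last (b0 # bs)) (length as - length bs). agree_cost as bs v"
proof (cases "even (length as - length bs)")
  case True
  then obtain r where "length as - length bs = 2 * r" by (elim evenE)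
  then show ?thesis using agree_cost_even_upper[of as bs r V] assms by (auto simp: agree_opt_def)
next
  case False
  then obtain r where "length as - length bs = 2 * r + 1" by (elim oddE)
  moreover from this have "as \<noteq> []" by auto
  ultimately show ?thesis using agree_cost_odd_upper[of as bs r V b0] assms False
    by (auto simp: agree_opt_def)
qed

section \<open>Different first letters\<close>

definition differ_opt :: "nat \<Rightarrow> nat list \<Rightarrow> nat \<Rightarrow> nat \<Rightarrow> nat \<Rightarrow> nat \<Rightarrow> nat \<Rightarrow> nat" where
  "differ_opt V as a b \<alpha> \<beta> e = min a b + (if odd e then min \<alpha> \<beta> else 0) +
     sepmin V ((a - b) # butlast as @ (if odd e then [\<alpha> - \<beta>] else [])) ((e + 1) div 2)"

text \<open>The head entry \<open>a - b\<close> does at the front what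
  \<open>\<alpha> - \<beta>\<close> does at the back. Choosing it means swallowing the first run of
  the longer list, with surplus \<open>e\<close> afterwards; leaving it out means swallowing the
  first run of the other list, with surplus \<open>e + 2\<close>.\<close>

lemma differ_opt_eq:
  assumes "as \<noteq> []" "tl as = [] \<longrightarrow> e = 0"
  shows "differ_opt V as a b \<alpha> \<beta> (Suc (Suc e)) =
    min a b + min (agree_opt V as \<alpha> \<beta> (Suc (Suc e))) ((a - b) + agree_opt V (tl as) \<alpha> \<beta> e)"
proof -
  define E where "E = (if odd e then [\<alpha> - \<beta>] else [])"
  have "tl (butlast as @ E) = butlast (tl as) @ E"
    using assms by (cases as; cases "tl as = []") (auto simp: E_def)
  then have "sepmin V ((a - b) # butlast as @ E) (Suc ((e + 1) div 2)) =
    min (sepmin V (butlast as @ E) (Suc ((e + 1) div 2)))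
      ((a - b) + sepmin V (butlast (tl as) @ E) ((e + 1) div 2))"
    by (simp only: sepmin.simps(3))
  moreover have "(Suc (Suc e) + 1) div 2 = Suc ((e + 1) div 2)" "odd (Suc (Suc e)) = odd e" by auto
  ultimately show ?thesis
    unfolding differ_opt_def agree_opt_def by (simp only: flip: E_def) linarith
qed

text \<open>For \<open>a \<le> b\<close> the head entry is truncated to \<open>0\<close>; this shows
  that choosing it does not make the remainder dearer.\<close>

lemma agree_opt_tl_le:
  assumes "as \<noteq> []" "tl as = [] \<longrightarrow> e = 0"
  shows "agree_opt V (tl as) \<alpha> \<beta> e \<le> agree_opt V as \<alpha> \<beta> (Suc (Suc e))"
  using sepmin_tl_le_Suc[of V "butlast as @ (if odd e then [\<alpha> - \<beta>] else [])" "(e+1) div 2"] assms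
  by (cases as; cases "tl as = []") (auto simp: agree_opt_def)

lemma differ_opt_longer:
  fixes a b :: nat
  assumes l: "length bs < length as" and V: "sum_list (a # as) \<le> V"
  defines "D \<equiv> differ_opt V as a b (last (a # as)) (last (b # bs)) (length as - length bs + 1)"
  shows "\<exists>v \<le> D. differ_cost (a # as) (b # bs) v"
    and "differ_cost (a # as) (b # bs) v \<Longrightarrow> D \<le> v"
proof -
  obtain a' as' where as: "as = a' # as'" using l by (cases as) auto
  define e where "e = length as' - length bs"
  have e: "length as - length bs + 1 = Suc (Suc e)" using l as by (auto simp: e_def)
  have tl: "tl as = [] \<longrightarrow> e = 0" using as by (auto simp: e_def)
  define \<alpha> where "\<alpha> = last (a # as)"
  define \<beta> where "\<beta> = last (b # bs)"
  have D: "D = min a b + min (agree_opt V as \<alpha> \<beta> (Suc (Suc e))) ((a - b) + agree_opt V as' \<alpha> \<beta> e)"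
    using differ_opt_eq[of as e V a b] tl as unfolding D_def e \<alpha>_def \<beta>_def by simp
  have tl_le: "agree_opt V as' \<alpha> \<beta> e \<le> agree_opt V as \<alpha> \<beta> (Suc (Suc e))"
    using agree_opt_tl_le[OF _ tl] as by simp
  have \<alpha>: "\<alpha> = last (a' # as')" using as by (simp add: \<alpha>_def)
  obtain v1 where v1: "v1 \<le> agree_opt V as' \<alpha> \<beta> e" "agree_cost as' bs v1"
    using agree_opt_upper[of bs as' V a' b] l V as \<alpha> by (auto simp: e_def \<beta>_def)
  have 1: "\<exists>v \<le> a + agree_opt V as' \<alpha> \<beta> e. differ_cost (a # as) (b # bs) v"
    using v1 as by (intro exI[of _ "a + v1"]) (auto intro: differ_cost.intros)
  have 2: "\<exists>v \<le> b + agree_opt V as \<alpha> \<beta> (Suc (Suc e)). differ_cost (a # as) (b # bs) v"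
  proof (cases bs)
    case Nil
    obtain v where v: "v \<le> sum_list as'" "agree_cost as' [] v" using agree_cost_Nil_bound by blast
    then have "differ_cost (a # as) (b # bs) (a + v)" "a + v \<le> V"
      using as Nil V by (auto intro: differ_cost.intros)
    \<comment> \<open>The run \<open>b\<close> has no successor to absorb into, so this option does
      not exist; in the formula the number of choices exceeds what the list can hold.\<close>
    moreover have "V \<le> agree_opt V as \<alpha> \<beta> (Suc (Suc e))"
      unfolding agree_opt_def using as Nil l
      by (intro trans_le_add2 sepmin_infeasible) (auto simp: e_def)
    ultimately show ?thesis by (meson order_trans trans_le_add2)
  next
    case (Cons b' bs')
    then have "\<beta> = last (b' # bs')" "length as - length bs' = Suc (Suc e)" "length bs' \<le> length as"
      using l as by (auto simp: \<beta>_def e_def)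
    then obtain v where "v \<le> agree_opt V as \<alpha> \<beta> (Suc (Suc e))" "agree_cost as bs' v"
      using agree_opt_upper[of bs' as V a b'] V by (auto simp: \<alpha>_def)
    then show ?thesis using Cons by (intro exI[of _ "b + v"]) (auto intro: differ_cost.intros)
  qed
  have "b + agree_opt V as \<alpha> \<beta> (Suc (Suc e)) \<le> D \<or> a + agree_opt V as' \<alpha> \<beta> e \<le> D"
    using tl_le unfolding D by (auto simp: min_def)
  then show "\<exists>v \<le> D. differ_cost (a # as) (b # bs) v" using 1 2 by (meson order_trans)
  show "D \<le> v" if "differ_cost (a # as) (b # bs) v" for v
    using that
  proof cases
    case (1 as'' v' a'')
    then have "agree_opt V as' \<alpha> \<beta> e \<le> v'" using agree_opt_lower[of as' bs v' V a' b] as l \<alpha>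
      by (auto simp: \<beta>_def e_def)
    then show ?thesis using 1 as unfolding D by auto
  next
    case (2 bs' v' b')
    then have "length as - length bs' = Suc (Suc e)" "length bs' \<le> length as"
      using as l by (auto simp: e_def)
    then have "agree_opt V as \<alpha> \<beta> (Suc (Suc e)) \<le> v'"
      using 2 agree_opt_lower[of as bs' v' V a b'] by (auto simp: \<beta>_def \<alpha>_def)
    then show ?thesis using 2 as unfolding D by auto
  next
    case 3
    then show ?thesis using as by auto
  qed
qed

text \<open>
  If the numbers of runs are equal and the letters differ at both ends, then the first and the last
  swallowed run can force an interior swallowed run in either string; this is the only case
  that is symmetric in the two strings.
\<close>

definition run_opt :: "nat \<Rightarrow> nat list \<Rightarrow> nat list \<Rightarrow> bool \<Rightarrow> nat" where
  "run_opt V A B s =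
    (if length A = length B \<and> \<not> s then
       if length A = 1 then max (hd A) (hd B)
       else min (last A) (last B) +
         min (hd A + sepmin V (butlast (tl B) @ [last B - last A]) 1)
             (hd B + sepmin V (butlast (tl A) @ [last A - last B]) 1)
     else let e = length A - length B + (if s then 0 else 1) in
       (if s then 0 else min (hd A) (hd B)) + (if odd e then min (last A) (last B) else 0) +
       sepmin V ((if s then [] else [hd A - hd B]) @ butlast (tl A) @
         (if odd e then [last A - last B] else [])) ((e + 1) div 2))"

lemma run_opt_optimal:
  assumes "A \<noteq> []" "B \<noteq> []" "length B \<le> length A" "sum_list A \<le> V" "sum_list B \<le> V"
  shows "(\<exists>u \<le> run_opt V A B s. align_cost A B s u) \<and> (\<forall>u. align_cost A B s u \<longrightarrow> run_opt V A B s \<le> u)"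
proof -
  obtain a as b bs where A: "A = a # as" "B = b # bs" using assms by (auto simp: neq_Nil_conv)
  consider s | "\<not> s" "length bs < length as" | "\<not> s" "length bs = length as" using assms(3) A by fastforce
  then show ?thesis
  proof cases
    case 1
    then have "run_opt V A B s = agree_opt V as (last (a # as)) (last (b # bs)) (length as - length bs)"
      by (auto simp: run_opt_def agree_opt_def A Let_def)
    then show ?thesis
      using agree_opt_upper[of bs as V a b] agree_opt_lower[of as bs _ V a b] assms A 1
      by (auto simp: align_cost_def)
  next
    case 2
    then have "run_opt V A B s = differ_opt V as a b (last (a # as)) (last (b # bs)) (length as - length bs + 1)"
      by (auto simp: run_opt_def differ_opt_def A Let_def)
    then show ?thesis
      using differ_opt_longer[of bs as a V b] assms A 2 by (auto simp: align_cost_def)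
  next
    case 3
    show ?thesis
    proof (cases as)
      case Nil
      then have "bs = []" using 3 by simp
      then show ?thesis using Nil 3 A
        by (auto simp: run_opt_def align_cost_def intro: differ_cost.intros elim: differ_cost.cases)
    next
      case as: (Cons a' as')
      then obtain b' bs' where bs: "bs = b' # bs'" using 3 by (cases bs) auto
      \<comment> \<open>After swallowing \<open>a\<close> the runs of \<open>bs\<close> outnumber
        those of \<open>as'\<close> by one; after swallowing \<open>b\<close> it is
        \<open>as\<close> that is one longer. Hence the two options select from different
        lists.\<close>
      define D1 where "D1 = agree_opt V bs (last (b # bs)) (last (a' # as')) 1"
      define D2 where "D2 = agree_opt V as (last (a # as)) (last (b' # bs')) 1"
      have l: "length bs' = length as'" using 3 as bs by simp
      have D: "run_opt V A B s = min (a + D1) (b + D2)"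
      proof -
        define p where "p = sepmin V (butlast bs @ [last bs - last as]) 1"
        define q where "q = sepmin V (butlast as @ [last as - last bs]) 1"
        have "run_opt V A B s = min (last as) (last bs) + min (a + p) (b + q)"
          using A 3 as bs unfolding p_def q_def by (simp add: run_opt_def)
        moreover have "D1 = min (last bs) (last as) + p" "D2 = min (last as) (last bs) + q"
          using as bs unfolding D1_def D2_def agree_opt_def p_def q_def by simp_all
        ultimately show ?thesis by linarith
      qed
      obtain v1 where v1: "v1 \<le> D1" "agree_cost bs as' v1"
        using agree_opt_upper[of as' bs V b a'] assms A bs l by (auto simp: D1_def)
      have 1: "\<exists>v \<le> a + D1. differ_cost A B v"
        using v1 A as by (intro exI[of _ "a + v1"]) (auto intro: differ_cost.intros agree_cost_sym)
      obtain v2 where v2: "v2 \<le> D2" "agree_cost as bs' v2"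
        using agree_opt_upper[of bs' as V a b'] assms A as l by (auto simp: D2_def)
      have 2: "\<exists>v \<le> b + D2. differ_cost A B v"
        using v2 A bs by (intro exI[of _ "b + v2"]) (auto intro: differ_cost.intros)
      have "min (a + D1) (b + D2) \<le> v" if "differ_cost A B v" for v
        using that
      proof cases
        case (1 as1 bs1 v' a1 a2 b1)
        then have "D1 \<le> v'" using agree_opt_lower[of as' bs v' V a' b] A as bs l by (auto simp: D1_def)
        then show ?thesis using 1 A by auto
      next
        case (2 as1 bs1 v' a1 b1 b2)
        then have "D2 \<le> v'" using agree_opt_lower[of as bs' v' V a b'] A as bs l by (auto simp: D2_def)
        then show ?thesis using 2 A by auto
      next
        case 3
        then show ?thesis using as A by auto
      qed
      then show ?thesis using 1 2 3 unfolding D by (auto simp: align_cost_def min_def)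
    qed
  qed
qed

section \<open>The distance in closed form\<close>

lemma sum_list_run_lengths: "sum_list (run_lengths x) = length x"
  using concat_runs[of x] by (metis length_concat)

lemma dtw_eq_run_opt:
  assumes "set x \<subseteq> {0, 1}" "set y \<subseteq> {0, 1}" "x \<noteq> []" "y \<noteq> []" "length x + length y \<le> V"
  shows "dtw x y = (if length (runs y) \<le> length (runs x)
     then run_opt V (run_lengths x) (run_lengths y) (hd x = hd y)
     else run_opt V (run_lengths y) (run_lengths x) (hd x = hd y))"
proof -
  have ne: "run_lengths x \<noteq> []" "run_lengths y \<noteq> []"
    using assms by (auto simp: neq_Nil_conv)
  have s: "sum_list (run_lengths x) \<le> V" "sum_list (run_lengths y) \<le> V"
    using assms(5) by (auto simp: sum_list_run_lengths)
  show ?thesis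
  proof (cases "length (runs y) \<le> length (runs x)")
    case True
    then show ?thesis using run_opt_optimal[OF ne _ s] dtw_eqI[OF assms(1-4)] by auto
  next
    case False
    then have "length (run_lengths x) \<le> length (run_lengths y)" by simp
    from run_opt_optimal[OF ne(2,1) this s(2,1)] show ?thesis 
      using False dtw_eqI[OF assms(1-4)] align_cost_sym by (metis (no_types, lifting))
  qed
qed

section \<open>Structured RAM programs\<close>

definition ram_reach :: "nat \<Rightarrow> ram_program \<Rightarrow> ram_config \<Rightarrow> nat \<Rightarrow> (ram_config \<Rightarrow> bool) \<Rightarrow> bool" where
  "ram_reach w P c t Q \<longleftrightarrow> (\<exists>s\<le>t. Q ((ram_step P ^^ s) c) \<and>
     (\<forall>i\<le>s. fits_words w ((ram_step P ^^ i) c)))"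

lemma ram_reach_refl: "fits_words w c \<Longrightarrow> Q c \<Longrightarrow> ram_reach w P c t Q"
  unfolding ram_reach_def by (intro exI[of _ 0]) auto

lemma ram_reach_trans:
  assumes "ram_reach w P c t Q" "\<And>c'. fits_words w c' \<Longrightarrow> Q c' \<Longrightarrow> ram_reach w P c' t' Q'"
  shows "ram_reach w P c (t + t') Q'"
proof -
  obtain s where s: "s \<le> t" "Q ((ram_step P ^^ s) c)" "\<forall>i\<le>s. fits_words w ((ram_step P ^^ i) c)"
    using assms(1) unfolding ram_reach_def by auto
  obtain s' where s': "s' \<le> t'" "Q' ((ram_step P ^^ s') ((ram_step P ^^ s) c))"
    "\<forall>i\<le>s'. fits_words w ((ram_step P ^^ i) ((ram_step P ^^ s) c))"
    using assms(2)[of "(ram_step P ^^ s) c"] s unfolding ram_reach_def by auto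
  have e: "(ram_step P ^^ i) ((ram_step P ^^ s) c) = (ram_step P ^^ (s + i)) c" for i
    by (simp add: add.commute funpow_add)
  have "fits_words w ((ram_step P ^^ i) c)" if "i \<le> s + s'" for i
    using s(3) s'(3) e[of "i - s"] that by (cases "i \<le> s") (auto, metis add_diff_inverse_nat diff_le_mono not_le add_diff_cancel_left')
  then show ?thesis using s(1) s'(1,2) unfolding ram_reach_def e
    by (intro exI[of _ "s + s'"]) auto
qed

lemma ram_reach_step:
  assumes "fits_words w c" "ram_reach w P (ram_step P c) t Q"
  shows "ram_reach w P c (Suc t) Q"
proof -
  have "fits_words w (ram_step P c)"
    using assms(2) unfolding ram_reach_def by (auto dest: spec[of _ 0])
  then have "ram_reach w P c 1 (\<lambda>c'. c' = ram_step P c)" using assms(1)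
    unfolding ram_reach_def by (intro exI[of _ 1]) (auto simp: le_Suc_eq)
  from ram_reach_trans[OF this, of t Q] assms(2) show ?thesis by auto
qed

lemma ram_reach_mono:
  assumes "ram_reach w P c t Q" "t \<le> t'" "\<And>c. Q c \<Longrightarrow> Q' c"
  shows "ram_reach w P c t' Q'"
  using assms unfolding ram_reach_def by (meson order_trans)

text \<open>Jumps are absolute, so a block of code is a function of the address where it is placed.\<close>

type_synonym block = "nat \<Rightarrow> ram_program"

text \<open>Quantifying over the code before and after the block makes the triple independent of its
  position, although jumps are absolute. Control leaves exactly at the end of the block.\<close>

definition runs_to :: "nat \<Rightarrow> block \<Rightarrow> (nat \<Rightarrow> nat) \<Rightarrow> (nat \<Rightarrow> nat) \<Rightarrow> nat \<Rightarrow>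
    ((nat \<Rightarrow> nat) \<Rightarrow> (nat \<Rightarrow> nat) \<Rightarrow> bool) \<Rightarrow> bool" where
  "runs_to w B R M t Q \<longleftrightarrow> (\<forall>pre suf. fits_words w (Config (length pre) R M) \<longrightarrow>
     ram_reach w (pre @ B (length pre) @ suf) (Config (length pre) R M) t
       (\<lambda>c. \<exists>R' M'. c = Config (length pre + length (B (length pre))) R' M' \<and> Q R' M'))"

lemma runs_to_mono:
  assumes "runs_to w B R M t Q" "t \<le> t'" "\<And>R M. Q R M \<Longrightarrow> Q' R M"
  shows "runs_to w B R M t' Q'"
  unfolding runs_to_def
proof (intro allI impI)
  fix pre suf :: ram_program assume "fits_words w (Config (length pre) R M)"
  with assms(1) have "ram_reach w (pre @ B (length pre) @ suf) (Config (length pre) R M) t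
       (\<lambda>c. \<exists>R' M'. c = Config (length pre + length (B (length pre))) R' M' \<and> Q R' M')"
    unfolding runs_to_def by blast
  then show "ram_reach w (pre @ B (length pre) @ suf) (Config (length pre) R M) t'
       (\<lambda>c. \<exists>R' M'. c = Config (length pre + length (B (length pre))) R' M' \<and> Q' R' M')"
    by (rule ram_reach_mono) (use assms in auto)
qed

text \<open>Weakest preconditions of straight-line code. Overflow is checked only at constants and
  additions, since all other instructions produce values bounded by words already present. Jumps get
  \<open>False\<close>.\<close>

fun wp :: "nat \<Rightarrow> ram_instr list \<Rightarrow> (nat \<Rightarrow> nat) \<Rightarrow> (nat \<Rightarrow> nat) \<Rightarrow>
    ((nat \<Rightarrow> nat) \<Rightarrow> (nat \<Rightarrow> nat) \<Rightarrow> bool) \<Rightarrow> bool" where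
  "wp w [] R M Q = Q R M"
| "wp w (Const i k # is) R M Q = (k < 2 ^ w \<and> wp w is (R(i := k)) M Q)"
| "wp w (Move i j # is) R M Q = wp w is (R(i := R j)) M Q"
| "wp w (Add i j k # is) R M Q = (R j + R k < 2 ^ w \<and> wp w is (R(i := R j + R k)) M Q)"
| "wp w (Sub i j k # is) R M Q = wp w is (R(i := R j - R k)) M Q"
| "wp w (Load i j # is) R M Q = wp w is (R(i := M (R j))) M Q"
| "wp w (Store i j # is) R M Q = wp w is R (M(R i := R j)) Q"
| "wp w (Jump l # is) R M Q = False"
| "wp w (JumpLess i j l # is) R M Q = False"

definition straight :: "ram_program \<Rightarrow> block" where
  "straight is = (\<lambda>p. is)"

lemma ram_step_at:
  assumes "P = pre @ i # suf"
  shows "ram_step P (Config (length pre) R M) = ram_exec i (Config (length pre) R M)"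
  using assms by (simp add: ram_step_def ram_halted_def)

lemma ram_reach_straight:
  assumes "wp w is R M Q" "fits_words w (Config p R M)" "P = pre @ is @ suf" "p = length pre"
  shows "ram_reach w P (Config p R M) (length is)
    (\<lambda>c. \<exists>R' M'. c = Config (p + length is) R' M' \<and> Q R' M')"
  using assms
proof (induction w "is" R M Q arbitrary: p pre rule: wp.induct)
  case (1 w R M Q)
  then show ?case by (intro ram_reach_refl) auto
next
  case (2 w i k "is" R M Q)
  have F: "fits_words w (Config (Suc p) (R(i := k)) M)"
    using "2.prems"(1,2) by (simp add: fits_words_def less_imp_diff_less)
  have "ram_reach w P (Config (Suc p) (R(i := k)) M) (length is)
    (\<lambda>c. \<exists>R' M'. c = Config (Suc p + length is) R' M' \<and> Q R' M')"
    using "2.IH"[of "Suc p" "pre @ [Const i k]"] "2.prems" F by (simp add: fun_upd_def)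
  then show ?case using 2 by (auto intro!: ram_reach_step simp: ram_step_at)
next
  case (3 w i j "is" R M Q)
  have F: "fits_words w (Config (Suc p) (R(i := R j)) M)"
    using "3.prems"(1,2) by (simp add: fits_words_def less_imp_diff_less)
  have "ram_reach w P (Config (Suc p) (R(i := R j)) M) (length is)
    (\<lambda>c. \<exists>R' M'. c = Config (Suc p + length is) R' M' \<and> Q R' M')"
    using "3.IH"[of "Suc p" "pre @ [Move i j]"] "3.prems" F by (simp add: fun_upd_def)
  then show ?case using 3 by (auto intro!: ram_reach_step simp: ram_step_at)
next
  case (4 w i j k "is" R M Q)
  have F: "fits_words w (Config (Suc p) (R(i := R j + R k)) M)"
    using "4.prems"(1,2) by (simp add: fits_words_def less_imp_diff_less)
  have "ram_reach w P (Config (Suc p) (R(i := R j + R k)) M) (length is)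
    (\<lambda>c. \<exists>R' M'. c = Config (Suc p + length is) R' M' \<and> Q R' M')"
    using "4.IH"[of "Suc p" "pre @ [Add i j k]"] "4.prems" F by (simp add: fun_upd_def)
  then show ?case using 4 by (auto intro!: ram_reach_step simp: ram_step_at)
next
  case (5 w i j k "is" R M Q)
  have F: "fits_words w (Config (Suc p) (R(i := R j - R k)) M)"
    using "5.prems"(1,2) by (simp add: fits_words_def less_imp_diff_less)
  have "ram_reach w P (Config (Suc p) (R(i := R j - R k)) M) (length is)
    (\<lambda>c. \<exists>R' M'. c = Config (Suc p + length is) R' M' \<and> Q R' M')"
    using "5.IH"[of "Suc p" "pre @ [Sub i j k]"] "5.prems" F by (simp add: fun_upd_def)
  then show ?case using 5 by (auto intro!: ram_reach_step simp: ram_step_at)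
next
  case (6 w i j "is" R M Q)
  have F: "fits_words w (Config (Suc p) (R(i := M (R j))) M)"
    using "6.prems"(1,2) by (simp add: fits_words_def less_imp_diff_less)
  have "ram_reach w P (Config (Suc p) (R(i := M (R j))) M) (length is)
    (\<lambda>c. \<exists>R' M'. c = Config (Suc p + length is) R' M' \<and> Q R' M')"
    using "6.IH"[of "Suc p" "pre @ [Load i j]"] "6.prems" F by (simp add: fun_upd_def)
  then show ?case using 6 by (auto intro!: ram_reach_step simp: ram_step_at)
next
  case (7 w i j "is" R M Q)
  have F: "fits_words w (Config (Suc p) R (M(R i := R j)))"
    using "7.prems"(1,2) by (simp add: fits_words_def less_imp_diff_less)
  have "ram_reach w P (Config (Suc p) R (M(R i := R j))) (length is)
    (\<lambda>c. \<exists>R' M'. c = Config (Suc p + length is) R' M' \<and> Q R' M')"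
    using "7.IH"[of "Suc p" "pre @ [Store i j]"] "7.prems" F by (simp add: fun_upd_def)
  then show ?case using 7 by (auto intro!: ram_reach_step simp: ram_step_at)
qed auto

lemma runs_to_straight:
  assumes "wp w is R M Q"
  shows "runs_to w (straight is) R M (length is) Q"
  unfolding runs_to_def straight_def using ram_reach_straight[OF assms] by blast

definition seq :: "block \<Rightarrow> block \<Rightarrow> block" (infixr \<open>;;\<close> 60) where
  "(B ;; B') = (\<lambda>p. B p @ B' (p + length (B p)))"

lemma runs_to_seq:
  assumes "runs_to w B R M t (\<lambda>R' M'. runs_to w B' R' M' t' Q)"
  shows "runs_to w (B ;; B') R M (t + t') Q"
  unfolding runs_to_def
proof (intro allI impI)
  fix pre suf :: ram_program
  define p where "p = length pre"
  define P where "P = pre @ (B ;; B') p @ suf"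
  assume "fits_words w (Config (length pre) R M)"
  then have "ram_reach w (pre @ B p @ (B' (p + length (B p)) @ suf)) (Config p R M) t
       (\<lambda>c. \<exists>R' M'. c = Config (p + length (B p)) R' M' \<and> runs_to w B' R' M' t' Q)"
    using assms unfolding runs_to_def[of w B] p_def by blast
  then have "ram_reach w P (Config p R M) t
       (\<lambda>c. \<exists>R' M'. c = Config (p + length (B p)) R' M' \<and> runs_to w B' R' M' t' Q)"
    by (simp add: P_def seq_def)
  then show "ram_reach w (pre @ (B ;; B') (length pre) @ suf) (Config (length pre) R M) (t + t')
       (\<lambda>c. \<exists>R' M'. c = Config (length pre + length ((B ;; B') (length pre))) R' M' \<and> Q R' M')"
    unfolding p_def[symmetric] P_def[symmetric]
  proof (rule ram_reach_trans)
    fix c assume c: "fits_words w c" "\<exists>R' M'. c = Config (p + length (B p)) R' M' \<and> runs_to w B' R' M' t' Q"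
    then obtain R' M' where *: "c = Config (p + length (B p)) R' M'" "runs_to w B' R' M' t' Q" by blast
    from *(2)[unfolded runs_to_def, rule_format, of "pre @ B p" suf] c(1) *(1)
    show "ram_reach w P c t' (\<lambda>c. \<exists>R' M'. c = Config (p + length ((B ;; B') p)) R' M' \<and> Q R' M')"
      by (simp add: P_def seq_def p_def add.assoc)
  qed
qed

definition if_less :: "nat \<Rightarrow> nat \<Rightarrow> block \<Rightarrow> block \<Rightarrow> block" where
  "if_less i j B B' = (\<lambda>p. let q = p + 2 + length (B' (p + 1)) in
     JumpLess i j q # B' (p + 1) @ Jump (q + length (B q)) # B q)"

lemma runs_to_if:
  assumes "R i < R j \<Longrightarrow> runs_to w B R M t Q" "\<not> R i < R j \<Longrightarrow> runs_to w B' R M t Q"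
  shows "runs_to w (if_less i j B B') R M (t + 2) Q"
  unfolding runs_to_def
proof (intro allI impI)
  fix pre suf :: ram_program
  define p where "p = length pre"
  define q where "q = p + 2 + length (B' (p + 1))"
  define C where "C = JumpLess i j q # B' (p + 1) @ Jump (q + length (B q)) # B q"
  have C: "if_less i j B B' p = C" by (simp add: if_less_def C_def q_def Let_def)
  define P where "P = pre @ C @ suf"
  assume fits: "fits_words w (Config (length pre) R M)"
  let ?Q = "\<lambda>c. \<exists>R' M'. c = Config (p + length C) R' M' \<and> Q R' M'"
  have step: "ram_step P (Config p R M) = Config (if R i < R j then q else Suc p) R M"
    using ram_step_at[of P pre "JumpLess i j q" "B' (p + 1) @ Jump (q + length (B q)) # B q @ suf" R M]
    by (simp add: P_def C_def p_def)
  have "ram_reach w P (Config p R M) (Suc (t + 1)) ?Q"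
  proof (rule ram_reach_step)
    show "fits_words w (Config p R M)" using fits by (simp add: p_def)
    show "ram_reach w P (ram_step P (Config p R M)) (t + 1) ?Q"
    proof (cases "R i < R j")
      case True
      have "ram_reach w P (Config q R M) t
          (\<lambda>c. \<exists>R' M'. c = Config (q + length (B q)) R' M' \<and> Q R' M')"
        using assms(1)[OF True, unfolded runs_to_def, rule_format,
            of "pre @ JumpLess i j q # B' (p + 1) @ [Jump (q + length (B q))]" suf] fits
        by (simp add: P_def C_def p_def q_def fits_words_def)
      then have "ram_reach w P (Config q R M) (t + 1) ?Q"
        by (rule ram_reach_mono) (auto simp: C_def q_def)
      then show ?thesis using True unfolding step by simp
    next
      case False
      have "ram_reach w P (Config (Suc p) R M) t
          (\<lambda>c. \<exists>R' M'. c = Config (Suc p + length (B' (Suc p))) R' M' \<and> Q R' M')"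
        using assms(2)[OF False, unfolded runs_to_def, rule_format,
            of "pre @ [JumpLess i j q]" "Jump (q + length (B q)) # B q @ suf"] fits
        by (simp add: P_def C_def p_def fits_words_def)
      then have "ram_reach w P (Config (Suc p) R M) (t + 1) ?Q"
      proof (rule ram_reach_trans)
        fix c assume c: "fits_words w c"
          "\<exists>R' M'. c = Config (Suc p + length (B' (Suc p))) R' M' \<and> Q R' M'"
        then obtain R' M' where *: "c = Config (Suc p + length (B' (Suc p))) R' M'" "Q R' M'" by blast
        have "ram_step P c = Config (q + length (B q)) R' M'"
          using ram_step_at[of P "pre @ JumpLess i j q # B' (Suc p)" "Jump (q + length (B q))" "B q @ suf" R' M'] *
          by (simp add: P_def C_def p_def)
        then show "ram_reach w P c 1 ?Q" unfolding One_nat_def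
          using c * by (intro ram_reach_step ram_reach_refl) (auto simp: C_def q_def fits_words_def)
      qed
      then show ?thesis using False unfolding step by simp
    qed
  qed
  then show "ram_reach w (pre @ if_less i j B B' (length pre) @ suf) (Config (length pre) R M) (t + 2)
       (\<lambda>c. \<exists>R' M'. c = Config (length pre + length (if_less i j B B' (length pre))) R' M' \<and> Q R' M')"
    unfolding p_def[symmetric] C by (simp add: P_def)
qed

definition while_less :: "nat \<Rightarrow> nat \<Rightarrow> block \<Rightarrow> block" where
  "while_less i j B = (\<lambda>p.
     [JumpLess i j (p + 2), Jump (p + 3 + length (B (p + 2)))] @ B (p + 2) @ [Jump p])"

text \<open>The index \<open>n\<close> of the invariant bounds the rounds still to come. A round
  costs the body, the test and the jump back; the failing test and the jump out give the final two
  steps.\<close>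

lemma runs_to_while:
  assumes init: "I n R M"
    and body: "\<And>n R M. I n R M \<Longrightarrow> R i < R j \<Longrightarrow> runs_to w B R M t (\<lambda>R' M'. \<exists>n'<n. I n' R' M')"
    and exit: "\<And>n R M. I n R M \<Longrightarrow> \<not> R i < R j \<Longrightarrow> Q R M"
  shows "runs_to w (while_less i j B) R M (n * (t + 2) + 2) Q"
  unfolding runs_to_def
proof (intro allI impI)
  fix pre suf :: ram_program
  define p where "p = length pre"
  define b where "b = B (p + 2)"
  define C where "C = [JumpLess i j (p + 2), Jump (p + 3 + length b)] @ b @ [Jump p]"
  have C: "while_less i j B p = C" by (simp add: while_less_def C_def b_def)
  define P where "P = pre @ C @ suf"
  let ?Q = "\<lambda>c. \<exists>R' M'. c = Config (p + length C) R' M' \<and> Q R' M'"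
  have "ram_reach w P (Config p R M) (n * (t + 2) + 2) ?Q"
    if "I n R M" "fits_words w (Config p R M)" for n R M
    using that
  proof (induction n arbitrary: R M rule: less_induct)
    case (less n)
    have step: "ram_step P (Config p R M) = Config (if R i < R j then p + 2 else Suc p) R M"
      using ram_step_at[of P pre "JumpLess i j (p + 2)"
          "Jump (p + 3 + length b) # b @ Jump p # suf" R M]
      by (simp add: P_def C_def p_def)
    show ?case
    proof (cases "R i < R j")
      case False
      have "ram_step P (Config (Suc p) R M) = Config (p + length C) R M"
        using ram_step_at[of P "pre @ [JumpLess i j (p + 2)]" "Jump (p + 3 + length b)" "b @ Jump p # suf" R M]
        by (simp add: P_def C_def p_def)
      then have "ram_reach w P (Config p R M) (Suc (Suc 0)) ?Q"
        using False less(3) exit[OF less(2) False] step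
        by (intro ram_reach_step ram_reach_refl) (auto simp: fits_words_def)
      then show ?thesis by (rule ram_reach_mono) auto
    next
      case True
      have "ram_reach w P (Config (p + 2) R M) t
          (\<lambda>c. \<exists>R' M'. c = Config (p + 2 + length b) R' M' \<and> (\<exists>n'<n. I n' R' M'))"
        using body[OF less(2) True, unfolded runs_to_def, rule_format,
            of "pre @ [JumpLess i j (p + 2), Jump (p + 3 + length b)]" "Jump p # suf"] less(3)
        by (simp add: P_def C_def b_def p_def fits_words_def)
      then have "ram_reach w P (Config (p + 2) R M) (t + Suc ((n - 1) * (t + 2) + 2)) ?Q"
      proof (rule ram_reach_trans)
        fix c assume c: "fits_words w c"
          "\<exists>R' M'. c = Config (p + 2 + length b) R' M' \<and> (\<exists>n'<n. I n' R' M')"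
        then obtain R' M' n' where *: "c = Config (p + 2 + length b) R' M'" "n' < n" "I n' R' M'" by blast
        have "ram_step P c = Config p R' M'"
          using ram_step_at[of P "pre @ [JumpLess i j (p + 2), Jump (p + 3 + length b)] @ b" "Jump p" suf R' M'] *
          by (simp add: P_def C_def p_def)
        moreover have "fits_words w (Config p R' M')" using c * by (simp add: fits_words_def)
        then have "ram_reach w P (Config p R' M') (n' * (t + 2) + 2) ?Q" 
          using less(1) * by blast
        then have "ram_reach w P (Config p R' M') ((n - 1) * (t + 2) + 2) ?Q"
          by (rule ram_reach_mono) (use * in \<open>auto intro!: mult_le_mono1 simp del: mult_Suc_right\<close>)
        ultimately show "ram_reach w P c (Suc ((n - 1) * (t + 2) + 2)) ?Q"
          using c(1) by (intro ram_reach_step) auto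
      qed
      then have "ram_reach w P (Config p R M) (Suc (t + Suc ((n - 1) * (t + 2) + 2))) ?Q"
        using True step less(3) by (intro ram_reach_step) auto
      moreover have "n \<noteq> 0" using less(2) True body[OF less(2) True]
        \<open>ram_reach w P (Config (p + 2) R M) t _\<close> by (auto simp: ram_reach_def)
      ultimately show ?thesis by (cases n) (auto elim: ram_reach_mono)
    qed
  qed
  then show "fits_words w (Config (length pre) R M) \<Longrightarrow>
    ram_reach w (pre @ while_less i j B (length pre) @ suf) (Config (length pre) R M) (n * (t + 2) + 2)
       (\<lambda>c. \<exists>R' M'. c = Config (length pre + length (while_less i j B (length pre))) R' M' \<and> Q R' M')"
    unfolding p_def[symmetric] C using init by (simp add: P_def)
qed

section \<open>Composition rules with slack in the time bound\<close>

lemma runs_to_straightI: "length is \<le> t \<Longrightarrow> wp w is R M Q \<Longrightarrow> runs_to w (straight is) R M t Q"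
  using runs_to_straight runs_to_mono by blast

lemma runs_to_straight_seqI:
  assumes "length is \<le> t" "wp w is R M (\<lambda>R' M'. runs_to w B R' M' (t - length is) Q)"
  shows "runs_to w (straight is ;; B) R M t Q"
  using runs_to_seq[OF runs_to_straight[OF assms(2)]] assms(1) by simp

lemma runs_to_ifI:
  assumes "2 \<le> t" "R i < R j \<Longrightarrow> runs_to w B R M (t - 2) Q"
    "\<not> R i < R j \<Longrightarrow> runs_to w B' R M (t - 2) Q"
  shows "runs_to w (if_less i j B B') R M t Q"
  by (rule runs_to_mono[OF runs_to_if[OF assms(2,3)]]) (use assms(1) in auto)

lemma runs_to_if_seqI:
  assumes "t + 2 + t' \<le> T" "R i < R j \<Longrightarrow> runs_to w B R M t (\<lambda>R' M'. runs_to w C R' M' t' Q)"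
    "\<not> R i < R j \<Longrightarrow> runs_to w B' R M t (\<lambda>R' M'. runs_to w C R' M' t' Q)"
  shows "runs_to w (if_less i j B B' ;; C) R M T Q"
  by (rule runs_to_mono[OF runs_to_seq[OF runs_to_if[OF assms(2,3)]]]) (use assms(1) in auto)

lemma runs_to_while_seqI:
  assumes "n * (t + 2) + 2 + t' \<le> T" "I n R M"
    and "\<And>n R M. I n R M \<Longrightarrow> R i < R j \<Longrightarrow> runs_to w B R M t (\<lambda>R' M'. \<exists>n'<n. I n' R' M')"
    and "\<And>n R M. I n R M \<Longrightarrow> \<not> R i < R j \<Longrightarrow> runs_to w C R M t' Q"
  shows "runs_to w (while_less i j B ;; C) R M T Q"
  by (rule runs_to_mono[OF runs_to_seq[OF runs_to_while[where I = I, OF assms(2-4)]]])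
    (use assms(1) in auto)

lemma runs_to_ram_computes:
  assumes "runs_to w B R M t (\<lambda>R' M'. R' 0 = v)" "fits_words w (Config 0 R M)"
  shows "ram_computes w (B 0) (Config 0 R M) v t"
  using assms(1)[unfolded runs_to_def, rule_format, of "[]" "[]"] assms(2)
  unfolding ram_reach_def ram_computes_def ram_halted_def by fastforce

section \<open>Selection by contraction\<close>

text \<open>
  The current list is \<open>rev st @ rest\<close>: the stack \<open>st\<close>, top first, holds the part already scanned. It
  increases strictly from the top down, so that an entry below the top is always at least the top and
  an incoming entry \<open>c\<close> triggers a contraction exactly if the top is at most \<open>c\<close>.
\<close>

definition comp_inv :: "nat \<Rightarrow> nat list \<Rightarrow> nat list \<Rightarrow> nat list \<Rightarrow> nat list \<Rightarrow> bool" where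
  "comp_inv N L recs st rest \<longleftrightarrow> sorted_wrt (<) st \<and> sum_list st + sum_list rest \<le> N \<and>
     (\<forall>b \<in> set recs. b \<le> N) \<and> length recs + length st + length rest \<le> length L \<and>
     sepmin (Suc N) L = foldr offer recs (sepmin (Suc N) (rev st @ rest))"

lemma comp_inv_init: "sum_list L \<le> N \<Longrightarrow> comp_inv N L [] [] L"
  by (simp add: comp_inv_def)

lemma comp_inv_push:
  assumes "comp_inv N L recs st (c # rest)" "st = [] \<or> c < hd st"
  shows "comp_inv N L recs (c # st) rest"
  using assms by (cases st) (auto simp: comp_inv_def)

text \<open>The merged entry returns to the unread part instead of being pushed, because it may
  trigger another contraction. The stack stays sorted, as it only loses entries.\<close>

lemma comp_inv_contract:
  assumes "comp_inv N L recs (b # a # st) (c # rest)" "b \<le> c"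
  shows "comp_inv N L (recs @ [b]) st ((c + a - b) # rest)"
proof -
  have "b \<le> a" using assms(1) by (auto simp: comp_inv_def)
  then have "sepmin (Suc N) (rev st @ a # b # c # rest) = offer b (sepmin (Suc N) (rev st @ (a + c - b) # rest))"
    using sepmin_contract[OF _ assms(2)] by blast
  then show ?thesis using assms unfolding comp_inv_def by (auto simp: add.commute)
qed

lemma comp_inv_drop:
  assumes "comp_inv N L recs [b] (c # rest)" "b \<le> c"
  shows "comp_inv N L (recs @ [b]) [] rest"
proof -
  have "sepmin (Suc N) (b # c # rest) = offer b (sepmin (Suc N) rest)"
    using sepmin_contract_left[OF assms(2)] by blast
  then show ?thesis using assms unfolding comp_inv_def by auto
qed

text \<open>When nothing is unread, the top is the last entry and at most its neighbour. Contracting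
  at the right end pays the top and discards that neighbour as well, hence
  \<open>tl\<close>.\<close>

lemma comp_inv_unload:
  assumes "comp_inv N L recs (b # st) []"
  shows "comp_inv N L (recs @ [b]) (tl st) []"
proof (cases st)
  case Nil
  have "sepmin (Suc N) [b] = offer b (sepmin (Suc N) [])"
  proof
    fix r show "sepmin (Suc N) [b] r = offer b (sepmin (Suc N) []) r" by (cases r) auto
  qed
  then show ?thesis using assms Nil unfolding comp_inv_def by auto
next
  case (Cons a st')
  have "b \<le> a" using assms(1) Cons by (auto simp: comp_inv_def)
  then have "sepmin (Suc N) (rev st' @ [a, b]) = offer b (sepmin (Suc N) (rev st'))"
    using sepmin_contract_right by blast
  then show ?thesis using assms Cons unfolding comp_inv_def by auto
qed

lemma comp_inv_final:
  assumes "comp_inv N L recs [] []"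
  shows "sepmin (Suc N) L q = (\<Sum>v<Suc N. q - length (filter (\<lambda>b. b \<le> v) recs))"
proof -
  have "sepmin (Suc N) [] = (\<lambda>r. r * Suc N)" by auto
  then show ?thesis using assms foldr_offer_eq_sum[of recs "Suc N" q] 
    unfolding comp_inv_def by (simp add: le_SucI)
qed

section \<open>Arrays in memory and the selection code\<close>

definition array :: "(nat \<Rightarrow> nat) \<Rightarrow> nat \<Rightarrow> nat list \<Rightarrow> bool" where
  "array M p L \<longleftrightarrow> (\<forall>i<length L. M (p + i) = L ! i)"

lemma array_Nil [simp]: "array M p []"
  by (simp add: array_def)

lemma array_Cons: "array M p (a # L) \<longleftrightarrow> M p = a \<and> array M (Suc p) L"
  unfolding array_def by (auto simp: nth_Cons' less_Suc_eq_0_disj)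

lemma array_append: "array M p (L @ L') \<longleftrightarrow> array M p L \<and> array M (p + length L) L'"
  by (induction L arbitrary: p) (auto simp: array_Cons)

lemma array_fun_upd: "a < p \<or> p + length L \<le> a \<Longrightarrow> array (M(a := v)) p L \<longleftrightarrow> array M p L"
proof -
  assume "a < p \<or> p + length L \<le> a"
  then have "(M(a := v)) (p + i) = M (p + i)" if "i < length L" for i using that by auto
  then show ?thesis unfolding array_def by simp
qed

text \<open>
  Registers of \<open>select_code\<close>: 2 holds the input length \<open>N\<close>, 3 holds 1, 6 the number of entries to
  choose, 0 the cost accumulated so far; the list occupies the addresses from register 8 up to
  register 9. The stack occupies the addresses from register 8 up to register 10, and register 11
  points to the next unread entry. The payments of value \<open>v\<close> are counted at address \<open>2 N + v\<close>.
\<close>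

definition push_code :: block where
  "push_code = straight [Store 10 13, Add 10 10 3, Add 11 11 3]"

definition compress_code :: block where
  "compress_code = straight [Load 13 11] ;;
     if_less 8 10
       (straight [Sub 14 10 3, Load 15 14] ;;
        if_less 13 15
          push_code
          (straight [Move 10 14, Add 16 12 15, Load 17 16, Add 17 17 3, Store 16 17] ;;
           if_less 8 10
             (straight [Sub 10 10 3, Load 18 10, Add 13 13 18, Sub 13 13 15, Store 11 13])
             (straight [Add 11 11 3])))
       push_code"

definition unload_code :: block where
  "unload_code = straight [Sub 10 10 3, Load 15 10, Add 16 12 15, Load 17 16, Add 17 17 3, Store 16 17] ;;
     if_less 8 10 (straight [Sub 10 10 3]) (straight [])"

definition select_code :: block where
  "select_code = straight [Move 10 8, Move 11 8, Add 12 2 2] ;;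
     while_less 11 9 compress_code ;;
     while_less 8 10 unload_code ;;
     straight [Add 13 12 2, Add 13 13 3] ;;
     while_less 12 13 (straight [Load 14 12, Sub 6 6 14, Add 0 0 6, Add 12 12 3])"

text \<open>Stack and unread part share the region of the original list: one is a prefix, the other
  a suffix, and the cells between them were freed by contractions.\<close>

definition comp_state ::
  "nat \<Rightarrow> nat \<Rightarrow> nat \<Rightarrow> nat list \<Rightarrow> nat \<Rightarrow> nat list \<Rightarrow> nat list \<Rightarrow> nat list \<Rightarrow> (nat \<Rightarrow> nat) \<Rightarrow> (nat \<Rightarrow> nat) \<Rightarrow> bool" where
  "comp_state N q base L lo recs st rest R M \<longleftrightarrow> comp_inv N L recs st rest \<and>
     R 3 = 1 \<and> R 2 = N \<and> R 6 = q \<and> R 0 = base \<and> R 8 = lo \<and> R 12 = N + N \<and>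
     R 10 = lo + length st \<and> R 11 + length rest = lo + length L \<and>
     array M lo (rev st) \<and> array M (R 11) rest \<and> (\<forall>v\<le>N. M (N + N + v) = count_list recs v)"

text \<open>Unread entries count twice in the measure \<open>n\<close>: a push then lowers it by
  one, a contraction by two, and the contraction at the left end by three.\<close>

definition comp_state_n ::
  "nat \<Rightarrow> nat \<Rightarrow> nat \<Rightarrow> nat list \<Rightarrow> nat \<Rightarrow> nat \<Rightarrow> nat \<Rightarrow> (nat \<Rightarrow> nat) \<Rightarrow> (nat \<Rightarrow> nat) \<Rightarrow> bool" where
  "comp_state_n N q base L lo hi n R M \<longleftrightarrow> (\<exists>recs st rest. comp_state N q base L lo recs st rest R M \<and>
     R 9 = hi \<and> n = 2 * length rest + length st)"

lemma push_code_run: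
  assumes s: "comp_state N q base L lo recs st (c # rest) R M" and R13: "R 13 = c" "R 9 = hi"
    and c: "st = [] \<or> c < hd st"
    and lo: "lo + length L \<le> N + N" and w: "3 * N + 2 < 2 ^ w" and t: "3 \<le> t"
    and n: "2 * length rest + length st + 1 < n"
  shows "runs_to w push_code R M t (\<lambda>R' M'. \<exists>n'<n. comp_state_n N q base L lo hi n' R' M')"
  unfolding push_code_def
proof (rule runs_to_straightI)
  note * = s[unfolded comp_state_def]
  have inv: "comp_inv N L recs (c # st) rest" using comp_inv_push c * by blast
  then have len: "Suc (length st) + length rest \<le> length L" by (auto simp: comp_inv_def)
  have "comp_state N q base L lo recs (c # st) rest (R(10 := lo + length st + 1, 11 := R 11 + 1))
     (M(lo + length st := c))"
    using * inv len lo by (auto simp: comp_state_def array_append array_Cons array_fun_upd)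
  then have "comp_state_n N q base L lo hi (2 * length rest + length st + 1)
     (R(10 := lo + length st + 1, 11 := R 11 + 1)) (M(lo + length st := c))"
    unfolding comp_state_n_def using R13 by (intro exI[of _ recs] exI[of _ "c # st"] exI[of _ rest]) auto
  then show "wp w [Store 10 13, Add 10 10 3, Add 11 11 3] R M
     (\<lambda>R' M'. \<exists>n'<n. comp_state_n N q base L lo hi n' R' M')"
    using * R13 n w lo len by (auto intro!: exI[of _ "2 * length rest + length st + 1"])
qed (use t in simp)

lemma compress_code_run:
  assumes s: "comp_state_n N q base L lo hi n R M" and less: "R 11 < R 9"
    and hi: "hi = lo + length L \<or> hi \<le> lo"
    and lo: "lo + length L \<le> N + N" and w: "3 * N + 2 < 2 ^ w"
  shows "runs_to w compress_code R M 19 (\<lambda>R' M'. \<exists>n'<n. comp_state_n N q base L lo hi n' R' M')"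
proof -
  obtain recs st rest0 where s0: "comp_state N q base L lo recs st rest0 R M"
    "R 9 = hi" "n = 2 * length rest0 + length st"
    using s by (auto simp: comp_state_n_def)
  have "rest0 \<noteq> []"
  proof
    assume "rest0 = []"
    then have "R 11 = lo + length L" using s0 by (simp add: comp_state_def)
    then show False using less hi s0 by auto
  qed
  then obtain c rest where rest: "rest0 = c # rest" by (cases rest0) auto
  note * = s0(1)[unfolded comp_state_def rest]
  then have inv: "comp_inv N L recs st (c # rest)" and c: "M (R 11) = c"
    by (auto simp: array_Cons)
  have s1: "comp_state N q base L lo recs st (c # rest) (R(13 := c)) M"
    using s0(1) rest by (simp add: comp_state_def)
  have len: "length recs + length st + Suc (length rest) \<le> length L"
    and sum: "sum_list st + c + sum_list rest \<le> N"
    using inv by (auto simp: comp_inv_def)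
  have cnt: "count_list recs v \<le> length recs" for v by (rule count_le_length)
  show ?thesis
  proof (cases st)
    case Nil
    show ?thesis unfolding compress_code_def
      using * c Nil s0 rest push_code_run[OF s1, of hi w 16 n] lo w
      by (auto intro!: runs_to_straight_seqI runs_to_ifI)
  next
    case (Cons b st')
    have b: "M (lo + length st') = b" "array M lo (rev st')" 
      using * Cons by (auto simp: array_append array_Cons)
    have bN: "b \<le> N" using sum Cons by simp
    have s2: "comp_state N q base L lo recs st (c # rest) (R(13 := c, 14 := lo + length st', 15 := b)) M"
      using s1 by (simp add: comp_state_def)
    define M1 where "M1 = M(N + N + b := Suc (count_list recs b))"
    have cntM1: "\<forall>v\<le>N. M1 (N + N + v) = count_list (recs @ [b]) v"
      using * by (auto simp: M1_def)
    have arr: "array M1 lo (rev st')" "array M1 (R 11) (c # rest)"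
      using * b lo len Cons unfolding M1_def by (subst array_fun_upd; auto)+
    have rec: "runs_to w (if_less 8 10
             (straight [Sub 10 10 3, Load 18 10, Add 13 13 18, Sub 13 13 15, Store 11 13])
             (straight [Add 11 11 3])) (R(13 := c, 14 := lo + length st', 15 := b, 
               10 := lo + length st', 16 := N + N + b, 17 := Suc (count_list recs b))) M1 7
            (\<lambda>R' M'. \<exists>n'<n. comp_state_n N q base L lo hi n' R' M')"
      if "b \<le> c"
    proof (cases st')
      case Nil
      have i2: "comp_inv N L (recs @ [b]) [] rest"
        using comp_inv_drop inv Cons Nil that by blast
      have "comp_state_n N q base L lo hi (2 * length rest)
         (R(13 := c, 14 := lo, 15 := b, 
               10 := lo, 16 := N + N + b, 17 := Suc (count_list recs b), 11 := Suc (R 11))) M1"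
        unfolding comp_state_n_def
        using * arr s0 i2 cntM1 Nil
        by (intro exI[of _ "recs @ [b]"] exI[of _ "[]"] exI[of _ rest]) (auto simp: comp_state_def array_Cons)
      then show ?thesis using * s0(3) rest Cons Nil w lo len
        by (auto intro!: runs_to_ifI runs_to_straightI exI[of _ "2 * length rest"])
    next
      case (Cons a st'')
      have i2: "comp_inv N L (recs @ [b]) st'' ((c + a - b) # rest)"
        using comp_inv_contract inv \<open>st = b # st'\<close> Cons that by blast
      have a: "M1 (lo + length st'') = a" "array M1 lo (rev st'')" 
        using arr Cons by (auto simp: array_append array_Cons)
      have ac: "c + a \<le> N" using sum \<open>st = b # st'\<close> Cons by simp
      have "comp_state_n N q base L lo hi (2 * Suc (length rest) + length st'')
         (R(14 := lo + length st', 15 := b, 16 := N + N + b, 17 := Suc (count_list recs b), 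
            10 := lo + length st'', 18 := a, 13 := c + a - b)) (M1(R 11 := c + a - b))"
        unfolding comp_state_n_def
        using * arr a s0 i2 cntM1 Cons \<open>st = b # st'\<close> len lo
        by (intro exI[of _ "recs @ [b]"] exI[of _ "st''"] exI[of _ "(c + a - b) # rest"])
          (auto simp: comp_state_def array_Cons array_fun_upd)
      then show ?thesis using * s0(3) rest Cons \<open>st = b # st'\<close> w lo len a ac
        by (auto intro!: runs_to_ifI runs_to_straightI exI[of _ "2 * Suc (length rest) + length st''"]
          simp: fun_upd_twist)
    qed
    have "runs_to w (if_less 13 15
          push_code
          (straight [Move 10 14, Add 16 12 15, Load 17 16, Add 17 17 3, Store 16 17] ;;
           if_less 8 10
             (straight [Sub 10 10 3, Load 18 10, Add 13 13 18, Sub 13 13 15, Store 11 13])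
             (straight [Add 11 11 3]))) (R(13 := c, 14 := lo + length st', 15 := b)) M 14
            (\<lambda>R' M'. \<exists>n'<n. comp_state_n N q base L lo hi n' R' M')"
      using rec push_code_run[OF s2, of hi w 12 n] * s0 rest Cons w lo len cnt[of b] bN
      by (auto intro!: runs_to_ifI runs_to_straight_seqI simp: M1_def)
    then show ?thesis unfolding compress_code_def
      using * c Cons s0 rest b
      by (auto intro!: runs_to_straight_seqI runs_to_ifI)
  qed
qed

definition unload_state_n ::
  "nat \<Rightarrow> nat \<Rightarrow> nat \<Rightarrow> nat list \<Rightarrow> nat \<Rightarrow> nat \<Rightarrow> (nat \<Rightarrow> nat) \<Rightarrow> (nat \<Rightarrow> nat) \<Rightarrow> bool" where
  "unload_state_n N q base L lo n R M \<longleftrightarrow> (\<exists>recs st. comp_state N q base L lo recs st [] R M \<and>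
     n = length st)"

lemma unload_code_run:
  assumes s: "unload_state_n N q base L lo n R M" and less: "R 8 < R 10"
    and lo: "lo + length L \<le> N + N" and w: "3 * N + 2 < 2 ^ w"
  shows "runs_to w unload_code R M 9 (\<lambda>R' M'. \<exists>n'<n. unload_state_n N q base L lo n' R' M')"
proof -
  obtain recs st0 where s0: "comp_state N q base L lo recs st0 [] R M" "n = length st0"
    using s by (auto simp: unload_state_n_def)
  note * = s0(1)[unfolded comp_state_def]
  have "st0 \<noteq> []" using less * by auto
  then obtain b st where st: "st0 = b # st" by (cases st0) auto
  have inv: "comp_inv N L recs (b # st) []" using * st by auto
  have i2: "comp_inv N L (recs @ [b]) (tl st) []" by (rule comp_inv_unload[OF inv])
  have len: "length recs + Suc (length st) \<le> length L" and bN: "b \<le> N"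
    using inv by (auto simp: comp_inv_def)
  have b: "M (lo + length st) = b" "array M lo (rev st)" 
    using * st by (auto simp: array_append array_Cons)
  define M1 where "M1 = M(N + N + b := Suc (count_list recs b))"
  have cntM1: "\<forall>v\<le>N. M1 (N + N + v) = count_list (recs @ [b]) v"
    using * by (auto simp: M1_def)
  have arr: "array M1 lo (rev st)"
    using * b lo len unfolding M1_def by (subst array_fun_upd; auto)
  define R1 where "R1 = R(10 := lo + length st, 15 := b, 16 := N + N + b, 17 := Suc (count_list recs b))"
  have "unload_state_n N q base L lo (length (tl st)) (R1(10 := lo + length (tl st))) M1"
    unfolding unload_state_n_def
  proof (intro exI conjI)
    show "comp_state N q base L lo (recs @ [b]) (tl st) [] (R1(10 := lo + length (tl st))) M1"
      using * i2 cntM1 arr by (cases st) (auto simp: comp_state_def R1_def array_append)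
  qed simp
  then have u: "\<exists>n'<n. unload_state_n N q base L lo n' (R1(10 := lo + length (tl st))) M1"
    using s0 st by (intro exI[of _ "length (tl st)"]) auto
  have "runs_to w (if_less 8 10 (straight [Sub 10 10 3]) (straight [])) R1 M1 3
     (\<lambda>R' M'. \<exists>n'<n. unload_state_n N q base L lo n' R' M')"
  proof (rule runs_to_ifI)
    assume "R1 8 < R1 10"
    have "R1 10 - R1 3 = lo + length (tl st)" using * \<open>R1 8 < R1 10\<close>
      by (cases st) (auto simp: R1_def)
    then show "runs_to w (straight [Sub 10 10 3]) R1 M1 (3 - 2)
     (\<lambda>R' M'. \<exists>n'<n. unload_state_n N q base L lo n' R' M')" using u
      by (intro runs_to_straightI) auto
  next
    assume "\<not> R1 8 < R1 10"
    then have "st = []" using * by (simp add: R1_def)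
    then have "R1(10 := lo + length (tl st)) = R1" by (auto simp: R1_def)
    then show "runs_to w (straight []) R1 M1 (3 - 2)
     (\<lambda>R' M'. \<exists>n'<n. unload_state_n N q base L lo n' R' M')" using u
      by (intro runs_to_straightI) auto
  qed simp
  moreover have "count_list recs b \<le> length recs" by (rule count_le_length)
  ultimately show ?thesis unfolding unload_code_def
    using * st b bN len lo w by (intro runs_to_straight_seqI) (auto simp: R1_def M1_def)
qed

lemma length_filter_le_eq:
  "length (filter (\<lambda>b. b \<le> v) bs) = length (filter (\<lambda>b. b < v) bs) + count_list bs v" for v :: nat
  by (induction bs) auto

text \<open>Truncated subtraction composes, so subtracting the counters one after another from
  register 6 leaves \<open>q\<close> minus the number of payments up to the current value. Adding up
  these remainders yields the sum of the \<open>q\<close> smallest without sorting.\<close>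

lemma sum_loop_run:
  assumes M: "\<And>v. v \<le> N \<Longrightarrow> M (a + v) = count_list recs v"
    and R: "R 3 = 1" "R 6 = q" "R 0 = base" "R 12 = a" "R 13 = a + Suc N"
    and w: "base + Suc N * q < 2 ^ w" "a + N + 1 < 2 ^ w"
  shows "runs_to w (while_less 12 13 (straight [Load 14 12, Sub 6 6 14, Add 0 0 6, Add 12 12 3])) R M
    (Suc N * 6 + 2) (\<lambda>R' M'. R' 0 = base + (\<Sum>v<Suc N. q - length (filter (\<lambda>b. b \<le> v) recs)))"
proof -
  define f where "f v = q - length (filter (\<lambda>b. b \<le> v) recs)" for v
  define I where "I n R' M' \<longleftrightarrow> (\<exists>v. n + v = Suc N \<and> M' = M \<and> R' 3 = 1 \<and> R' 12 = a + v \<and>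
     R' 13 = a + Suc N \<and> R' 6 = q - length (filter (\<lambda>b. b < v) recs) \<and>
     R' 0 = base + (\<Sum>u<v. f u))" for n and R' M' :: "nat \<Rightarrow> nat"
  have "runs_to w (while_less 12 13 (straight [Load 14 12, Sub 6 6 14, Add 0 0 6, Add 12 12 3])) R M
    (Suc N * (4 + 2) + 2) (\<lambda>R' M'. R' 0 = base + (\<Sum>v<Suc N. f v))"
  proof (rule runs_to_while[where I = I])
    show "I (Suc N) R M" using R by (auto simp: I_def)
  next
    fix n R' M' assume I: "I n R' M'" and "R' 12 < R' 13"
    then obtain v where v: "n + v = Suc N" "M' = M" "R' 3 = 1" "R' 12 = a + v" 
     "R' 13 = a + Suc N" "R' 6 = q - length (filter (\<lambda>b. b < v) recs)"
     "R' 0 = base + (\<Sum>u<v. f u)" by (auto simp: I_def)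
    have vN: "v \<le> N" using v \<open>R' 12 < R' 13\<close> by auto
    have fv: "R' 6 - M (a + v) = f v"
      using v M[OF vN] by (simp add: f_def length_filter_le_eq)
    have "(\<Sum>u<Suc v. f u) \<le> (\<Sum>u<Suc v. q)" by (intro sum_mono) (auto simp: f_def)
    also have "\<dots> = Suc v * q" by simp
    also have "\<dots> \<le> Suc N * q" using vN by (intro mult_le_mono1) auto
    finally have b: "base + ((\<Sum>u<v. f u) + f v) < 2 ^ w" using w(1) by simp
    have f': "f v = q - length (filter (\<lambda>b. b < Suc v) recs)" by (simp add: f_def less_Suc_eq_le)
    have next_I: "\<exists>n'<n. I n' R'' M" if "R'' 3 = 1" "R'' 12 = a + Suc v" "R'' 13 = a + Suc N"
      "R'' 6 = f v" "R'' 0 = base + ((\<Sum>u<v. f u) + f v)" for R''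
      using that v vN f' by (intro exI[of _ "n - 1"]) (auto simp: I_def intro!: exI[of _ "Suc v"])
    show "runs_to w (straight [Load 14 12, Sub 6 6 14, Add 0 0 6, Add 12 12 3]) R' M' 4
          (\<lambda>R' M'. \<exists>n'<n. I n' R' M')"
      using v vN b fv w(2) by (intro runs_to_straightI) (auto intro!: next_I)
  next
    fix n R' M' assume "I n R' M'" "\<not> R' 12 < R' 13"
    then obtain v where v: "n + v = Suc N" "\<not> a + v < a + Suc N" "R' 0 = base + (\<Sum>u<v. f u)"
      unfolding I_def by metis
    then have "v = Suc N" by linarith
    then show "R' 0 = base + (\<Sum>v<Suc N. f v)" using v by blast
  qed
  then show ?thesis by (simp add: f_def)
qed

text \<open>The factor 53 is made up of two rounds of 21 steps for contraction and one round of 11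
  steps for unloading per entry. The alternative \<open>hi \<le> lo\<close> admits an empty list
  whose end pointer lies below its start.\<close>

lemma select_code_run:
  assumes R: "R 2 = N" "R 3 = 1" "R 6 = q" "R 0 = base" "R 8 = lo" "R 9 = hi"
    and hi: "hi = lo + length L \<or> hi \<le> lo \<and> L = []"
    and lo: "lo + length L \<le> N + N"
    and M: "array M lo L" "\<And>v. v \<le> N \<Longrightarrow> M (N + N + v) = 0"
    and sum: "sum_list L \<le> N"
    and w: "3 * N + 2 < 2 ^ w" "base + Suc N * q < 2 ^ w"
  shows "runs_to w select_code R M (53 * length L + 6 * N + 17)
    (\<lambda>R' M'. R' 0 = base + sepmin (Suc N) L q)"
proof -
  let ?Q = "\<lambda>R' M'. R' 0 = base + sepmin (Suc N) L q"
  let ?sum = "while_less 12 13 (straight [Load 14 12, Sub 6 6 14, Add 0 0 6, Add 12 12 3])"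
  let ?fin = "straight [Add 13 12 2, Add 13 13 3] ;; ?sum"
  have fin: "runs_to w ?fin R' M' (6 * N + 10) ?Q"
    if "comp_state N q base L lo recs [] rest R' M'" "rest = []" for recs rest R' M'
  proof (rule runs_to_straight_seqI)
    note * = that(1)[unfolded comp_state_def that(2)]
    have "sepmin (Suc N) L q = (\<Sum>v<Suc N. q - length (filter (\<lambda>b. b \<le> v) recs))"
      using comp_inv_final * by blast
    moreover have "runs_to w ?sum (R'(13 := N + N + N + 1)) M' (Suc N * 6 + 2)
       (\<lambda>R' M'. R' 0 = base + (\<Sum>v<Suc N. q - length (filter (\<lambda>b. b \<le> v) recs)))"
      using * w by (intro sum_loop_run[where a = "N + N"]) auto
    ultimately have "runs_to w ?sum (R'(13 := N + N + N + 1)) M' (6 * N + 8) ?Q"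
      by (simp add: algebra_simps)
    then show "wp w [Add 13 12 2, Add 13 13 3] R' M' (\<lambda>R' M'. runs_to w ?sum R' M' 
       (6 * N + 10 - length [Add 13 12 2, Add 13 13 3]) ?Q)" using * w by (simp add: add.commute)
  qed simp
  have unl: "runs_to w (while_less 8 10 unload_code ;; ?fin) R' M' (11 * length L + 6 * N + 12) ?Q"
    if "comp_state N q base L lo recs st [] R' M'" for recs st R' M'
  proof (rule runs_to_while_seqI[where I = "unload_state_n N q base L lo" and n = "length st" and t = 9])
    show "unload_state_n N q base L lo (length st) R' M'" using that by (auto simp: unload_state_n_def)
    have "length st \<le> length L" using that by (auto simp: comp_state_def comp_inv_def)
    then show "length st * (9 + 2) + 2 + (6 * N + 10) \<le> 11 * length L + 6 * N + 12" by simp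
  next
    fix n R M assume "unload_state_n N q base L lo n R M" "R 8 < R 10"
    then show "runs_to w unload_code R M 9 (\<lambda>R' M'. \<exists>n'<n. unload_state_n N q base L lo n' R' M')"
      using unload_code_run lo w by blast
  next
    fix n R M assume *: "unload_state_n N q base L lo n R M" "\<not> R 8 < R 10"
    then obtain recs st where s: "comp_state N q base L lo recs st [] R M"
      by (auto simp: unload_state_n_def)
    then have "st = []" using *(2) by (auto simp: comp_state_def)
    then show "runs_to w ?fin R M (6 * N + 10) ?Q" using fin s by blast
  qed
  have "runs_to w (while_less 11 9 compress_code ;; while_less 8 10 unload_code ;; ?fin) 
    (R(10 := lo, 11 := lo, 12 := N + N)) M (53 * length L + 6 * N + 14) ?Q"
  proof (rule runs_to_while_seqI[where I = "comp_state_n N q base L lo hi" and n = "2 * length L" and t = 19])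
    show "comp_state_n N q base L lo hi (2 * length L) (R(10 := lo, 11 := lo, 12 := N + N)) M"
      unfolding comp_state_n_def using R M sum
      by (intro exI[of _ "[]"] exI[of _ L]) (auto simp: comp_state_def comp_inv_init)
    show "2 * length L * (19 + 2) + 2 + (11 * length L + 6 * N + 12) \<le> 53 * length L + 6 * N + 14" by simp
  next
    fix n R M assume "comp_state_n N q base L lo hi n R M" "R 11 < R 9"
    then show "runs_to w compress_code R M 19 (\<lambda>R' M'. \<exists>n'<n. comp_state_n N q base L lo hi n' R' M')"
      using compress_code_run lo w hi by blast
  next
    fix n R M assume *: "comp_state_n N q base L lo hi n R M" "\<not> R 11 < R 9"
    then obtain recs st rest where s: "comp_state N q base L lo recs st rest R M" "R 9 = hi"
      by (auto simp: comp_state_n_def)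
    then have "rest = []" using *(2) hi by (cases rest) (auto simp: comp_state_def comp_inv_def)
    then show "runs_to w (while_less 8 10 unload_code ;; ?fin) R M (11 * length L + 6 * N + 12) ?Q"
      using unl s by blast
  qed
  then show ?thesis unfolding select_code_def
    using R w by (intro runs_to_straight_seqI) (auto simp: add.commute)
qed

section \<open>The program for DTW\<close>

text \<open>\<open>runs\<close> splits off the first run, whereas the encoder reads one letter at a
  time and touches only the last run.\<close>

lemma run_lengths_snoc:
  assumes "z \<noteq> []"
  shows "run_lengths (z @ [c]) = (if c = last z
    then butlast (run_lengths z) @ [Suc (last (run_lengths z))] else run_lengths z @ [1])"
  using assms
proof (induction z rule: runs.induct)
  case (2 a x)
  show ?case
  proof (cases "\<forall>b\<in>set x. b = a")
    case True
    then have t: "takeWhile (\<lambda>b. b = a) x = x" "dropWhile (\<lambda>b. b = a) x = []" by auto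
    have "runs (a # x) = [a # x]" unfolding runs.simps t by simp
    moreover have "takeWhile (\<lambda>b. b = a) (x @ [c]) = x @ takeWhile (\<lambda>b. b = a) [c]"
      "dropWhile (\<lambda>b. b = a) (x @ [c]) = dropWhile (\<lambda>b. b = a) [c]"
      using True by auto
    then have "runs (a # x @ [c]) = (if c = a then [a # x @ [c]] else [a # x, [c]])"
      unfolding runs.simps by simp
    moreover have "last (a # x) = a" using True by auto
    ultimately show ?thesis by (simp del: runs.simps)
  next
    case False
    then obtain b where b: "b \<in> set x" "b \<noteq> a" by auto
    let ?d = "dropWhile (\<lambda>b. b = a) x"
    have t: "takeWhile (\<lambda>b. b = a) (x @ [c]) = takeWhile (\<lambda>b. b = a) x"
      "dropWhile (\<lambda>b. b = a) (x @ [c]) = ?d @ [c]"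
      using b by (auto simp: takeWhile_append1 dropWhile_append1)
    have d: "?d \<noteq> []" using b by (auto simp: dropWhile_eq_Nil_conv)
    then have "last ?d = last (a # x)"
      by (metis last_appendR last_ConsR takeWhile_dropWhile_id append_is_Nil_conv)
    moreover have "runs ?d \<noteq> []" using d by (cases ?d) auto
    ultimately show ?thesis using 2(1)[OF d] t by simp
  qed
qed simp

lemma length_runs_le: "length (runs z) \<le> length z"
proof (induction z rule: runs.induct)
  case (2 a x)
  then show ?case using length_dropWhile_le[of "\<lambda>b. b = a" x] by simp
qed simp

lemma runs_to_seqI:
  assumes "runs_to w B R M t Q'" "\<And>R' M'. Q' R' M' \<Longrightarrow> runs_to w C R' M' t' Q" "t + t' \<le> T"
  shows "runs_to w (B ;; C) R M T Q"
  by (rule runs_to_mono[OF runs_to_seq[OF runs_to_mono[OF assms(1) order_refl assms(2)]] assms(3)])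

text \<open>
  The string between the addresses in registers 5 and 6 is run-length encoded into zeroed memory
  starting at the address in register 7, which is advanced by the distance of consecutive letters.
\<close>

definition rle_code :: block where
  "rle_code = straight [Load 8 5] ;;
     while_less 5 6 (straight [Load 9 5, Sub 10 9 8, Sub 11 8 9, Add 10 10 11, Add 7 7 10,
       Load 11 7, Add 11 11 3, Store 7 11, Move 8 9, Add 5 5 3])"

lemma rle_code_run:
  assumes z: "z \<noteq> []" "set z \<subseteq> {0, 1}"
    and R: "R 3 = 1" "R 5 = p" "R 6 = p + length z" "R 7 = r"
    and M: "array M p z" "\<And>i. i < length z \<Longrightarrow> M (r + i) = 0"
    and r: "p + length z \<le> r" "r + length z + 1 < 2 ^ w"
  shows "runs_to w rle_code R M (12 * length z + 3)
    (\<lambda>R' M'. (\<forall>i. i \<notin> {5, 7, 8, 9, 10, 11} \<longrightarrow> R' i = R i) \<and> R' 5 = p + length z \<and>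
       R' 7 + 1 = r + length (runs z) \<and> array M' r (run_lengths z) \<and>
       (\<forall>a. a < r \<or> r + length (runs z) \<le> a \<longrightarrow> M' a = M a))" (is "runs_to _ _ _ _ _ ?Q")
proof -
  \<comment> \<open>At \<open>c = 0\<close> both truncated predecessors take effect: register 8
    holds the first letter itself and register 7 points to \<open>r\<close>, so the first letter is
    seen as continuing a run of length zero.\<close>
  define I where "I n R' M' \<longleftrightarrow> (\<exists>c rl. n + c = length z \<and> rl = run_lengths (take c z) \<and>
     (\<forall>i. i \<notin> {5, 7, 8, 9, 10, 11} \<longrightarrow> R' i = R i) \<and> R' 5 = p + c \<and>
     R' 7 = r + (length rl - 1) \<and> R' 8 = z ! (c - 1) \<and> array M' r rl \<and>
     (\<forall>a. a < r \<or> r + length rl \<le> a \<longrightarrow> M' a = M a))" for n and R' M' :: "nat \<Rightarrow> nat"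
  let ?body = "[Load 9 5, Sub 10 9 8, Sub 11 8 9, Add 10 10 11, Add 7 7 10,
       Load 11 7, Add 11 11 3, Store 7 11, Move 8 9, Add 5 5 3]"
  have Mz: "M (p + i) = z ! i" if "i < length z" for i using M(1) that by (auto simp: array_def)
  have bin: "z ! i \<le> 1" if "i < length z" for i using z(2) nth_mem[OF that] by auto
  have loop: "runs_to w (while_less 5 6 (straight ?body)) (R(8 := z ! 0)) M (length z * (10 + 2) + 2) ?Q"
  proof (rule runs_to_while[where I = I])
    show "I (length z) (R(8 := z ! 0)) M" using R by (auto simp: I_def)
  next
    fix n R' M' assume I: "I n R' M'" and less: "R' 5 < R' 6"
    then obtain c rl where c: "n + c = length z" "rl = run_lengths (take c z)"
      "\<forall>i. i \<notin> {5, 7, 8, 9, 10, 11} \<longrightarrow> R' i = R i" "R' 5 = p + c"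
      "R' 7 = r + (length rl - 1)" "R' 8 = z ! (c - 1)" "array M' r rl"
      "\<forall>a. a < r \<or> r + length rl \<le> a \<longrightarrow> M' a = M a" by (auto simp: I_def)
    have R': "R' 3 = 1" "R' 6 = p + length z" using c(3) R by auto
    have cz: "c < length z" using less c(4) R' by simp
    have cur: "M' (p + c) = z ! c" using c(8) r Mz[OF cz] cz by auto
    define rl' where "rl' = run_lengths (take (Suc c) z)"
    \<comment> \<open>One of the two truncated differences vanishes, so this is the distance of
      consecutive letters: \<open>1\<close> exactly when a new run starts.\<close>
    define d where "d = (z ! c - z ! (c - 1)) + (z ! (c - 1) - z ! c)"
    have "z ! (c - 1) \<le> 1" using cz by (intro bin) simp
    then have d1: "d \<le> 1" using bin[OF cz] unfolding d_def by linarith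
    have lrl: "length rl \<le> c" using length_runs_le[of "take c z"] c(2) cz by simp
    define j where "j = r + (length rl - 1) + d"
    have j: "j \<le> r + c" using lrl d1 by (cases "c = 0") (auto simp: j_def d_def)
    have key: "j = r + (length rl' - 1) \<and> array (M'(j := Suc (M' j))) r rl' \<and> 
       (\<forall>a. a < r \<or> r + length rl' \<le> a \<longrightarrow> (M'(j := Suc (M' j))) a = M a) \<and> M' j \<le> c"
    proof (cases "c = 0")
      case True
      have "take (Suc c) z = [z ! 0]" using True z(1) by (cases z) auto
      then have "rl' = [1]" by (simp add: rl'_def)
      moreover have "j = r" "M' r = 0" using True c M(2)[of 0] z(1) by (auto simp: j_def d_def)
      ultimately show ?thesis using c(2,8) True by (auto simp: array_Cons)
    next
      case False
      have ne: "take c z \<noteq> []" using False cz by auto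
      have last: "last (take c z) = z ! (c - 1)" using False cz ne by (simp add: last_conv_nth)
      have "rl \<noteq> []" using ne c(2) by (cases "take c z") auto
      then obtain i k where rl: "rl = i @ [k]" by (metis append_butlast_last_id)
      have rl': "rl' = (if z ! c = z ! (c - 1) then i @ [Suc k] else rl @ [1])"
        unfolding rl'_def take_Suc_conv_app_nth[OF cz] run_lengths_snoc[OF ne] last c(2)[symmetric]
        using rl by simp
      have "sum_list rl = c" using c(2) cz sum_list_run_lengths[of "take c z"] by simp
      then have kc: "k \<le> c" using rl by simp
      show ?thesis
      proof (cases "z ! c = z ! (c - 1)")
        case True
        then have "j = r + length i" by (simp add: j_def d_def rl)
        moreover have "M' (r + length i) = k" "array M' r i"
          using c(7) rl by (auto simp: array_append array_Cons)
        ultimately show ?thesis using rl' True c(8) rl kc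
          by (auto simp: array_append array_Cons array_fun_upd)
      next
        case F: False
        then have "d = 1" using d1 by (auto simp: d_def)
        then have j': "j = r + length rl" by (simp add: j_def rl)
        then have "M' j = 0" using c(8) M(2)[of "length rl"] lrl cz by auto
        then show ?thesis using rl' F c(7,8) j' 
          by (auto simp: array_append array_Cons array_fun_upd)
      qed
    qed
    have next_I: "\<exists>n'<n. I n' R'' M''" if "\<forall>i. i \<notin> {5, 7, 8, 9, 10, 11} \<longrightarrow> R'' i = R' i"
      "R'' 5 = p + Suc c" "R'' 7 = j" "R'' 8 = z ! c" "M'' = M'(j := Suc (M' j))" for R'' M''
      unfolding I_def
    proof (intro exI conjI)
      show "n - 1 < n" "n - 1 + Suc c = length z" using c(1) cz by auto
      show "rl' = run_lengths (take (Suc c) z)" by (rule rl'_def)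
      show "\<forall>i. i \<notin> {5, 7, 8, 9, 10, 11} \<longrightarrow> R'' i = R i" using that(1) c(3) by simp
      show "R'' 8 = z ! (Suc c - 1)" using that(4) by simp
    qed (use that key in blast)+
    have j_eq: "r + (length rl - Suc 0) + (z ! c - z ! (c - Suc 0) + (z ! (c - Suc 0) - z ! c)) = j"
      by (simp add: j_def d_def)
    have "z ! c - z ! (c - Suc 0) + (z ! (c - Suc 0) - z ! c) = d" by (simp add: d_def)
    then have bounds: "z ! c - z ! (c - Suc 0) + (z ! (c - Suc 0) - z ! c) < 2 ^ w" "j < 2 ^ w"
      "Suc (M' j) < 2 ^ w" "Suc (p + c) < 2 ^ w"
      using d1 j key r cz by auto
    have wp: "wp w ?body R' M' (\<lambda>R' M'. \<exists>n'<n. I n' R' M')"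
      by (simp add: c(4-6) cur R'(1) j_eq bounds) (rule next_I; simp)
    show "runs_to w (straight ?body) R' M' 10 (\<lambda>R' M'. \<exists>n'<n. I n' R' M')"
      by (rule runs_to_straightI[OF _ wp]) simp
  next
    fix n R' M' assume I: "I n R' M'" and less: "\<not> R' 5 < R' 6"
    then obtain c rl where c: "n + c = length z" "rl = run_lengths (take c z)"
      "\<forall>i. i \<notin> {5, 7, 8, 9, 10, 11} \<longrightarrow> R' i = R i" "R' 5 = p + c"
      "R' 7 = r + (length rl - 1)" "array M' r rl"
      "\<forall>a. a < r \<or> r + length rl \<le> a \<longrightarrow> M' a = M a" by (auto simp: I_def)
    have "R' 6 = p + length z" using c(3) R by auto
    then have "c = length z" using c(1,4) less by simp
    moreover have "runs z \<noteq> []" using z(1) by (cases z) auto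
    ultimately show "?Q R' M'" using c by (cases "runs z") auto
  qed
  show ?thesis unfolding rle_code_def
    using loop R Mz[of 0] z(1) by (intro runs_to_straight_seqI) (auto simp: mult.commute add.commute)
qed

section \<open>Equally many runs and different first letters\<close>

lemma foldr_min_acc: "foldr min U (min t d) = min t (foldr min U d)" for t d :: nat
  by (induction U) (auto simp: min.left_commute)

text \<open>A single choice has no adjacency constraint, and leaving it out at price
  \<open>V\<close> is no better than \<open>d\<close>; a plain minimum remains.\<close>

lemma sepmin_1_snoc: "d \<le> V \<Longrightarrow> sepmin V (L @ [d]) 1 = foldr min L d"
  by (induction L) (auto simp: min.commute)

text \<open>The case of equally many runs and different first letters; \<open>x - (x - y)\<close> is the minimum.\<close>

definition equal_code :: block where
  "equal_code = straight [Load 5 12, Load 6 14] ;;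
     if_less 3 17
       (straight [Sub 13 13 3, Sub 15 15 3, Load 7 13, Load 8 15, Sub 9 7 8, Sub 10 8 7, Sub 11 7 9,
          Add 12 12 3, Add 14 14 3] ;;
        while_less 12 13 (straight [Load 19 12, Load 20 14, Sub 19 9 19, Sub 9 9 19,
          Sub 20 10 20, Sub 10 10 20, Add 12 12 3, Add 14 14 3]) ;;
        straight [Add 5 5 10, Add 6 6 9, Sub 7 5 6, Sub 5 5 7, Add 0 11 5])
       (straight [Sub 6 6 5, Add 0 5 6])"

lemma min_loop_run:
  assumes R: "R 3 = 1" "R 12 + length U = R 13" "R 14 + length U' = e"
    and U: "length U = length U'" "array M (R 12) U" "array M (R 14) U'"
    and w: "R 13 + 1 < 2 ^ w" "e + 1 < 2 ^ w"
  shows "runs_to w (while_less 12 13 (straight [Load 19 12, Load 20 14, Sub 19 9 19, Sub 9 9 19,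
          Sub 20 10 20, Sub 10 10 20, Add 12 12 3, Add 14 14 3])) R M (length U * 10 + 2)
     (\<lambda>R' M'. (\<forall>i. i \<notin> {9, 10, 12, 14, 19, 20} \<longrightarrow> R' i = R i) \<and>
        R' 9 = foldr min U (R 9) \<and> R' 10 = foldr min U' (R 10))"
proof -
  define I where "I n R' M' \<longleftrightarrow> (\<exists>T T'. n = length T \<and> length T = length T' \<and> M' = M \<and>
     (\<forall>i. i \<notin> {9, 10, 12, 14, 19, 20} \<longrightarrow> R' i = R i) \<and>
     R' 12 + length T = R 13 \<and> R' 14 + length T' = e \<and> array M (R' 12) T \<and> array M (R' 14) T' \<and>
     foldr min T (R' 9) = foldr min U (R 9) \<and> foldr min T' (R' 10) = foldr min U' (R 10))"
    for n and R' M' :: "nat \<Rightarrow> nat"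
  let ?body = "[Load 19 12, Load 20 14, Sub 19 9 19, Sub 9 9 19,
          Sub 20 10 20, Sub 10 10 20, Add 12 12 3, Add 14 14 3]"
  have "runs_to w (while_less 12 13 (straight ?body)) R M (length U * (8 + 2) + 2)
     (\<lambda>R' M'. (\<forall>i. i \<notin> {9, 10, 12, 14, 19, 20} \<longrightarrow> R' i = R i) \<and>
        R' 9 = foldr min U (R 9) \<and> R' 10 = foldr min U' (R 10))"
  proof (rule runs_to_while[where I = I])
    show "I (length U) R M" unfolding I_def using R U by (intro exI[of _ U] exI[of _ U']) auto
  next
    fix n R' M' assume I: "I n R' M'" and less: "R' 12 < R' 13"
    then obtain T T' where T: "n = length T" "length T = length T'" "M' = M"
     "\<forall>i. i \<notin> {9, 10, 12, 14, 19, 20} \<longrightarrow> R' i = R i"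
     "R' 12 + length T = R 13" "R' 14 + length T' = e" "array M (R' 12) T" "array M (R' 14) T'"
     "foldr min T (R' 9) = foldr min U (R 9)" "foldr min T' (R' 10) = foldr min U' (R 10)"
      by (auto simp: I_def)
    have R': "R' 3 = 1" "R' 13 = R 13" using R T(4) by auto
    then have "T \<noteq> []" using T(5) less by auto
    then obtain a V b V' where TT: "T = a # V" "T' = b # V'" using T(2) by (cases T; cases T') auto
    have next_I: "\<exists>n'<n. I n' R'' M" if "\<forall>i. i \<notin> {9, 10, 12, 14, 19, 20} \<longrightarrow> R'' i = R' i"
      "R'' 9 = min a (R' 9)" "R'' 10 = min b (R' 10)" "R'' 12 = Suc (R' 12)" "R'' 14 = Suc (R' 14)" for R''
      unfolding I_def using that T TT
      by (intro exI[of _ "length V"] conjI exI[of _ V] exI[of _ V']) (simp_all add: foldr_min_acc array_Cons)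
    have m: "x - (x - y) = min y x" for x y :: nat by auto
    have wp: "wp w ?body R' M' (\<lambda>R' M'. \<exists>n'<n. I n' R' M')"
      using T(3,5-8) TT R' w by (simp add: array_Cons) (rule next_I; simp add: m)
    show "runs_to w (straight ?body) R' M' 8 (\<lambda>R' M'. \<exists>n'<n. I n' R' M')"
      by (rule runs_to_straightI[OF _ wp]) simp
  next
    fix n R' M' assume I: "I n R' M'" and less: "\<not> R' 12 < R' 13"
    then obtain T T' where T: "n = length T" "length T = length T'" "M' = M"
     "\<forall>i. i \<notin> {9, 10, 12, 14, 19, 20} \<longrightarrow> R' i = R i" "R' 12 + length T = R 13"
     "foldr min T (R' 9) = foldr min U (R 9)" "foldr min T' (R' 10) = foldr min U' (R 10)"
      by (auto simp: I_def)
    have "R' 13 = R 13" using T(4) by auto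
    then have "length T = 0" using T(5) less by linarith
    then have "T = []" "T' = []" using T(2) by auto
    then show "(\<forall>i. i \<notin> {9, 10, 12, 14, 19, 20} \<longrightarrow> R' i = R i) \<and>
        R' 9 = foldr min U (R 9) \<and> R' 10 = foldr min U' (R 10)" using T by simp
  qed
  then show ?thesis by simp
qed

lemma equal_code_run:
  assumes AB: "length A = length B" "A \<noteq> []"
    and R: "R 3 = 1" "R 12 = pa" "R 13 = pa + length A" "R 14 = pb" "R 15 = pb + length B" "R 17 = length A"
    and M: "array M pa A" "array M pb B"
    and sum: "sum_list A \<le> N" "sum_list B \<le> N"
    and le: "pa + length A \<le> N + N" "pb + length B \<le> N + N"
    and w: "3 * N + 2 < 2 ^ w"
  shows "runs_to w equal_code R M (10 * length A + 20) (\<lambda>R' M'. R' 0 = run_opt (Suc N) A B False)"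
proof -
  obtain a as b bs where A: "A = a # as" "B = b # bs" using AB by (cases A; cases B) auto
  have ab: "M pa = a" "M pb = b" "array M (Suc pa) as" "array M (Suc pb) bs" "a \<le> N" "b \<le> N"
    using M A sum by (auto simp: array_Cons)
  show ?thesis
  proof (cases "as = []")
    case True
    then have "bs = []" using AB A by simp
    \<comment> \<open>With one run each the cost is the maximum, computed as
      \<open>a + (b - a)\<close>.\<close>
    then show ?thesis unfolding equal_code_def
      using R A True ab w
      by (intro runs_to_straight_seqI) (auto intro!: runs_to_ifI runs_to_straightI simp: run_opt_def)
  next
    case False
    define U where "U = butlast as"
    define U' where "U' = butlast bs"
    define \<alpha> where "\<alpha> = last as"
    define \<beta> where "\<beta> = last bs"
    have bs: "bs \<noteq> []" using False AB A by auto
    have U: "as = U @ [\<alpha>]" "bs = U' @ [\<beta>]" "length U = length U'"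
      using False bs AB A by (auto simp: U_def U'_def \<alpha>_def \<beta>_def)
    have arr: "array M (Suc pa) U" "M (Suc (pa + length U)) = \<alpha>"
      "array M (Suc pb) U'" "M (Suc (pb + length U')) = \<beta>"
      using ab U by (auto simp: array_append array_Cons)
    have \<alpha>: "a + sum_list U + \<alpha> \<le> N" "b + sum_list U' + \<beta> \<le> N" using sum A U by auto
    let ?p = "foldr min U (\<alpha> - \<beta>)" and ?q = "foldr min U' (\<beta> - \<alpha>)"
    have "?p \<le> \<alpha> - \<beta>" "?q \<le> \<beta> - \<alpha>" 
      using foldr_min_acc[of _ "\<alpha> - \<beta>" "\<alpha> - \<beta>"] foldr_min_acc[of _ "\<beta> - \<alpha>" "\<beta> - \<alpha>"]
      by (metis min.cobounded1 min.idem)+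
    then have pq: "a + ?q \<le> N + N" "b + ?p \<le> N + N" "min \<alpha> \<beta> + (a + ?q) \<le> N + N"
      "min \<alpha> \<beta> + (b + ?p) \<le> N + N" using \<alpha> by auto
    have V: "\<alpha> - \<beta> \<le> Suc N" "\<beta> - \<alpha> \<le> Suc N" using \<alpha> by auto
    have opt: "run_opt (Suc N) A B False = min \<alpha> \<beta> + min (a + ?q) (b + ?p)"
      using A U False bs AB(1) sepmin_1_snoc[OF V(1), of U] sepmin_1_snoc[OF V(2), of U']
      unfolding run_opt_def by (simp del: sepmin.simps)
    define R1 where "R1 = R(5 := a, 6 := b, 13 := Suc (pa + length U), 15 := Suc (pb + length U'),
      7 := \<alpha>, 8 := \<beta>, 9 := \<alpha> - \<beta>, 10 := \<beta> - \<alpha>, 11 := min \<alpha> \<beta>, 12 := Suc pa, 14 := Suc pb)"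
    let ?loop = "while_less 12 13 (straight [Load 19 12, Load 20 14, Sub 19 9 19, Sub 9 9 19,
          Sub 20 10 20, Sub 10 10 20, Add 12 12 3, Add 14 14 3])"
    let ?fin = "straight [Add 5 5 10, Add 6 6 9, Sub 7 5 6, Sub 5 5 7, Add 0 11 5]"
    have "runs_to w (?loop ;; ?fin) R1 M (length U * 10 + 7) (\<lambda>R' M'. R' 0 = run_opt (Suc N) A B False)"
    proof (rule runs_to_seqI[OF min_loop_run[of R1 U U' "Suc (pb + length U')"]])
      show "R1 3 = 1" "R1 12 + length U = R1 13" "R1 14 + length U' = Suc (pb + length U')"
        "length U = length U'" "array M (R1 12) U" "array M (R1 14) U'"
        "R1 13 + 1 < 2 ^ w" "Suc (pb + length U') + 1 < 2 ^ w"
        using R arr U le w A by (auto simp: R1_def)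
    next
      fix R' M' assume *: "(\<forall>i. i \<notin> {9, 10, 12, 14, 19, 20} \<longrightarrow> R' i = R1 i) \<and>
        R' 9 = foldr min U (R1 9) \<and> R' 10 = foldr min U' (R1 10)"
      have R': "R' 5 = a" "R' 6 = b" "R' 11 = min \<alpha> \<beta>" "R' 9 = ?p" "R' 10 = ?q"
        using * by (simp_all add: R1_def)
      have m: "x - (x - y) = min x y" for x y :: nat by auto
      have "min \<alpha> \<beta> + min (a + ?q) (b + ?p) \<le> N + N" using pq by linarith
      then show "runs_to w ?fin R' M' 5 (\<lambda>R' M'. R' 0 = run_opt (Suc N) A B False)"
        using R' pq w by (intro runs_to_straightI) (simp_all add: opt m del: min_less_iff_disj)
    qed simp
    then have L: "runs_to w (?loop ;; ?fin) R1 M (length U * 10 + 27) (\<lambda>R' M'. R' 0 = run_opt (Suc N) A B False)"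
      by (rule runs_to_mono) auto
    have m: "x - (x - y) = min x y" for x y :: nat by auto
    show ?thesis unfolding equal_code_def
      using R A U ab arr w le L
      by (intro runs_to_straight_seqI) 
        (auto intro!: runs_to_ifI runs_to_straight_seqI simp: R1_def m fun_upd_twist add.commute mult.commute)
  qed
qed

text \<open>
  All other cases. With \<open>e\<close> as in \<open>run_opt\<close>, the first loop leaves \<open>(e + 1) div 2\<close> in register 6 and, with
  the subsequent subtraction, \<open>e mod 2\<close> in register 7.
\<close>

definition core_code :: block where
  "core_code = straight [Add 5 5 16, Const 6 0, Const 7 0, Const 0 0, Add 8 12 3, Sub 9 13 3] ;;
     while_less 7 5 (straight [Add 6 6 3, Add 7 7 3, Add 7 7 3]) ;;
     straight [Sub 7 7 5] ;;
     if_less 4 16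
       (straight [Load 10 12, Load 11 14, Sub 17 10 11, Sub 0 10 17, Store 12 17, Move 8 12])
       (straight []) ;;
     if_less 4 7
       (straight [Sub 15 15 3, Load 10 9, Load 11 15, Sub 17 10 11, Sub 18 10 17, Add 0 0 18,
          Store 9 17, Move 9 13])
       (straight []) ;;
     select_code"

section \<open>The remaining cases\<close>

lemma halve_run:
  assumes "R 3 = 1" "R 5 = e" "R 6 = 0" "R 7 = 0" "e + 2 < 2 ^ w"
  shows "runs_to w (while_less 7 5 (straight [Add 6 6 3, Add 7 7 3, Add 7 7 3])) R M
     ((e + 1) div 2 * 5 + 2)
     (\<lambda>R' M'. M' = M \<and> R' = R(6 := (e + 1) div 2, 7 := 2 * ((e + 1) div 2)))"
proof -
  define I where "I n R' M' \<longleftrightarrow> (\<exists>h. n + h = (e + 1) div 2 \<and> M' = M \<and> R' = R(6 := h, 7 := 2 * h))"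
    for n R' M'
  have "runs_to w (while_less 7 5 (straight [Add 6 6 3, Add 7 7 3, Add 7 7 3])) R M
     ((e + 1) div 2 * (3 + 2) + 2)
     (\<lambda>R' M'. M' = M \<and> R' = R(6 := (e + 1) div 2, 7 := 2 * ((e + 1) div 2)))"
  proof (rule runs_to_while[where I = I])
    show "I ((e + 1) div 2) R M" using assms by (auto simp: I_def)
  next
    fix n R' M' assume "I n R' M'" "R' 7 < R' 5"
    then obtain h where h: "n + h = (e + 1) div 2" "M' = M" "R' = R(6 := h, 7 := 2 * h)" "2 * h < e"
      using assms by (auto simp: I_def)
    then have "I (n - 1) (R(6 := Suc h, 7 := Suc (Suc (2 * h)))) M" "n - 1 < n"
      by (auto simp: I_def intro!: exI[of _ "Suc h"])
    then have ex: "\<exists>n'<n. I n' (R(6 := Suc h, 7 := Suc (Suc (2 * h)))) M" by blast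
    show "runs_to w (straight [Add 6 6 3, Add 7 7 3, Add 7 7 3]) R' M' 3 (\<lambda>R' M'. \<exists>n'<n. I n' R' M')"
      using h(2-4) assms ex by (intro runs_to_straightI) (auto simp: fun_upd_twist)
  next
    fix n R' M' assume "I n R' M'" "\<not> R' 7 < R' 5"
    then obtain h where h: "n + h = (e + 1) div 2" "M' = M" "R' = R(6 := h, 7 := 2 * h)" "\<not> 2 * h < e"
      using assms by (auto simp: I_def)
    then have "h = (e + 1) div 2" by linarith
    then show "M' = M \<and> R' = R(6 := (e + 1) div 2, 7 := 2 * ((e + 1) div 2))" using h by simp
  qed
  then show ?thesis by simp
qed

lemma last_array: "L \<noteq> [] \<Longrightarrow> array M p L \<Longrightarrow> M (p + (length L - 1)) = last L"
  by (simp add: array_def last_conv_nth)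

text \<open>The list for the selection differs from \<open>A\<close> only at its ends, so it is
  prepared in place: the first cell is skipped or overwritten by the truncated difference, and the
  last one is overwritten or cut off.\<close>

lemma core_code_run:
  assumes AB: "B \<noteq> []" "length B \<le> length A" "length A = length B \<Longrightarrow> s"
    and R: "R 2 = N" "R 3 = 1" "R 4 = 0" "R 5 = length A - length B" "R 12 = pa" "R 13 = pa + length A"
      "R 14 = pb" "R 15 = pb + length B" "R 16 = (if s then 0 else 1)"
    and M: "array M pa A" "array M pb B" "\<And>v. v \<le> N \<Longrightarrow> M (N + N + v) = 0"
    and disj: "pa + length A \<le> pb \<or> pb + length B \<le> pa"
    and sum: "sum_list A \<le> N" "sum_list B \<le> N" "length A \<le> N"
    and le: "pa + length A \<le> N + N" "pb + length B \<le> N + N"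
    and w: "3 * N + 2 < 2 ^ w" "3 * N + N * N < 2 ^ w"
  shows "runs_to w core_code R M (58 * length A + 6 * N + 44) (\<lambda>R' M'. R' 0 = run_opt (Suc N) A B s)"
proof -
  obtain a as b bs where A: "A = a # as" "B = b # bs" using AB(1,2) by (cases A; cases B) auto
  define e where "e = length A - length B + (if s then 0 else 1)"
  define q where "q = (e + 1) div 2"
  define base where "base = (if s then 0 else min a b)"
  define pre where "pre = (if s then [] else [a - b])"
  define lo where "lo = (if s then Suc pa else pa)"
  define M1 where "M1 = (if s then M else M(pa := a - b))"
  define U where "U = butlast as"
  define \<alpha> where "\<alpha> = last A"
  define \<beta> where "\<beta> = last B"
  define Q where "Q R' M' \<longleftrightarrow> R' 0 = run_opt (Suc N) A B s" for R' M' :: "nat \<Rightarrow> nat"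
  have opt: "run_opt (Suc N) A B s = base + (if odd e then min \<alpha> \<beta> else 0) +
    sepmin (Suc N) (pre @ U @ (if odd e then [\<alpha> - \<beta>] else [])) q"
    using AB(3) unfolding run_opt_def Let_def e_def[symmetric] q_def[symmetric]
    by (auto simp: base_def pre_def U_def \<alpha>_def \<beta>_def A)
  \<comment> \<open>Whenever an end is overwritten, \<open>A\<close> has at least two runs, so the
    first and the last cell are distinct.\<close>
  have as1: "as \<noteq> []" if "\<not> s \<or> odd e" using that AB A by (auto simp: e_def split: if_splits)
  have qN: "q \<le> length A" "e \<le> length A" using A AB by (auto simp: q_def e_def)
  have ab: "M pa = a" "M pb = b" "array M (Suc pa) as" "a \<le> N" "b \<le> N"
    using M A sum by (auto simp: array_Cons)
  have lo: "lo + length pre = Suc pa" by (simp add: lo_def pre_def)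
  have arr: "array M1 lo (pre @ as)" using ab by (auto simp: lo_def pre_def M1_def array_Cons array_fun_upd)
  have \<beta>: "M1 (pb + length bs) = \<beta>" using last_array[OF AB(1) M(2)] disj A
    by (auto simp: M1_def \<beta>_def)
  have zero: "M1 (N + N + v) = 0" if "v \<le> N" for v using M(3)[OF that] le A by (auto simp: M1_def)
  have base_le: "base \<le> N" using ab by (auto simp: base_def)
  have pre_le: "sum_list pre \<le> a" by (auto simp: pre_def)
  have sumA: "a + sum_list as \<le> N" using sum A by simp
  \<comment> \<open>Each of the \<open>N + 1\<close> terms of the final sum is at most
    \<open>q \<le> N\<close>; together with a prepayment of at most \<open>2 * N\<close> this is the
    bound \<open>3 * N + N * N\<close>.\<close>
  have w': "b0 + Suc N * q < 2 ^ w" if "b0 \<le> N + N" for b0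
  proof -
    have "Suc N * q \<le> Suc N * N" using qN sum(3) by (intro mult_le_mono2) simp
    then show ?thesis using that w by simp
  qed
  let ?pre2 = "straight [Sub 15 15 3, Load 10 9, Load 11 15, Sub 17 10 11, Sub 18 10 17, Add 0 0 18,
          Store 9 17, Move 9 13]"
  have C: "runs_to w (if_less 4 7 ?pre2 (straight []) ;; select_code) R' M1
      (8 + 2 + (53 * length A + 6 * N + 17)) Q"
    if R': "R' 2 = N" "R' 3 = 1" "R' 4 = 0" "R' 6 = q" "R' 7 = (if odd e then 1 else 0)" "R' 0 = base"
      "R' 8 = lo" "R' 9 = pa + length as" "R' 13 = pa + length A" "R' 15 = pb + length B" for R'
  proof (rule runs_to_if_seqI[OF order_refl])
    assume "R' 4 < R' 7"
    then have odd: "odd e" using R' by (auto split: if_splits)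
    then have ne: "as \<noteq> []" using as1 by simp
    then have as: "as = U @ [\<alpha>]" by (simp add: U_def \<alpha>_def A)
    let ?L = "pre @ U @ [\<alpha> - \<beta>]"
    define M2 where "M2 = M1(pa + length as := \<alpha> - \<beta>)"
    have posn: "pa + length as = Suc (pa + length U)" using as by simp
    have arrU: "array M1 lo pre" "array M1 (Suc pa) U" and \<alpha>M: "M1 (pa + length as) = \<alpha>"
      using arr unfolding as array_append lo by (simp_all add: array_Cons)
    have arr2: "array M2 lo ?L" using arrU lo unfolding M2_def posn array_append
      by (simp add: array_Cons array_fun_upd)
    have lenL: "lo + length ?L = pa + length A" "length ?L \<le> length A" 
      using lo as A by (auto simp: pre_def)
    have \<alpha>N: "\<alpha> \<le> N" using sumA as by simp
    define R2 where "R2 = R'(15 := pb + length bs, 10 := \<alpha>, 11 := \<beta>, 17 := \<alpha> - \<beta>, 18 := min \<alpha> \<beta>,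
      0 := base + min \<alpha> \<beta>, 9 := pa + length A)"
    have "runs_to w select_code R2 M2 (53 * length ?L + 6 * N + 17)
      (\<lambda>R' M'. R' 0 = base + min \<alpha> \<beta> + sepmin (Suc N) ?L q)"
    proof (rule select_code_run)
      show "R2 2 = N" "R2 3 = 1" "R2 6 = q" "R2 0 = base + min \<alpha> \<beta>" "R2 8 = lo" "R2 9 = pa + length A"
        using R' by (simp_all add: R2_def)
      show "array M2 lo ?L" by (rule arr2)
      show "M2 (N + N + v) = 0" if "v \<le> N" for v using zero[OF that] le A by (auto simp: M2_def)
      show "sum_list ?L \<le> N" using sumA pre_le as by auto
      show "base + min \<alpha> \<beta> + Suc N * q < 2 ^ w" using base_le \<alpha>N by (intro w') linarith
      show "lo + length ?L \<le> N + N" using lenL le by linarith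
      show "pa + length A = lo + length ?L \<or> pa + length A \<le> lo \<and> ?L = []" using lenL by simp
    qed (fact w(1))
    then have sel: "runs_to w select_code R2 M2 (53 * length A + 6 * N + 17) Q"
      by (rule runs_to_mono) (use lenL odd opt in \<open>auto simp: Q_def\<close>)
    have m: "x - (x - y) = min x y" for x y :: nat by auto
    show "runs_to w ?pre2 R' M1 8 (\<lambda>R' M'. runs_to w select_code R' M' (53 * length A + 6 * N + 17) Q)"
    proof (rule runs_to_straightI)
      have "base + min \<alpha> \<beta> < 2 ^ w" using w'[of "base + min \<alpha> \<beta>"] base_le \<alpha>N by linarith
      then show "wp w [Sub 15 15 3, Load 10 9, Load 11 15, Sub 17 10 11, Sub 18 10 17, Add 0 0 18,
          Store 9 17, Move 9 13] R' M1
          (\<lambda>R' M'. runs_to w select_code R' M' (53 * length A + 6 * N + 17) Q)"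
        using sel R' \<alpha>M \<beta> A by (simp add: m R2_def M2_def del: min_less_iff_disj)
    qed simp
  next
    assume "\<not> R' 4 < R' 7"
    then have even: "even e" using R' by (auto split: if_splits)
    let ?L = "pre @ U"
    have hi: "pa + length as = lo + length ?L \<or> pa + length as \<le> lo \<and> ?L = []"
      and lenL: "lo + length ?L \<le> pa + length A" "length ?L \<le> length A" and sumL: "sum_list ?L \<le> N"
      and arrL: "array M1 lo ?L"
    proof -
      have *: "(pa + length as = lo + length ?L \<or> pa + length as \<le> lo \<and> ?L = []) \<and>
        lo + length ?L \<le> pa + length A \<and> length ?L \<le> length A \<and> sum_list ?L \<le> N \<and> array M1 lo ?L"
      proof (cases "as = []")
        \<comment> \<open>Only possible for equal first letters: skipping the first cell puts the
          end pointer one below \<open>lo\<close>.\<close>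
        case True
        then show ?thesis using as1 by (auto simp: U_def pre_def lo_def A)
      next
        case False
        then have as: "as = U @ [\<alpha>]" by (simp add: U_def \<alpha>_def A)
        have "length pre \<le> 1" by (simp add: pre_def)
        then show ?thesis using as lo arr A sumA pre_le by (auto simp: array_append)
      qed
      then show "pa + length as = lo + length ?L \<or> pa + length as \<le> lo \<and> ?L = []"
        "lo + length ?L \<le> pa + length A" "length ?L \<le> length A" "sum_list ?L \<le> N" "array M1 lo ?L"
        by blast+
    qed
    have "runs_to w select_code R' M1 (53 * length ?L + 6 * N + 17)
      (\<lambda>R' M'. R' 0 = base + sepmin (Suc N) ?L q)"
    proof (rule select_code_run)
      show "R' 2 = N" "R' 3 = 1" "R' 6 = q" "R' 0 = base" "R' 8 = lo" "R' 9 = pa + length as"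
        by (fact R')+
      show "M1 (N + N + v) = 0" if "v \<le> N" for v using zero[OF that] .
      show "base + Suc N * q < 2 ^ w" using base_le by (intro w') linarith
      show "lo + length ?L \<le> N + N" using lenL le by linarith
    qed (fact hi sumL arrL w(1))+
    then have sel: "runs_to w select_code R' M1 (53 * length A + 6 * N + 17) Q"
      by (rule runs_to_mono) (use lenL even opt in \<open>auto simp: Q_def\<close>)
    then show "runs_to w (straight []) R' M1 8 (\<lambda>R' M'. runs_to w select_code R' M' (53 * length A + 6 * N + 17) Q)"
      by (intro runs_to_straightI) auto
  qed
  let ?rest2 = "if_less 4 7 ?pre2 (straight []) ;; select_code"
  let ?pre1 = "straight [Load 10 12, Load 11 14, Sub 17 10 11, Sub 0 10 17, Store 12 17, Move 8 12]"
  have B: "runs_to w (if_less 4 16 ?pre1 (straight []) ;; ?rest2) R' M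
      (6 + 2 + (8 + 2 + (53 * length A + 6 * N + 17))) Q"
    if R': "R' 2 = N" "R' 3 = 1" "R' 4 = 0" "R' 6 = q" "R' 7 = (if odd e then 1 else 0)" "R' 0 = 0"
      "R' 8 = Suc pa" "R' 9 = pa + length as" "R' 12 = pa" "R' 13 = pa + length A" 
      "R' 14 = pb" "R' 15 = pb + length B" "R' 16 = (if s then 0 else 1)" for R'
  proof (rule runs_to_if_seqI[OF order_refl])
    assume "R' 4 < R' 16"
    then have s: "\<not> s" using R' by auto
    have "runs_to w ?rest2 (R'(10 := a, 11 := b, 17 := a - b, 0 := min a b, 8 := pa)) M1
      (8 + 2 + (53 * length A + 6 * N + 17)) Q"
      using R' s by (intro C) (simp_all add: base_def lo_def)
    moreover have m: "x - (x - y) = min x y" for x y :: nat by auto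
    ultimately show "runs_to w ?pre1 R' M 6 (\<lambda>R' M'. runs_to w ?rest2 R' M' (8 + 2 + (53 * length A + 6 * N + 17)) Q)"
      using R' s ab by (intro runs_to_straightI) (simp_all add: m M1_def)
  next
    assume "\<not> R' 4 < R' 16"
    then have s: "s" using R' by (auto split: if_splits)
    have "runs_to w ?rest2 R' M1 (8 + 2 + (53 * length A + 6 * N + 17)) Q"
      using R' s by (intro C) (simp_all add: base_def lo_def)
    then show "runs_to w (straight []) R' M 6 (\<lambda>R' M'. runs_to w ?rest2 R' M' (8 + 2 + (53 * length A + 6 * N + 17)) Q)"
      using s by (intro runs_to_straightI) (simp_all add: M1_def)
  qed
  let ?rest1 = "if_less 4 16 ?pre1 (straight []) ;; ?rest2"
  define R1 where "R1 = R(5 := e, 6 := 0, 7 := 0, 0 := 0, 8 := Suc pa, 9 := pa + length as)"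
  have loop: "runs_to w (while_less 7 5 (straight [Add 6 6 3, Add 7 7 3, Add 7 7 3]) ;;
     straight [Sub 7 7 5] ;; ?rest1) R1 M (58 * length A + 6 * N + 38) Q"
  proof (rule runs_to_seqI[OF halve_run[of R1 e w M]])
    show "R1 3 = 1" "R1 5 = e" "R1 6 = 0" "R1 7 = 0" using R by (simp_all add: R1_def)
    show "e + 2 < 2 ^ w" using qN sum(3) w by linarith
    show "(e + 1) div 2 * 5 + 2 + (1 + (6 + 2 + (8 + 2 + (53 * length A + 6 * N + 17)))) \<le> 58 * length A + 6 * N + 38"
      using qN(1) by (simp add: q_def)
  next
    fix R' M' assume "M' = M \<and> R' = R1(6 := (e + 1) div 2, 7 := 2 * ((e + 1) div 2))"
    then have *: "M' = M" "R' = R1(6 := q, 7 := 2 * q)" by (simp_all add: q_def)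
    \<comment> \<open>Since \<open>q\<close> is \<open>e / 2\<close> rounded up, the excess of
      \<open>2 * q\<close> over \<open>e\<close> is the parity of \<open>e\<close>.\<close>
    have sub: "2 * q - e = (if odd e then 1 else 0)" unfolding q_def by presburger
    have "runs_to w ?rest1 (R'(7 := if odd e then 1 else 0)) M (6 + 2 + (8 + 2 + (53 * length A + 6 * N + 17))) Q"
      by (rule B) (use R * in \<open>simp_all add: R1_def\<close>)
    moreover have "R' 7 - R' 5 = (if odd e then 1 else 0)" using * sub by (simp add: R1_def)
    ultimately show "runs_to w (straight [Sub 7 7 5] ;; ?rest1) R' M' (1 + (6 + 2 + (8 + 2 + (53 * length A + 6 * N + 17)))) Q"
      using *(1) by (intro runs_to_straight_seqI) simp_all
  qed
  have "R 5 + R 16 = e" "e < 2 ^ w" using R qN sum(3) w by (simp_all add: e_def)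
  then have "runs_to w core_code R M (58 * length A + 6 * N + 44) Q"
    unfolding core_code_def using loop R(2,5,6) A w le
    by (intro runs_to_straight_seqI) (simp_all add: R1_def add.commute)
  then show ?thesis by (simp add: Q_def[abs_def])
qed

text \<open>Subtracting the surplus of runs from the distance of the first letters gives a positive
  value exactly when the letters differ and the numbers of runs are equal.\<close>

definition decide_code :: block where
  "decide_code = straight [Sub 5 17 18, Sub 6 16 5] ;; if_less 4 6 equal_code core_code"

lemma decide_code_run:
  assumes AB: "B \<noteq> []" "length B \<le> length A"
    and R: "R 2 = N" "R 3 = 1" "R 4 = 0" "R 12 = pa" "R 13 = pa + length A"
      "R 14 = pb" "R 15 = pb + length B" "R 16 = (if s then 0 else 1)" "R 17 = length A" "R 18 = length B"
    and M: "array M pa A" "array M pb B" "\<And>v. v \<le> N \<Longrightarrow> M (N + N + v) = 0"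
    and disj: "pa + length A \<le> pb \<or> pb + length B \<le> pa"
    and sum: "sum_list A \<le> N" "sum_list B \<le> N" "length A \<le> N"
    and le: "pa + length A \<le> N + N" "pb + length B \<le> N + N"
    and w: "3 * N + 2 < 2 ^ w" "3 * N + N * N < 2 ^ w"
  shows "runs_to w decide_code R M (64 * N + 48) (\<lambda>R' M'. R' 0 = run_opt (Suc N) A B s)"
proof -
  define R1 where "R1 = R(5 := length A - length B, 6 := (if s then 0 else 1) - (length A - length B))"
  have "runs_to w (if_less 4 6 equal_code core_code) R1 M (64 * N + 46)
    (\<lambda>R' M'. R' 0 = run_opt (Suc N) A B s)"
  proof (rule runs_to_ifI)
    assume "R1 4 < R1 6"
    then have eq: "length A = length B" "\<not> s" using R AB(2) by (auto simp: R1_def split: if_splits)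
    have "runs_to w equal_code R1 M (10 * length A + 20) (\<lambda>R' M'. R' 0 = run_opt (Suc N) A B False)"
      by (rule equal_code_run[where pa = pa and pb = pb]) (use eq AB R M sum le w in \<open>auto simp: R1_def\<close>)
    then show "runs_to w equal_code R1 M (64 * N + 46 - 2) (\<lambda>R' M'. R' 0 = run_opt (Suc N) A B s)"
      by (rule runs_to_mono) (use eq sum(3) in auto)
  next
    assume "\<not> R1 4 < R1 6"
    then have eq: "length A = length B \<Longrightarrow> s" using R by (auto simp: R1_def split: if_splits)
    have "runs_to w core_code R1 M (58 * length A + 6 * N + 44) (\<lambda>R' M'. R' 0 = run_opt (Suc N) A B s)"
      by (rule core_code_run[where pa = pa and pb = pb, OF AB eq])
        (use R M disj sum le w in \<open>simp_all add: R1_def\<close>)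
    then show "runs_to w core_code R1 M (64 * N + 46 - 2) (\<lambda>R' M'. R' 0 = run_opt (Suc N) A B s)"
      by (rule runs_to_mono) (use sum(3) in auto)
  qed simp
  then show ?thesis unfolding decide_code_def
    using R by (intro runs_to_straight_seqI) (simp_all add: R1_def add.commute)
qed

text \<open>
  The run lengths of \<open>x\<close> and \<open>y\<close> are stored from the addresses \<open>N\<close> and \<open>N + length x\<close> on; registers 12 to
  15 delimit the two lists, the longer one first, and register 16 holds the distance of the first
  letters.
\<close>

definition main_code :: block where
  "main_code = straight [Load 16 5, Load 17 0, Sub 18 16 17, Sub 17 17 16, Add 16 18 17, Move 6 0, Move 7 2] ;;
     rle_code ;;
     straight [Move 12 2, Add 13 7 3, Move 6 2, Add 7 5 2] ;;
     rle_code ;;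
     straight [Add 14 0 2, Add 15 7 3, Sub 17 13 12, Sub 18 15 14] ;;
     if_less 17 18
       (straight [Move 5 12, Move 12 14, Move 14 5, Move 5 13, Move 13 15, Move 15 5,
          Move 5 17, Move 17 18, Move 18 5])
       (straight []) ;;
     decide_code"

text \<open>Register 4 is never written and supplies the constant zero. For two empty strings
  register 0 already contains the answer.\<close>

definition dtw_code :: block where
  "dtw_code = straight [Const 3 1, Add 2 0 1] ;; if_less 4 0 main_code (straight [])"

lemma array_cong: "array M p L \<Longrightarrow> (\<And>a. p \<le> a \<Longrightarrow> a < p + length L \<Longrightarrow> M' a = M a) \<Longrightarrow> array M' p L"
  by (simp add: array_def)

lemma main_code_run:
  assumes x: "x \<noteq> []" "set x \<subseteq> {0, 1}" and y: "y \<noteq> []" "set y \<subseteq> {0, 1}"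
    and N: "N = length x + length y"
    and R: "R 0 = length x" "R 2 = N" "R 3 = 1" "R 4 = 0" "R 5 = 0"
    and M: "array M 0 (x @ y)" "\<And>a. N \<le> a \<Longrightarrow> M a = 0"
    and w: "3 * N + 2 < 2 ^ w" "3 * N + N * N < 2 ^ w"
  shows "runs_to w main_code R M (76 * N + 80) (\<lambda>R' M'. R' 0 = dtw x y)"
proof -
  define Q where "Q R' M' \<longleftrightarrow> R' 0 = dtw x y" for R' M' :: "nat \<Rightarrow> nat"
  define n where "n = length x"
  define A where "A = run_lengths x"
  define B where "B = run_lengths y"
  define s where "s \<longleftrightarrow> hd x = hd y"
  have ne: "A \<noteq> []" "B \<noteq> []" using x y by (auto simp: A_def B_def neq_Nil_conv)
  have sum: "sum_list A = n" "sum_list B = length y" by (simp_all add: A_def B_def n_def sum_list_run_lengths)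
  have len: "length A \<le> n" "length B \<le> length y" using length_runs_le by (auto simp: A_def B_def n_def)
  have dtw: "dtw x y = (if length B \<le> length A then run_opt (Suc N) A B s else run_opt (Suc N) B A s)"
    using dtw_eq_run_opt[OF x(2) y(2) x(1) y(1), of "Suc N"] N by (simp add: A_def B_def s_def)
  have arrx: "array M 0 x" "array M n y" using M(1) by (auto simp: array_append n_def)
  let ?swap = "straight [Move 5 12, Move 12 14, Move 14 5, Move 5 13, Move 13 15, Move 15 5,
          Move 5 17, Move 17 18, Move 18 5]"
  have C: "runs_to w (if_less 17 18 ?swap (straight []) ;; decide_code) R' M' (9 + 2 + (64 * N + 48)) Q"
    if R': "R' 2 = N" "R' 3 = 1" "R' 4 = 0" "R' 12 = N" "R' 13 = N + length A"
      "R' 14 = N + n" "R' 15 = N + n + length B" "R' 16 = (if s then 0 else 1)" "R' 17 = length A"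
      "R' 18 = length B"
      and M': "array M' N A" "array M' (N + n) B" "\<And>v. v \<le> N \<Longrightarrow> M' (N + N + v) = 0" for R' M'
  proof (rule runs_to_if_seqI[OF order_refl])
    assume "R' 17 < R' 18"
    then have l: "length A \<le> length B" "\<not> length B \<le> length A" using R' by auto
    define R2 where "R2 = R'(12 := N + n, 14 := N, 13 := N + n + length B, 15 := N + length A,
      17 := length B, 5 := length A, 18 := length A)"
    have "runs_to w decide_code R2 M' (64 * N + 48) (\<lambda>R' M'. R' 0 = run_opt (Suc N) B A s)"
      by (rule decide_code_run[where pa = "N + n" and pb = N])
        (use l ne R' M' sum len N w in \<open>auto simp: R2_def n_def\<close>)
    then have "runs_to w decide_code R2 M' (64 * N + 48) Q"
      by (rule runs_to_mono) (use l dtw in \<open>auto simp: Q_def\<close>)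
    then show "runs_to w ?swap R' M' 9 (\<lambda>R' M'. runs_to w decide_code R' M' (64 * N + 48) Q)"
      using R' by (intro runs_to_straightI) (auto simp: R2_def fun_upd_twist)
  next
    assume "\<not> R' 17 < R' 18"
    then have l: "length B \<le> length A" using R' by auto
    have "runs_to w decide_code R' M' (64 * N + 48) (\<lambda>R' M'. R' 0 = run_opt (Suc N) A B s)"
      by (rule decide_code_run[where pa = N and pb = "N + n"])
        (use l ne R' M' sum len N w in \<open>auto simp: n_def\<close>)
    then have "runs_to w decide_code R' M' (64 * N + 48) Q"
      by (rule runs_to_mono) (use l dtw in \<open>auto simp: Q_def\<close>)
    then show "runs_to w (straight []) R' M' 9 (\<lambda>R' M'. runs_to w decide_code R' M' (64 * N + 48) Q)"
      by (intro runs_to_straightI) auto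
  qed
  let ?C = "if_less 17 18 ?swap (straight []) ;; decide_code"
  let ?D = "straight [Add 14 0 2, Add 15 7 3, Sub 17 13 12, Sub 18 15 14] ;; ?C"
  have B: "runs_to w (rle_code ;; ?D) R' M' (12 * length y + 3 + (4 + (9 + 2 + (64 * N + 48)))) Q"
    if R': "R' 0 = n" "R' 2 = N" "R' 3 = 1" "R' 4 = 0" "R' 5 = n" "R' 6 = N" "R' 7 = N + n" "R' 12 = N" 
      "R' 13 = N + length A" "R' 16 = (if s then 0 else 1)"
      and M': "array M' N A" "\<And>a. a < N \<or> N + length A \<le> a \<Longrightarrow> M' a = M a" for R' M'
  proof (rule runs_to_seqI[OF _ _ order_refl])
    show "runs_to w rle_code R' M' (12 * length y + 3)
      (\<lambda>R'' M''. (\<forall>i. i \<notin> {5, 7, 8, 9, 10, 11} \<longrightarrow> R'' i = R' i) \<and> R'' 5 = n + length y \<and>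
       R'' 7 + 1 = N + n + length (runs y) \<and> array M'' (N + n) (run_lengths y) \<and>
       (\<forall>a. a < N + n \<or> N + n + length (runs y) \<le> a \<longrightarrow> M'' a = M' a))"
    proof (rule rle_code_run[OF y])
      show "array M' n y" by (rule array_cong[OF arrx(2)]) (use M' N in \<open>auto simp: n_def\<close>)
      show "M' (N + n + i) = 0" if "i < length y" for i using M'(2)[of "N + n + i"] M(2) len by auto
    qed (use R' N w in \<open>auto simp: n_def\<close>)
  next
    fix R2 M2 assume *: "(\<forall>i. i \<notin> {5, 7, 8, 9, 10, 11} \<longrightarrow> R2 i = R' i) \<and> R2 5 = n + length y \<and>
       R2 7 + 1 = N + n + length (runs y) \<and> array M2 (N + n) (run_lengths y) \<and>
       (\<forall>a. a < N + n \<or> N + n + length (runs y) \<le> a \<longrightarrow> M2 a = M' a)"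
    then have keep: "R2 i = R' i" if "i \<notin> {5, 7, 8, 9, 10, 11}" for i using that by blast
    have R2: "R2 0 = n" "R2 2 = N" "R2 3 = 1" "R2 4 = 0" "R2 12 = N" "R2 13 = N + length A"
      "R2 16 = (if s then 0 else 1)" using keep R' by simp_all
    have R7: "Suc (R2 7) = N + n + length B" using * by (simp add: B_def)
    have M2: "array M2 (N + n) B" using * by (simp add: B_def)
    have M2_eq: "M2 a = M' a" if "a < N + n \<or> N + n + length B \<le> a" for a
      using * that unfolding B_def length_map by blast
    have M2A: "array M2 N A" by (rule array_cong[OF M'(1)], rule M2_eq) (use len in auto)
    \<comment> \<open>Both lists of run lengths end by address \<open>2 * N\<close>, so the counters
      above are still zero.\<close>
    have Z: "M2 (N + N + v) = 0" if "v \<le> N" for v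
    proof -
      have "M2 (N + N + v) = M' (N + N + v)" using len N by (intro M2_eq) (auto simp: n_def)
      also have "\<dots> = M (N + N + v)" using len N by (intro M'(2)) (auto simp: n_def)
      finally show ?thesis using M(2) by simp
    qed
    have "runs_to w ?C (R2(14 := N + n, 15 := N + n + length B, 17 := length A, 18 := length B)) M2
      (9 + 2 + (64 * N + 48)) Q"
    proof (rule C)
      show "array M2 N A" "array M2 (N + n) B" by (fact M2A M2)+
      show "M2 (N + N + v) = 0" if "v \<le> N" for v by (rule Z[OF that])
    qed (use R2 in simp_all)
    moreover have "N + n + length B < 2 ^ w" using len N w by (simp add: n_def)
    ultimately show "runs_to w ?D R2 M2 (4 + (9 + 2 + (64 * N + 48))) Q"
      using R2 R7 by (intro runs_to_straight_seqI) (simp_all add: add.commute)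
  qed
  let ?E = "straight [Move 12 2, Add 13 7 3, Move 6 2, Add 7 5 2] ;; rle_code ;; ?D"
  have D: "runs_to w (rle_code ;; ?E) R' M 
      (12 * n + 3 + (4 + (12 * length y + 3 + (4 + (9 + 2 + (64 * N + 48)))))) Q"
    if R': "R' 0 = n" "R' 2 = N" "R' 3 = 1" "R' 4 = 0" "R' 5 = 0" "R' 6 = n" "R' 7 = N" 
      "R' 16 = (if s then 0 else 1)" for R'
  proof (rule runs_to_seqI[OF _ _ order_refl])
    show "runs_to w rle_code R' M (12 * n + 3)
      (\<lambda>R'' M''. (\<forall>i. i \<notin> {5, 7, 8, 9, 10, 11} \<longrightarrow> R'' i = R' i) \<and> R'' 5 = 0 + n \<and>
       R'' 7 + 1 = N + length (runs x) \<and> array M'' N (run_lengths x) \<and>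
       (\<forall>a. a < N \<or> N + length (runs x) \<le> a \<longrightarrow> M'' a = M a))"
      unfolding n_def
      by (rule rle_code_run[OF x]) (use R' N w M(2) arrx in \<open>auto simp: n_def\<close>)
  next
    fix R2 M2 assume *: "(\<forall>i. i \<notin> {5, 7, 8, 9, 10, 11} \<longrightarrow> R2 i = R' i) \<and> R2 5 = 0 + n \<and>
       R2 7 + 1 = N + length (runs x) \<and> array M2 N (run_lengths x) \<and>
       (\<forall>a. a < N \<or> N + length (runs x) \<le> a \<longrightarrow> M2 a = M a)"
    then have keep: "R2 i = R' i" if "i \<notin> {5, 7, 8, 9, 10, 11}" for i using that by blast
    have R2: "R2 0 = n" "R2 2 = N" "R2 3 = 1" "R2 4 = 0" "R2 16 = (if s then 0 else 1)"
      using keep R' by simp_all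
    have R57: "R2 5 = n" "Suc (R2 7) = N + length A" using * by (simp_all add: A_def)
    have M2: "array M2 N A" using * by (simp add: A_def)
    have M2_eq: "M2 a = M a" if "a < N \<or> N + length A \<le> a" for a
      using * that unfolding A_def length_map by blast
    have "runs_to w (rle_code ;; ?D) (R2(12 := N, 13 := N + length A, 6 := N, 7 := N + n)) M2
      (12 * length y + 3 + (4 + (9 + 2 + (64 * N + 48)))) Q"
    proof (rule B)
      show "array M2 N A" by (fact M2)
      show "M2 a = M a" if "a < N \<or> N + length A \<le> a" for a by (rule M2_eq[OF that])
    qed (use R2 R57 in simp_all)
    moreover have "N + length A < 2 ^ w" "N + n < 2 ^ w" using len N w by (simp_all add: n_def)
    ultimately show "runs_to w ?E R2 M2 (4 + (12 * length y + 3 + (4 + (9 + 2 + (64 * N + 48))))) Q"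
      using R2 R57 by (intro runs_to_straight_seqI) (simp_all add: add.commute)
  qed
  have hd: "M 0 = hd x" "M n = hd y" using arrx x y by (auto simp: array_def hd_conv_nth)
  have "hd x \<in> {0, 1}" "hd y \<in> {0, 1}" using x y hd_in_set by blast+
  then have d: "(hd x - hd y) + (hd y - hd x) = (if s then 0 else 1)" by (auto simp: s_def)
  have "runs_to w (rle_code ;; ?E) (R(18 := hd x - hd y, 17 := hd y - hd x, 16 := if s then 0 else 1, 6 := n, 7 := N)) M
    (12 * n + 3 + (4 + (12 * length y + 3 + (4 + (9 + 2 + (64 * N + 48)))))) Q"
    by (rule D) (use R in \<open>simp_all add: n_def\<close>)
  then have "runs_to w (rle_code ;; ?E) (R(18 := hd x - hd y, 17 := hd y - hd x, 16 := if s then 0 else 1, 6 := n, 7 := N)) M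
    (76 * N + 80 - 7) Q"
    by (rule runs_to_mono) (auto simp: n_def N)
  then have "runs_to w main_code R M (76 * N + 80) Q" unfolding main_code_def
    using R hd d w by (intro runs_to_straight_seqI) (simp_all add: n_def fun_upd_twist)
  then show ?thesis by (simp add: Q_def[abs_def])
qed

text \<open>The logarithm is doubled to accommodate the term \<open>N * N\<close>. Two more bits
  give the factor 4, which absorbs the linear terms also for \<open>N = 0\<close>.\<close>

definition word_size :: "nat \<Rightarrow> nat" where
  "word_size N = 2 * nat \<lceil>log 2 (real N + 1)\<rceil> + 2"

lemma word_size_ge: "4 * (N + 1) ^ 2 \<le> (2::nat) ^ word_size N"
proof -
  define k where "k = nat \<lceil>log 2 (real N + 1)\<rceil>"
  have "log 2 (real N + 1) \<le> real k" unfolding k_def by linarith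
  then have "2 powr log 2 (real N + 1) \<le> 2 powr real k" by (intro powr_mono) auto
  then have "real (N + 1) \<le> real (2 ^ k)" by (simp add: powr_realpow)
  then have "N + 1 \<le> 2 ^ k" by (simp only: of_nat_le_iff)
  then have "(N + 1) ^ 2 \<le> (2 ^ k) ^ 2" by (rule power_mono) simp
  moreover have "(2::nat) ^ word_size N = 4 * (2 ^ k) ^ 2"
    by (simp add: word_size_def k_def[symmetric] power_add power_mult[symmetric] mult.commute)
  ultimately show ?thesis by linarith
qed

lemma word_size_bigo: "(\<lambda>N. real (word_size N)) \<in> O(\<lambda>N. ln (real N))"
proof -
  have "real (word_size N) \<le> 2 * log 2 (real N + 1) + 4" for N
  proof -
    have "0 \<le> log 2 (real N + 1)" by simp
    then show ?thesis unfolding word_size_def by linarith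
  qed
  then have "(\<lambda>N. real (word_size N)) \<in> O(\<lambda>N. 2 * log 2 (real N + 1) + 4)"
    by (intro bigoI[of _ 1] always_eventually allI) (auto intro: order_trans)
  also have "(\<lambda>N. 2 * log 2 (real N + 1) + 4) \<in> O(\<lambda>N. ln (real N))" by real_asymp
  finally show ?thesis .
qed

text \<open>The factor 76 collects, per unit of input length, 12 steps for encoding, 5 for halving
  the surplus, 53 for contraction and unloading, and 6 for counting by value.\<close>

lemma dtw_code_computes:
  assumes "x \<in> binary_strings n" "y \<in> binary_strings m" "correspondences x y \<noteq> {}"
  shows "ram_computes (word_size (n + m)) (dtw_code 0) (ram_input x y) (dtw x y) (76 * (n + m) + 84)"
proof -
  define N where "N = n + m"
  define w where "w = word_size N"
  define R where "R = ((\<lambda>_. 0)(0 := length x, 1 := length y) :: nat \<Rightarrow> nat)"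
  define M where "M = (\<lambda>a. if a < length x + length y then (x @ y) ! a else 0)"
  have x: "set x \<subseteq> {0, 1}" "length x = n" and y: "set y \<subseteq> {0, 1}" "length y = m"
    using assms by (auto simp: binary_strings_def)
  have xy: "x = [] \<longleftrightarrow> y = []" using assms(3) correspondences_nonempty_iff by blast
  have "4 * (N + 1) ^ 2 \<le> 2 ^ w" unfolding w_def by (rule word_size_ge)
  moreover have "4 * (N + 1) ^ 2 = 4 * (N * N) + 8 * N + 4" by (simp add: power2_eq_square algebra_simps)
  ultimately have w: "3 * N + 2 < 2 ^ w" "3 * N + N * N < 2 ^ w" by linarith+
  have fits: "fits_words w (Config 0 R M)"
  proof -
    have "(x @ y) ! a < 2 ^ w" if "a < length x + length y" for a
    proof -
      have "(x @ y) ! a \<in> set (x @ y)" using that by (intro nth_mem) simp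
      then have "(x @ y) ! a \<in> {0, 1}" using x(1) y(1) by auto
      then show ?thesis using w(1) by auto
    qed
    then show ?thesis using w(1) x(2) y(2) by (auto simp: fits_words_def R_def M_def N_def)
  qed
  have "runs_to w (if_less 4 0 main_code (straight [])) (R(3 := 1, 2 := N)) M (76 * N + 82)
    (\<lambda>R' M'. R' 0 = dtw x y)"
  proof (rule runs_to_ifI)
    assume "(R(3 := 1, 2 := N)) 4 < (R(3 := 1, 2 := N)) 0"
    then have "x \<noteq> []" by (simp add: R_def)
    then have "runs_to w main_code (R(3 := 1, 2 := N)) M (76 * N + 80) (\<lambda>R' M'. R' 0 = dtw x y)"
      using x y xy w by (intro main_code_run) (auto simp: N_def R_def M_def array_def)
    then show "runs_to w main_code (R(3 := 1, 2 := N)) M (76 * N + 82 - 2) (\<lambda>R' M'. R' 0 = dtw x y)"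
      by (simp add: add.commute)
  next
    assume "\<not> (R(3 := 1, 2 := N)) 4 < (R(3 := 1, 2 := N)) 0"
    then have e: "x = []" "y = []" using xy by (simp_all add: R_def)
    have "correspondences ([] :: nat list) [] = {([], [])}"
      by (auto simp: correspondences_def expansions_Nil)
    then have "dtw x y = 0" by (simp add: e dtw_def correspondence_value_def)
    then show "runs_to w (straight []) (R(3 := 1, 2 := N)) M (76 * N + 82 - 2) (\<lambda>R' M'. R' 0 = dtw x y)"
      using e by (intro runs_to_straightI) (simp_all add: R_def)
  qed simp
  then have "runs_to w dtw_code R M (76 * N + 84) (\<lambda>R' M'. R' 0 = dtw x y)" unfolding dtw_code_def
    using w x(2) y(2) by (intro runs_to_straight_seqI) (simp_all add: R_def N_def add.commute)
  then have "ram_computes w (dtw_code 0) (Config 0 R M) (dtw x y) (76 * N + 84)"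
    by (rule runs_to_ram_computes[OF _ fits])
  then show ?thesis by (simp add: ram_input_def R_def M_def w_def N_def)
qed

theorem theorem1:
  "\<exists>(P :: ram_program) (T :: nat \<Rightarrow> nat) (w :: nat \<Rightarrow> nat).
     (\<lambda>N. real (T N)) \<in> O(\<lambda>N. real N) \<and>
     (\<lambda>N. real (w N)) \<in> O(\<lambda>N. ln (real N)) \<and>
     (\<forall>n m. \<forall>x \<in> binary_strings n. \<forall>y \<in> binary_strings m.
        correspondences x y \<noteq> {} \<longrightarrow>
        ram_computes (w (n + m)) P (ram_input x y) (dtw x y) (T (n + m)))"
proof (intro exI conjI allI ballI impI)
  have "(\<lambda>N. 76 * real N + 84) \<in> O(\<lambda>N. real N)" by real_asymp
  then show "(\<lambda>N. real (76 * N + 84)) \<in> O(\<lambda>N. real N)" by simp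
  show "(\<lambda>N. real (word_size N)) \<in> O(\<lambda>N. ln (real N))" by (rule word_size_bigo)
qed (rule dtw_code_computes)

end
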